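(* Let $N\ge3$ and let $\mathcal X=\{X_1,\dots,X_m\}$, $m\le N$, be linearly independent smooth vector fields on $\mathbb{R}^N$ such that (i) each $X_i$ is homogeneous of degree one with respect to a family of dilations $\delta_\lambda(x)=(\lambda^{\sigma_1}x_1,\dots,\lambda^{\sigma_N}x_N)$, $\lambda>0$, where $1=\sigma_1\le\dots\le\sigma_N$ are positive integers; and (ii) $\mathcal X$ satisfies the H\"ormander (bracket generating) condition. If $u$ is a classical solution of $$-\Delta_{\mathcal X}u+|D_{\mathcal X}u|^2=0\quad\text{in }\mathbb{R}^N,$$ then $u$ is constant.
   Context: $D_{\mathcal X}u=(X_1u,\dots,X_mu)\in\mathbb{R}^m$ is the horizontal gradient and $\Delta_{\mathcal X}u=\sum_{i=1}^mX_i^2u$. A vector field $X$ is $\delta_\lambda$-homogeneous of degree one if $X(\varphi\circ\delta_\lambda)=\lambda (X\varphi)\circ\delta_\lambda$ for all smooth $\varphi$ and $\lambda>0$. The H\"ormander condition means that the Lie algebra generated by $X_1,\dots,X_m$ spans $\mathbb{R}^N$ at every point. *)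

theory Defs
  imports "HOL-Analysis.Analysis"
begin

text \<open>A vector field on R^N is represented by its coefficient map x |-> X(x) in R^N.
  It acts on a scalar function u by (X u)(x) = Du(x)[X(x)] = sum_j X_j(x) d_j u(x).\<close>

definition vf_apply :: "(real^'n \<Rightarrow> real^'n) \<Rightarrow> (real^'n \<Rightarrow> real) \<Rightarrow> real^'n \<Rightarrow> real" where
  "vf_apply X u x = frechet_derivative u (at x) (X x)"

definition pderiv_j :: "'n \<Rightarrow> (real^'n \<Rightarrow> real) \<Rightarrow> real^'n \<Rightarrow> real" where
  "pderiv_j j u x = frechet_derivative u (at x) (axis j 1)"

fun Ck :: "nat \<Rightarrow> (real^'n \<Rightarrow> real) \<Rightarrow> bool" where
  "Ck 0 u = continuous_on UNIV u"
| "Ck (Suc k) u = ((\<forall>x. u differentiable (at x)) \<and> (\<forall>j. Ck k (pderiv_j j u)))"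

definition smooth_fun :: "(real^'n \<Rightarrow> real) \<Rightarrow> bool" where
  "smooth_fun u = (\<forall>k. Ck k u)"

definition smooth_vf :: "(real^'n \<Rightarrow> real^'n) \<Rightarrow> bool" where
  "smooth_vf X = (\<forall>i. smooth_fun (\<lambda>x. X x $ i))"

definition dil :: "('n \<Rightarrow> nat) \<Rightarrow> real \<Rightarrow> real^'n \<Rightarrow> real^'n" where
  "dil \<sigma> t x = (\<chi> i. t ^ \<sigma> i * x $ i)"

definition homogeneous_deg1 :: "('n \<Rightarrow> nat) \<Rightarrow> (real^'n \<Rightarrow> real^'n) \<Rightarrow> bool" where
  "homogeneous_deg1 \<sigma> X =
     (\<forall>\<phi> t. smooth_fun \<phi> \<and> t > 0 \<longrightarrow>
        (\<forall>x. vf_apply X (\<phi> \<circ> dil \<sigma> t) x = t * vf_apply X \<phi> (dil \<sigma> t x)))"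

text \<open>Lie bracket [X,Y] = XY - YX, in coefficients: DY(x)[X(x)] - DX(x)[Y(x)].\<close>
definition lie_bracket :: "(real^'n \<Rightarrow> real^'n) \<Rightarrow> (real^'n \<Rightarrow> real^'n) \<Rightarrow> real^'n \<Rightarrow> real^'n" where
  "lie_bracket X Y x = frechet_derivative Y (at x) (X x) - frechet_derivative X (at x) (Y x)"

inductive_set lie_alg :: "(nat \<Rightarrow> real^'n \<Rightarrow> real^'n) \<Rightarrow> nat \<Rightarrow> (real^'n \<Rightarrow> real^'n) set"
  for X m where
  gen: "i < m \<Longrightarrow> X i \<in> lie_alg X m"
| add: "V \<in> lie_alg X m \<Longrightarrow> W \<in> lie_alg X m \<Longrightarrow> (\<lambda>x. V x + W x) \<in> lie_alg X m"
| scale: "V \<in> lie_alg X m \<Longrightarrow> (\<lambda>x. c *\<^sub>R V x) \<in> lie_alg X m"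
| bracket: "V \<in> lie_alg X m \<Longrightarrow> W \<in> lie_alg X m \<Longrightarrow> lie_bracket V W \<in> lie_alg X m"

definition hoermander :: "(nat \<Rightarrow> real^'n \<Rightarrow> real^'n) \<Rightarrow> nat \<Rightarrow> bool" where
  "hoermander X m = (\<forall>x. span {V x | V. V \<in> lie_alg X m} = UNIV)"

definition vf_lin_indep :: "(nat \<Rightarrow> real^'n \<Rightarrow> real^'n) \<Rightarrow> nat \<Rightarrow> bool" where
  "vf_lin_indep X m =
     (\<forall>c::nat \<Rightarrow> real. (\<forall>x. (\<Sum>i<m. c i *\<^sub>R X i x) = 0) \<longrightarrow> (\<forall>i<m. c i = 0))"

end

theory Submission
  imports Defs
begin

text \<open>The function v = exp (-u) is a positive solution of the linear equation, and so is v - a whenever a is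
  below its infimum. Hence it suffices to bound the oscillation of u by a constant that is the same for
  all solutions; letting a tend to the infimum then makes v constant. The dilations preserve the set of
  solutions, so it is enough to bound the oscillation over the unit ball.

  For this, homogeneity makes the coefficients of the fields weighted polynomials; their flows are
  polynomial and triangular, hence preserve Lebesgue measure. Commutators of flows realise the brackets,
  and by the bracket condition at 0 one obtains words of flows that translate a coordinate and only
  disturb coordinates of higher weight. Composing them gives a measure-preserving parametrisation of the
  space from any base point whose increments are controlled by the horizontal gradient, and thus a Nash
  and a Poincare inequality. Combined with the Caccioppoli inequalities for powers of v they give
  local boundedness in the manner of Moser, with constants independent of the exponent, and the argument of
  Bombieri and Giusti, started from the square integrability of u = -log v, bounds u on the unit ball.\<close>

text \<open>All estimates are made on Euclidean balls of fixed size, so neither a control distance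
  nor a doubling property enters. The ball-box theorem is replaced by exact algebra: a bracket of
  degree \<open>k\<close> maps a coordinate of weight at most \<open>k\<close> to a constant, and
  the error of a commutator word has negative degree there, hence is 0. So the words translate such
  coordinates exactly, and \<open>G\<close> is triangular with unit diagonal both in the point and
  in the parameter: no Jacobian has to be estimated. The quadratic term of the equation bounds the
  energy of a solution on a ball by a constant that ignores the solution; this is the source of the
  square integrability of u up to an additive constant. Moser's iteration treats positive and
  negative powers of v separately, and the passage through the exponent 0 would usually rest on the
  John-Nirenberg lemma. The argument of Bombieri and Giusti gets by with a weak bound on u, provided
  the estimates are uniform as the exponent tends to 0.\<close>

lemma has_derivative_vecI:
  fixes f :: "'a::real_normed_vector \<Rightarrow> real^'n"
  assumes "\<And>i. ((\<lambda>x. f x $ i) has_derivative (\<lambda>h. f' h $ i)) (at x within S)"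
  shows "(f has_derivative f') (at x within S)"
  using assms by (subst has_derivative_componentwise_within) (auto simp: Basis_vec_def inner_axis)

section \<open>Calculus of the derivation attached to a vector field\<close>

lemma vf_apply_has_derivative:
  "(f has_derivative f') (at x) \<Longrightarrow> vf_apply V f x = f' (V x)"
  unfolding vf_apply_def using frechet_derivative_at by metis

lemma vf_apply_const: "vf_apply V (\<lambda>x. c) x = 0"
  by (rule vf_apply_has_derivative[where f' = "\<lambda>_. 0", THEN trans]) auto

lemma vf_apply_coord: "vf_apply V (\<lambda>x. x $ j) x = V x $ j"
  by (rule vf_apply_has_derivative[where f' = "\<lambda>h. h $ j"])
     (intro bounded_linear.has_derivative[OF bounded_linear_vec_nth] has_derivative_ident)

lemma vf_apply_add:
  assumes "f differentiable at x" "g differentiable at x"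
  shows "vf_apply V (\<lambda>x. f x + g x) x = vf_apply V f x + vf_apply V g x"
proof -
  from assms obtain f' g' where d: "(f has_derivative f') (at x)" "(g has_derivative g') (at x)"
    by (auto simp: differentiable_def)
  show ?thesis
    using vf_apply_has_derivative[OF has_derivative_add[OF d]]
      vf_apply_has_derivative[OF d(1)] vf_apply_has_derivative[OF d(2)] by simp
qed

lemma vf_apply_mult:
  assumes "f differentiable at x" "g differentiable at x"
  shows "vf_apply V (\<lambda>x. f x * g x) x = vf_apply V f x * g x + f x * vf_apply V g x"
proof -
  from assms obtain f' g' where d: "(f has_derivative f') (at x)" "(g has_derivative g') (at x)"
    by (auto simp: differentiable_def)
  show ?thesis
    using vf_apply_has_derivative[OF has_derivative_mult[OF d]]
      vf_apply_has_derivative[OF d(1)] vf_apply_has_derivative[OF d(2)] by simp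
qed

lemma vf_apply_cmult:
  assumes "f differentiable at x"
  shows "vf_apply V (\<lambda>x. c * f x) x = c * vf_apply V f x"
  using vf_apply_mult[of "\<lambda>_. c" x f] assms by (simp add: vf_apply_const)

lemma vf_apply_sum:
  assumes "finite S" "\<And>i. i \<in> S \<Longrightarrow> f i differentiable at x"
  shows "vf_apply V (\<lambda>x. \<Sum>i\<in>S. f i x) x = (\<Sum>i\<in>S. vf_apply V (f i) x)"
  using assms
  by (induction S rule: finite_induct)
     (simp_all add: vf_apply_const vf_apply_add differentiable_sum)

lemma vf_apply_comp_real:
  assumes "f differentiable at x" "(F has_real_derivative F') (at (f x))"
  shows "vf_apply V (\<lambda>x. F (f x)) x = F' * vf_apply V f x"
proof -
  from assms obtain f' where d: "(f has_derivative f') (at x)"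
    by (auto simp: differentiable_def)
  have "((\<lambda>x. F (f x)) has_derivative (\<lambda>h. F' * f' h)) (at x)"
    using has_derivative_compose[OF d] assms(2) unfolding has_field_derivative_def by blast
  then show ?thesis
    using vf_apply_has_derivative d by metis
qed

lemma vf_apply_expand:
  assumes "f differentiable at x"
  shows "vf_apply V f x = (\<Sum>j\<in>UNIV. V x $ j * pderiv_j j f x)"
proof -
  from assms obtain f' where d: "(f has_derivative f') (at x)"
    by (auto simp: differentiable_def)
  then have f': "frechet_derivative f (at x) = f'" using frechet_derivative_at by metis
  have lin: "linear f'" using d has_derivative_linear by blast
  have "f' (V x) = f' (\<Sum>j\<in>UNIV. V x $ j *\<^sub>R axis j 1)"
    by (simp add: basis_expansion scalar_mult_eq_scaleR[symmetric])
  also have "\<dots> = (\<Sum>j\<in>UNIV. V x $ j * f' (axis j 1))"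
    by (simp add: linear_sum[OF lin] linear_scale[OF lin])
  finally show ?thesis by (simp add: vf_apply_def pderiv_j_def f')
qed

text \<open>Partial derivatives become derivations along constant fields, so the sum, product and
  chain rules above serve both.\<close>

lemma pderiv_vf: "pderiv_j j f = vf_apply (\<lambda>_. axis j 1) f"
  by (simp add: fun_eq_iff pderiv_j_def vf_apply_def)

section \<open>Continuously differentiable functions\<close>

definition C1 :: "(real^'n \<Rightarrow> real) \<Rightarrow> bool" where
  "C1 f \<longleftrightarrow> (\<forall>x. f differentiable at x) \<and> (\<forall>j. continuous_on UNIV (pderiv_j j f))"

lemma C1_diff: "C1 f \<Longrightarrow> f differentiable at x"
  by (simp add: C1_def)

lemma C1_cont: "C1 f \<Longrightarrow> continuous_on S f"
  by (meson C1_def continuous_at_imp_continuous_on differentiable_imp_continuous_within)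

lemma C1_vf_cont:
  assumes "C1 f" "continuous_on UNIV V"
  shows "continuous_on S (vf_apply V f)"
proof -
  have "vf_apply V f = (\<lambda>x. \<Sum>j\<in>UNIV. V x $ j * pderiv_j j f x)"
    using assms(1) by (simp add: fun_eq_iff vf_apply_expand C1_diff)
  moreover have "continuous_on UNIV (\<lambda>x. \<Sum>j\<in>UNIV. V x $ j * pderiv_j j f x)"
    using assms by (intro continuous_intros) (auto simp: C1_def)
  ultimately show ?thesis using continuous_on_subset by fastforce
qed

lemma C1_I:
  assumes "\<And>x. f differentiable at x" "\<And>j. continuous_on UNIV (pderiv_j j f)"
  shows "C1 f"
  using assms by (simp add: C1_def)

lemma C1_const: "C1 (\<lambda>_. c)"
  by (intro C1_I) (simp_all add: pderiv_vf vf_apply_const)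

lemma C1_coord: "C1 (\<lambda>x. x $ j)"
  by (intro C1_I)
     (simp_all add: pderiv_vf vf_apply_coord bounded_linear_imp_differentiable bounded_linear_vec_nth)

lemma C1_add: assumes "C1 f" "C1 g" shows "C1 (\<lambda>x. f x + g x)"
proof (intro C1_I)
  fix j
  have "pderiv_j j (\<lambda>x. f x + g x) = (\<lambda>x. pderiv_j j f x + pderiv_j j g x)"
    using assms by (simp add: fun_eq_iff pderiv_vf vf_apply_add C1_diff)
  then show "continuous_on UNIV (pderiv_j j (\<lambda>x. f x + g x))"
    using assms by (auto simp: C1_def intro!: continuous_intros)
qed (use assms in \<open>auto simp: C1_diff\<close>)

lemma C1_mult: assumes "C1 f" "C1 g" shows "C1 (\<lambda>x. f x * g x)"
proof (intro C1_I)
  fix j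
  have "pderiv_j j (\<lambda>x. f x * g x) = (\<lambda>x. pderiv_j j f x * g x + f x * pderiv_j j g x)"
    using assms by (simp add: fun_eq_iff pderiv_vf vf_apply_mult C1_diff)
  then show "continuous_on UNIV (pderiv_j j (\<lambda>x. f x * g x))"
    using assms C1_cont[OF assms(1)] C1_cont[OF assms(2)]
    by (auto simp: C1_def intro!: continuous_intros)
qed (use assms in \<open>auto simp: C1_diff\<close>)

lemma C1_sum:
  assumes "finite S" "\<And>i. i \<in> S \<Longrightarrow> C1 (f i)"
  shows "C1 (\<lambda>x. \<Sum>i\<in>S. f i x)"
  using assms by (induction S rule: finite_induct) (simp_all add: C1_const C1_add)

lemma C1_comp_real:
  assumes "C1 f" "\<And>x. (F has_real_derivative F' (f x)) (at (f x))"
    and "continuous_on UNIV (\<lambda>x. F' (f x))"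
  shows "C1 (\<lambda>x. F (f x))"
proof (intro C1_I)
  fix x
  obtain f' where "(f has_derivative f') (at x)"
    using C1_diff[OF assms(1)] by (auto simp: differentiable_def)
  from has_derivative_compose[OF this assms(2)[of x, unfolded has_field_derivative_def]]
  show "(\<lambda>x. F (f x)) differentiable at x"
    by (auto simp: differentiable_def)
next
  fix j
  have "pderiv_j j (\<lambda>x. F (f x)) = (\<lambda>x. F' (f x) * pderiv_j j f x)"
    using assms by (simp add: fun_eq_iff pderiv_vf vf_apply_comp_real C1_diff)
  then show "continuous_on UNIV (pderiv_j j (\<lambda>x. F (f x)))"
    using assms by (auto simp: C1_def intro!: continuous_intros)
qed

lemma smooth_fun_pderiv: "smooth_fun f \<Longrightarrow> smooth_fun (pderiv_j j f)"
  unfolding smooth_fun_def by (metis Ck.simps(2))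

lemma Ck_imp_cont: "Ck k f \<Longrightarrow> continuous_on UNIV f"
  by (cases k) (auto simp: continuous_at_imp_continuous_on differentiable_imp_continuous_within)

lemma Ck_Suc_imp_C1: "Ck (Suc k) f \<Longrightarrow> C1 f"
  unfolding C1_def using Ck_imp_cont by auto

lemma smooth_fun_C1: "smooth_fun f \<Longrightarrow> C1 f"
  unfolding smooth_fun_def using Ck_Suc_imp_C1 by blast

lemma Ck2_iff: "Ck 2 u \<longleftrightarrow> (\<forall>x. u differentiable at x) \<and> (\<forall>j. C1 (pderiv_j j u))"
  by (simp add: numeral_2_eq_2 C1_def)

section \<open>Weighted polynomials\<close>

text \<open>A filtration rather than a grading, with integer degrees: in negative degree only 0 is left,
  which is how error terms will vanish.\<close>

inductive wpoly :: "('n::finite \<Rightarrow> nat) \<Rightarrow> int \<Rightarrow> (real^'n \<Rightarrow> real) \<Rightarrow> bool" for \<sigma> where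
  zero: "wpoly \<sigma> d (\<lambda>_. 0)"
| const: "0 \<le> d \<Longrightarrow> wpoly \<sigma> d (\<lambda>_. c)"
| coord: "int (\<sigma> j) \<le> d \<Longrightarrow> wpoly \<sigma> d (\<lambda>x. x $ j)"
| add: "wpoly \<sigma> d f \<Longrightarrow> wpoly \<sigma> d g \<Longrightarrow> wpoly \<sigma> d (\<lambda>x. f x + g x)"
| mult: "wpoly \<sigma> d f \<Longrightarrow> wpoly \<sigma> e g \<Longrightarrow> wpoly \<sigma> (d + e) (\<lambda>x. f x * g x)"

lemma wpoly_neg: "wpoly \<sigma> d f \<Longrightarrow> d < 0 \<Longrightarrow> f x = 0"
proof (induction rule: wpoly.induct)
  case (mult d f e g)
  then show ?case by (cases "d < 0") auto
qed auto

lemma wpoly_mono: "wpoly \<sigma> d f \<Longrightarrow> d \<le> e \<Longrightarrow> wpoly \<sigma> e f"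
  using wpoly.mult[OF wpoly.const[of "e - d" \<sigma> 1], of d f] by simp

lemma wpoly_cmult: "wpoly \<sigma> d f \<Longrightarrow> wpoly \<sigma> d (\<lambda>x. c * f x)"
  using wpoly.mult[OF wpoly.const[of 0 \<sigma> c], of d f] by simp

lemma wpoly_diff: "wpoly \<sigma> d f \<Longrightarrow> wpoly \<sigma> d g \<Longrightarrow> wpoly \<sigma> d (\<lambda>x. f x - g x)"
  using wpoly.add[OF _ wpoly_cmult[of \<sigma> d g "-1"], of f] by simp

lemma wpoly_sum:
  "finite S \<Longrightarrow> (\<And>i. i \<in> S \<Longrightarrow> wpoly \<sigma> d (f i)) \<Longrightarrow> wpoly \<sigma> d (\<lambda>x. \<Sum>i\<in>S. f i x)"
  by (induction S rule: finite_induct) (auto intro: wpoly.intros)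

lemma wpoly_C1: "wpoly \<sigma> d f \<Longrightarrow> C1 f"
  by (induction rule: wpoly.induct) (auto intro: C1_const C1_coord C1_add C1_mult)

lemma wpoly_diffble: "wpoly \<sigma> d f \<Longrightarrow> f differentiable at x"
  by (blast intro: C1_diff wpoly_C1)

text \<open>The triangularity of words (\<open>wrun_mp\<close>) rests on this. In a product with
  both degrees nonnegative each factor sees only weights up to the total degree; a factor of
  negative degree makes the product 0.\<close>

lemma wpoly_depends:
  fixes \<sigma> :: "'n::finite \<Rightarrow> nat"
  assumes "wpoly \<sigma> d f" "\<And>k. int (\<sigma> k) \<le> d \<Longrightarrow> x $ k = y $ k" "\<And>k. 1 \<le> \<sigma> k"
  shows "f x = f y"
  using assms
proof (induction arbitrary: x y rule: wpoly.induct)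
  case (mult d f e g)
  show ?case
  proof (cases "d < 0 \<or> e < 0")
    case True
    then show ?thesis using wpoly_neg[OF mult(1)] wpoly_neg[OF mult(2)] by auto
  next
    case False
    then have "x $ k = y $ k" if "int (\<sigma> k) \<le> d \<or> int (\<sigma> k) \<le> e" for k
      using that False mult.prems(1)[of k] by linarith
    then show ?thesis using mult.IH mult.prems(2) by metis
  qed
next
  case (add d f g)
  then show ?case by metis
qed auto

lemma wpoly_zero_deg:
  assumes "wpoly \<sigma> d f" "d \<le> 0" "\<And>k. 1 \<le> \<sigma> k"
  shows "f x = f y"
  by (rule wpoly_depends[OF assms(1) _ assms(3)]) (use assms(2,3) in \<open>smt (verit) of_nat_1 of_nat_mono\<close>)

text \<open>A condition on the coordinates only, because a derivation is determined by them;
  \<open>lowers_apply\<close> extends it to all weighted polynomials by the Leibniz rule.\<close>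

definition lowers :: "('n::finite \<Rightarrow> nat) \<Rightarrow> int \<Rightarrow> (real^'n \<Rightarrow> real^'n) \<Rightarrow> bool" where
  "lowers \<sigma> k V \<longleftrightarrow> (\<forall>j. wpoly \<sigma> (int (\<sigma> j) - k) (\<lambda>x. V x $ j))"

lemma lowers_apply:
  assumes "lowers \<sigma> k V" "0 \<le> k" "wpoly \<sigma> d f"
  shows "wpoly \<sigma> (d - k) (vf_apply V f)"
  using assms(3)
proof (induction rule: wpoly.induct)
  case (zero d)
  show ?case by (simp add: vf_apply_const[abs_def] wpoly.zero)
next
  case (const d c)
  show ?case by (simp add: vf_apply_const[abs_def] wpoly.zero)
next
  case (coord j d)
  then show ?case using assms(1) wpoly_mono[of \<sigma> "int (\<sigma> j) - k" _ "d - k"]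
    by (simp add: vf_apply_coord[abs_def] lowers_def)
next
  case (add d f g)
  have "vf_apply V (\<lambda>x. f x + g x) = (\<lambda>x. vf_apply V f x + vf_apply V g x)"
    using add by (simp add: fun_eq_iff vf_apply_add wpoly_diffble)
  then show ?case using add by (simp add: wpoly.add)
next
  case (mult d f e g)
  have "vf_apply V (\<lambda>x. f x * g x) = (\<lambda>x. vf_apply V f x * g x + f x * vf_apply V g x)"
    using mult by (simp add: fun_eq_iff vf_apply_mult wpoly_diffble)
  moreover have "wpoly \<sigma> (d - k + e) (\<lambda>x. vf_apply V f x * g x)"
    "wpoly \<sigma> (d + (e - k)) (\<lambda>x. f x * vf_apply V g x)"
    using mult by (auto intro: wpoly.mult)
  ultimately show ?case by (simp add: wpoly.add algebra_simps)
qed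

lemma dil_has_derivative:
  "(dil \<sigma> t has_derivative dil \<sigma> t) (at x)"
  by (rule bounded_linear.has_derivative[where f="dil \<sigma> t" and g = "\<lambda>x. x", simplified])
     (auto simp: linear_conv_bounded_linear[symmetric] dil_def algebra_simps vec_eq_iff intro!: linearI)

lemma has_derivative_comp_dil:
  assumes "f differentiable at (dil \<sigma> t x)"
  shows "((\<lambda>x. f (dil \<sigma> t x)) has_derivative
           (\<lambda>h. frechet_derivative f (at (dil \<sigma> t x)) (dil \<sigma> t h))) (at x)"
  using has_derivative_compose[OF dil_has_derivative, of f] assms frechet_derivative_works by blast

lemma pderiv_dil:
  assumes "f differentiable at (dil \<sigma> t x)"
  shows "pderiv_j j (\<lambda>x. f (dil \<sigma> t x)) x = t ^ \<sigma> j * pderiv_j j f (dil \<sigma> t x)"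
proof -
  have "dil \<sigma> t (axis j 1) = t ^ \<sigma> j *\<^sub>R axis j 1"
    by (auto simp: dil_def vec_eq_iff axis_def)
  moreover have "linear (frechet_derivative f (at (dil \<sigma> t x)))"
    using assms by (simp add: linear_frechet_derivative)
  ultimately show ?thesis
    unfolding pderiv_vf using vf_apply_has_derivative[OF has_derivative_comp_dil[OF assms], of "\<lambda>_. axis j 1"]
    by (simp add: vf_apply_def linear_scale)
qed

lemma dil_tendsto_zero:
  assumes "\<And>k. 1 \<le> \<sigma> k"
  shows "((\<lambda>t. dil \<sigma> t x) \<longlongrightarrow> 0) (at_right 0)"
proof -
  have "isCont (\<lambda>t. dil \<sigma> t x) 0"
    unfolding dil_def isCont_def by (auto intro!: tendsto_intros)
  moreover have "\<sigma> k \<noteq> 0" for k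
    using assms[of k] by simp
  then have "dil \<sigma> 0 x = 0"
    by (auto simp: dil_def vec_eq_iff power_0_left simp del: neq0_conv)
  ultimately show ?thesis
    by (metis (no_types, lifting) at_within_le_at isCont_def tendsto_mono)
qed

text \<open>Induction on the degree: the partial derivative in direction \<open>j\<close> is
  homogeneous of degree \<open>d - \<sigma> j\<close>, hence a weighted polynomial, and Euler's
  identity rebuilds \<open>f\<close> from these derivatives. Continuity at the origin excludes
  negative degrees and leaves only constants in degree 0.\<close>

lemma homogeneous_wpoly:
  fixes \<sigma> :: "'n::finite \<Rightarrow> nat"
  assumes pos: "\<And>k. 1 \<le> \<sigma> k"
  shows "smooth_fun f \<Longrightarrow> (\<And>t x. 0 < t \<Longrightarrow> f (dil \<sigma> t x) = t ^ d * f x) \<Longrightarrow> wpoly \<sigma> (int d) f"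
proof (induction d arbitrary: f rule: less_induct)
  case (less d)
  have cont0: "((\<lambda>t. g (dil \<sigma> t x)) \<longlongrightarrow> g 0) (at_right 0)" if "C1 g" for g :: "real^'n \<Rightarrow> real" and x
    by (rule tendsto_compose[OF _ dil_tendsto_zero[OF pos]])
       (use C1_cont[OF that, of UNIV] in \<open>simp add: continuous_on_eq_continuous_at isCont_def\<close>)
  have C1f: "C1 f" using less by (simp add: smooth_fun_C1)
  show ?case
  proof (cases "d = 0")
    case True
    have "f x = f 0" for x
    proof -
      have "((\<lambda>t. f (dil \<sigma> t x)) \<longlongrightarrow> f x) (at_right 0)"
        by (rule tendsto_eventually) (auto simp: less.prems(2) True eventually_at_filter)
      from tendsto_unique[OF trivial_limit_at_right_real this cont0[OF C1f]] show ?thesis .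
    qed
    then have "f = (\<lambda>_. f 0)" by auto
    then show ?thesis using wpoly.const[of "int d" \<sigma> "f 0"] by simp
  next
    case False
    have hom: "t ^ \<sigma> j * pderiv_j j f (dil \<sigma> t x) = t ^ d * pderiv_j j f x" if "0 < t" for j t x
    proof -
      have "(\<lambda>x. f (dil \<sigma> t x)) = (\<lambda>x. t ^ d * f x)" using less.prems(2) that by auto
      then show ?thesis
        using pderiv_dil[of f \<sigma> t x j] C1_diff[OF C1f] vf_apply_cmult[of f x _ "t ^ d"]
        by (simp add: pderiv_vf)
    qed
    have P: "wpoly \<sigma> (int d - int (\<sigma> j)) (pderiv_j j f)" for j
    proof (cases "\<sigma> j \<le> d")
      case True
      have "wpoly \<sigma> (int (d - \<sigma> j)) (pderiv_j j f)"
      proof (rule less.IH)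
        show "d - \<sigma> j < d" using pos[of j] False by simp
        show "smooth_fun (pderiv_j j f)" using less by (simp add: smooth_fun_pderiv)
        fix t :: real and x :: "real^'n" assume t: "0 < t"
        have "t ^ \<sigma> j * pderiv_j j f (dil \<sigma> t x) = t ^ \<sigma> j * (t ^ (d - \<sigma> j) * pderiv_j j f x)"
          using hom[OF t, of j x] True
          by (metis le_add_diff_inverse mult.assoc power_add)
        then show "pderiv_j j f (dil \<sigma> t x) = t ^ (d - \<sigma> j) * pderiv_j j f x"
          using t by simp
      qed
      then show ?thesis using True by (simp add: of_nat_diff)
    next
      \<comment> \<open>Here the derivative has negative degree and is continuous at 0: letting
        \<open>t\<close> tend to 0 in the scaling identity gives 0.\<close>
      case F: False
      have "pderiv_j j f x = 0" for x
      proof -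
        have "((\<lambda>t. t ^ (\<sigma> j - d) * pderiv_j j f (dil \<sigma> t x)) \<longlongrightarrow> 0 ^ (\<sigma> j - d) * pderiv_j j f 0) (at_right 0)"
          by (intro tendsto_mult tendsto_power tendsto_ident_at cont0[OF smooth_fun_C1] smooth_fun_pderiv[OF less.prems(1)])
        moreover have "((\<lambda>t. t ^ (\<sigma> j - d) * pderiv_j j f (dil \<sigma> t x)) \<longlongrightarrow> pderiv_j j f x) (at_right 0)"
        proof (rule tendsto_eventually)
          have "t ^ (\<sigma> j - d) * pderiv_j j f (dil \<sigma> t x) = pderiv_j j f x" if t: "0 < t" for t
          proof -
            have "t ^ d * (t ^ (\<sigma> j - d) * pderiv_j j f (dil \<sigma> t x)) = t ^ d * pderiv_j j f x"
              using hom[OF t, of j x] F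
              by (metis le_add_diff_inverse less_imp_le mult.assoc not_less power_add)
            then show ?thesis using t by simp
          qed
          then show "\<forall>\<^sub>F t in at_right 0. t ^ (\<sigma> j - d) * pderiv_j j f (dil \<sigma> t x) = pderiv_j j f x"
            by (auto simp: eventually_at_filter)
        qed
        ultimately show ?thesis
          using tendsto_unique[OF trivial_limit_at_right_real, of _ "pderiv_j j f x" 0] F
          by (simp add: power_0_left)
      qed
      then have "pderiv_j j f = (\<lambda>_. 0)" by auto
      then show ?thesis by (simp add: wpoly.zero)
    qed
    \<comment> \<open>Differentiate \<open>f (dil \<sigma> t x) = t ^ d * f x\<close> in
      \<open>t\<close> at \<open>t = 1\<close>.\<close>
    have Euler: "f x = (1 / real d) * (\<Sum>j\<in>UNIV. (real (\<sigma> j) * x $ j) * pderiv_j j f x)" for x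
    proof -
      have dil1: "dil \<sigma> 1 x = x" by (simp add: dil_def vec_eq_iff)
      have "((\<lambda>t. dil \<sigma> t x) has_derivative (\<lambda>h. h *\<^sub>R (\<chi> j. real (\<sigma> j) * x $ j))) (at 1)"
        unfolding dil_def
        by (rule has_derivative_vecI) (auto intro!: derivative_eq_intros)
      moreover obtain f' where f': "(f has_derivative f') (at x)"
        using C1_diff[OF C1f] by (auto simp: differentiable_def)
      ultimately have "((\<lambda>t. f (dil \<sigma> t x)) has_derivative (\<lambda>h. f' (h *\<^sub>R (\<chi> j. real (\<sigma> j) * x $ j)))) (at 1)"
        using has_derivative_compose[of "\<lambda>t. dil \<sigma> t x" _ 1 UNIV f f'] dil1 by simp
      moreover have "((\<lambda>t. f (dil \<sigma> t x)) has_derivative (\<lambda>h. h * (real d * f x))) (at (1::real))"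
      proof (rule has_derivative_transform_within_open[where s = "{0<..}" and f = "\<lambda>t. t ^ d * f x"])
        show "((\<lambda>t. t ^ d * f x) has_derivative (\<lambda>h. h * (real d * f x))) (at 1)"
          by (auto intro!: derivative_eq_intros)
      qed (auto simp: less.prems(2))
      ultimately have "(\<lambda>h. f' (h *\<^sub>R (\<chi> j. real (\<sigma> j) * x $ j))) = (\<lambda>h. h * (real d * f x))"
        by (rule has_derivative_unique)
      from fun_cong[OF this, of 1] have "f' (\<chi> j. real (\<sigma> j) * x $ j) = real d * f x"
        by simp
      moreover have "f' (\<chi> j. real (\<sigma> j) * x $ j) = (\<Sum>j\<in>UNIV. (real (\<sigma> j) * x $ j) * pderiv_j j f x)"
        using vf_apply_expand[OF C1_diff[OF C1f], of "\<lambda>x. \<chi> j. real (\<sigma> j) * x $ j" x]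
          vf_apply_has_derivative[OF f', of "\<lambda>x. \<chi> j. real (\<sigma> j) * x $ j"] by simp
      ultimately show ?thesis using False by simp
    qed
    have "wpoly \<sigma> (int d) (\<lambda>x. (1 / real d) * (\<Sum>j\<in>UNIV. (real (\<sigma> j) * x $ j) * pderiv_j j f x))"
    proof (intro wpoly_cmult wpoly_sum)
      fix j
      have "wpoly \<sigma> (int (\<sigma> j)) (\<lambda>x. real (\<sigma> j) * x $ j)"
        by (intro wpoly_cmult wpoly.coord) simp
      from wpoly.mult[OF this P[of j]]
      show "wpoly \<sigma> (int d) (\<lambda>x. (real (\<sigma> j) * x $ j) * pderiv_j j f x)" by simp
    qed auto
    moreover have "f = (\<lambda>x. (1 / real d) * (\<Sum>j\<in>UNIV. (real (\<sigma> j) * x $ j) * pderiv_j j f x))"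
      using Euler by (rule ext)
    ultimately show ?thesis by metis
  qed
qed

section \<open>Flows of derivations lowering the weighted degree\<close>

lemma wpoly_funpow:
  assumes "lowers \<sigma> 1 V" "wpoly \<sigma> d f"
  shows "wpoly \<sigma> (d - int k) ((vf_apply V ^^ k) f)"
proof (induction k)
  case (Suc k)
  from lowers_apply[OF assms(1) _ Suc] show ?case by (simp add: algebra_simps)
qed (use assms in simp)

lemma wpoly_funpow_zero:
  assumes "lowers \<sigma> 1 V" "wpoly \<sigma> d f" "d < int k"
  shows "(vf_apply V ^^ k) f x = 0"
  using wpoly_neg[OF wpoly_funpow[OF assms(1,2), of k]] assms(3) by simp

lemma vf_funpow_const: "(vf_apply V ^^ Suc k) (\<lambda>_. c) = (\<lambda>_. 0)"
proof (induction k)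
  case 0
  show ?case by (simp add: vf_apply_const fun_eq_iff)
next
  case (Suc k)
  have "(vf_apply V ^^ Suc (Suc k)) (\<lambda>_. c) = vf_apply V ((vf_apply V ^^ Suc k) (\<lambda>_. c))"
    by simp
  also have "\<dots> = (\<lambda>_. 0)"
    unfolding Suc by (simp add: vf_apply_const fun_eq_iff)
  finally show ?case .
qed

lemma vf_funpow_add:
  assumes "lowers \<sigma> 1 V" "wpoly \<sigma> d f" "wpoly \<sigma> d g"
  shows "(vf_apply V ^^ k) (\<lambda>x. f x + g x) = (\<lambda>x. (vf_apply V ^^ k) f x + (vf_apply V ^^ k) g x)"
proof (induction k)
  case (Suc k)
  have "(vf_apply V ^^ Suc k) (\<lambda>x. f x + g x) = vf_apply V ((vf_apply V ^^ k) (\<lambda>x. f x + g x))"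
    by simp
  also have "\<dots> = (\<lambda>x. (vf_apply V ^^ Suc k) f x + (vf_apply V ^^ Suc k) g x)"
    unfolding Suc
    using wpoly_diffble[OF wpoly_funpow[OF assms(1,2)]] wpoly_diffble[OF wpoly_funpow[OF assms(1,3)]]
    by (simp add: vf_apply_add fun_eq_iff)
  finally show ?case .
qed simp

text \<open>Dividing by factorials absorbs the binomial coefficients and turns the Leibniz rule into
  a Cauchy product, the form needed for the multiplicativity of the exponential of a
  derivation.\<close>

lemma vf_funpow_Leibniz:
  fixes V :: "real^'n \<Rightarrow> real^'n"
  assumes V: "lowers \<sigma> 1 V" and f: "wpoly \<sigma> d f" and g: "wpoly \<sigma> e g"
  shows "(vf_apply V ^^ k) (\<lambda>x. f x * g x) x / fact k =
    (\<Sum>i\<le>k. ((vf_apply V ^^ i) f x / fact i) * ((vf_apply V ^^ (k - i)) g x / fact (k - i)))"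
proof (induction k arbitrary: x)
  case (Suc k)
  define A where "A i x = (vf_apply V ^^ i) f x / fact i" for i x
  define B where "B i x = (vf_apply V ^^ i) g x / fact i" for i x
  have dA: "A i differentiable at x" for i x
    unfolding A_def using wpoly_diffble[OF wpoly_cmult[OF wpoly_funpow[OF V f], where c = "1 / fact i"]] by simp
  have dB: "B i differentiable at x" for i x
    unfolding B_def using wpoly_diffble[OF wpoly_cmult[OF wpoly_funpow[OF V g], where c = "1 / fact i"]] by simp
  have VA: "vf_apply V (A i) x = real (Suc i) * A (Suc i) x" for i x
    using vf_apply_cmult[of "(vf_apply V ^^ i) f" x V "1 / fact i", OF wpoly_diffble[OF wpoly_funpow[OF V f]]]
    by (simp add: A_def[abs_def] fact_Suc field_simps del: of_nat_Suc)
  have VB: "vf_apply V (B i) x = real (Suc i) * B (Suc i) x" for i x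
    using vf_apply_cmult[of "(vf_apply V ^^ i) g" x V "1 / fact i", OF wpoly_diffble[OF wpoly_funpow[OF V g]]]
    by (simp add: B_def[abs_def] fact_Suc field_simps del: of_nat_Suc)
  have IH: "(vf_apply V ^^ k) (\<lambda>x. f x * g x) = (\<lambda>x. fact k * (\<Sum>i\<le>k. A i x * B (k - i) x))"
    using Suc by (simp add: A_def B_def fun_eq_iff field_simps)
  have "(vf_apply V ^^ Suc k) (\<lambda>x. f x * g x) x
      = fact k * vf_apply V (\<lambda>x. \<Sum>i\<le>k. A i x * B (k - i) x) x"
    by (simp add: IH) (intro vf_apply_cmult differentiable_sum finite_atMost ballI
        differentiable_mult dA dB)
  also have "vf_apply V (\<lambda>x. \<Sum>i\<le>k. A i x * B (k - i) x) x
      = (\<Sum>i\<le>k. real (Suc i) * A (Suc i) x * B (k - i) x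
            + real (Suc (k - i)) * A i x * B (Suc (k - i)) x)"
    by (subst vf_apply_sum)
       (auto intro!: sum.cong differentiable_mult dA dB simp: vf_apply_mult dA dB VA VB simp del: of_nat_Suc)
  also have "\<dots> = (\<Sum>i\<le>k. real (Suc i) * A (Suc i) x * B (Suc k - Suc i) x)
      + (\<Sum>i\<le>k. real (Suc k - i) * A i x * B (Suc k - i) x)"
    by (subst sum.distrib[symmetric]) (intro sum.cong refl, simp add: Suc_diff_le del: of_nat_Suc)
  also have "(\<Sum>i\<le>k. real (Suc i) * A (Suc i) x * B (Suc k - Suc i) x)
      = (\<Sum>i\<le>Suc k. real i * A i x * B (Suc k - i) x)"
    by (subst sum.atMost_Suc_shift) simp
  also have "(\<Sum>i\<le>k. real (Suc k - i) * A i x * B (Suc k - i) x)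
      = (\<Sum>i\<le>Suc k. real (Suc k - i) * A i x * B (Suc k - i) x)"
    by simp
  \<comment> \<open>The weights \<open>i\<close> and \<open>Suc k - i\<close> of the two shifted
    sums add up to \<open>Suc k\<close>.\<close>
  also have "(\<Sum>i\<le>Suc k. real i * A i x * B (Suc k - i) x) + \<dots>
      = real (Suc k) * (\<Sum>i\<le>Suc k. A i x * B (Suc k - i) x)"
    unfolding sum.distrib[symmetric] sum_distrib_left
    by (intro sum.cong refl) (auto simp: of_nat_diff algebra_simps)
  finally show ?case
    by (simp add: A_def[symmetric] B_def[symmetric] fact_Suc field_simps del: of_nat_Suc sum.atMost_Suc)
qed simp

text \<open>The exponential series of \<open>V\<close> at time \<open>t\<close>, applied to the
  coordinates. Stopping at \<open>\<sigma> j\<close> loses nothing when \<open>V\<close> lowers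
  degrees by 1, because later iterates have negative degree; so no differential equation has to be
  solved.\<close>

definition flow :: "('n::finite \<Rightarrow> nat) \<Rightarrow> (real^'n \<Rightarrow> real^'n) \<Rightarrow> real \<Rightarrow> real^'n \<Rightarrow> real^'n" where
  "flow \<sigma> V t x = (\<chi> j. \<Sum>k\<le>\<sigma> j. t ^ k / fact k * (vf_apply V ^^ k) (\<lambda>x. x $ j) x)"

text \<open>The exponential of a derivation is an algebra homomorphism, and so is evaluation at the
  flow; they agree on coordinates, hence on all weighted polynomials. Stated with
  \<open>sums\<close> so that the Cauchy product applies without tracking where each series
  stops.\<close>

lemma exp_sums_flow:
  assumes V: "lowers \<sigma> 1 V" and f: "wpoly \<sigma> d f"
  shows "(\<lambda>k. t ^ k / fact k * (vf_apply V ^^ k) f x) sums f (flow \<sigma> V t x)"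
  using f
proof (induction rule: wpoly.induct)
  case (zero d)
  have "(vf_apply V ^^ k) (\<lambda>_. 0) x = 0" for k
    by (cases k) (simp_all only: vf_funpow_const funpow_0)
  then show ?case by simp
next
  case (const d c)
  have "(\<lambda>k. t ^ k / fact k * (vf_apply V ^^ k) (\<lambda>_. c) x)
      sums (\<Sum>k\<in>{0}. t ^ k / fact k * (vf_apply V ^^ k) (\<lambda>_. c) x)"
    by (rule sums_finite) (auto simp: gr0_conv_Suc vf_funpow_const simp del: funpow.simps)
  then show ?case by simp
next
  case (coord j d)
  have "(\<lambda>k. t ^ k / fact k * (vf_apply V ^^ k) (\<lambda>x. x $ j) x)
      sums (\<Sum>k\<le>\<sigma> j. t ^ k / fact k * (vf_apply V ^^ k) (\<lambda>x. x $ j) x)"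
    using wpoly_funpow_zero[OF V wpoly.coord[OF order_refl, of \<sigma> j]] by (intro sums_finite) auto
  then show ?case by (simp add: flow_def)
next
  case (add d f g)
  then show ?case
    using sums_add by (fastforce simp: vf_funpow_add[OF V add.hyps] algebra_simps)
next
  case (mult d f e g)
  let ?a = "\<lambda>k. t ^ k / fact k * (vf_apply V ^^ k) f x"
  let ?b = "\<lambda>k. t ^ k / fact k * (vf_apply V ^^ k) g x"
  have fin: "summable (\<lambda>k. norm (t ^ k / fact k * (vf_apply V ^^ k) h x))" if "wpoly \<sigma> d h" for d h
    by (rule summable_finite[of "{..nat d}"]) (use wpoly_funpow_zero[OF V that] in auto)
  have "(\<lambda>k. \<Sum>i\<le>k. ?a i * ?b (k - i)) sums (suminf ?a * suminf ?b)"
    using fin[OF mult.hyps(1)] fin[OF mult.hyps(2)] by (rule Cauchy_product_sums)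
  moreover have "(\<Sum>i\<le>k. ?a i * ?b (k - i))
      = t ^ k / fact k * (vf_apply V ^^ k) (\<lambda>x. f x * g x) x" for k
  proof -
    have "(\<Sum>i\<le>k. ?a i * ?b (k - i)) = t ^ k *
      (\<Sum>i\<le>k. ((vf_apply V ^^ i) f x / fact i) * ((vf_apply V ^^ (k - i)) g x / fact (k - i)))"
      unfolding sum_distrib_left
    proof (intro sum.cong refl)
      fix i assume "i \<in> {..k}"
      then have "t ^ k = t ^ i * t ^ (k - i)" by (simp add: power_add[symmetric])
      then show "?a i * ?b (k - i) =
          t ^ k * ((vf_apply V ^^ i) f x / fact i * ((vf_apply V ^^ (k - i)) g x / fact (k - i)))"
        by simp
    qed
    then show ?thesis unfolding vf_funpow_Leibniz[OF V mult.hyps, symmetric] by simp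
  qed
  ultimately show ?case using mult.IH by (simp add: sums_iff)
qed

lemma exp_sum_flow:
  assumes V: "lowers \<sigma> 1 V" and f: "wpoly \<sigma> d f" and n: "d \<le> int n"
  shows "f (flow \<sigma> V t x) = (\<Sum>k\<le>n. t ^ k / fact k * (vf_apply V ^^ k) f x)"
proof -
  have "(\<lambda>k. t ^ k / fact k * (vf_apply V ^^ k) f x)
      sums (\<Sum>k\<le>n. t ^ k / fact k * (vf_apply V ^^ k) f x)"
    by (rule sums_finite) (use wpoly_funpow_zero[OF V f] n in auto)
  with exp_sums_flow[OF V f] show ?thesis by (rule sums_unique2)
qed

lemma flow_0: "flow \<sigma> V 0 x = x"
proof -
  have "(\<Sum>k\<le>\<sigma> j. 0 ^ k / fact k * (vf_apply V ^^ k) (\<lambda>x. x $ j) x) = x $ j" for j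
    by (subst sum.atMost_shift) (simp add: lessThan_Suc_atMost)
  then show ?thesis by (simp add: flow_def vec_eq_iff)
qed

lemma wpoly_flow_deriv:
  assumes V: "lowers \<sigma> 1 V" and f: "wpoly \<sigma> d f"
  shows "((\<lambda>t. f (flow \<sigma> V t x)) has_real_derivative vf_apply V f (flow \<sigma> V t x)) (at t)"
proof -
  define n where "n = nat d"
  let ?c = "\<lambda>k. (vf_apply V ^^ k) f x"
  have n: "d \<le> int n" "d \<le> int (Suc n)" by (simp_all add: n_def)
  have Vf: "wpoly \<sigma> (d - 1) (vf_apply V f)" using lowers_apply[OF V _ f] by simp
  have "((\<lambda>t. t ^ k / fact k * ?c k) has_real_derivative (real k * t ^ (k - 1)) / fact k * ?c k) (at t)" for k
    by (auto intro!: derivative_eq_intros)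
  \<comment> \<open>One term more than is kept for \<open>V f\<close>, since differentiation removes
    the constant term.\<close>
  then have "((\<lambda>t. \<Sum>k\<le>Suc n. t ^ k / fact k * ?c k) has_real_derivative
      (\<Sum>k\<le>Suc n. (real k * t ^ (k - 1)) / fact k * ?c k)) (at t)"
    by (rule DERIV_sum)
  also have "(\<Sum>k\<le>Suc n. (real k * t ^ (k - 1)) / fact k * ?c k) = (\<Sum>k\<le>n. t ^ k / fact k * ?c (Suc k))"
    by (subst sum.atMost_Suc_shift) (auto intro!: sum.cong simp: fact_Suc field_simps simp del: of_nat_Suc)
  also have "\<dots> = vf_apply V f (flow \<sigma> V t x)"
    using exp_sum_flow[OF V Vf, of n t x] n by (simp add: funpow_swap1)
  finally show ?thesis using exp_sum_flow[OF V f n(2)] by presburger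
qed

lemma flow_has_derivative:
  assumes V: "lowers \<sigma> 1 V"
  shows "((\<lambda>t. flow \<sigma> V t x) has_derivative (\<lambda>h. h *\<^sub>R V (flow \<sigma> V t x))) (at t)"
proof (rule has_derivative_vecI)
  fix j
  show "((\<lambda>t. flow \<sigma> V t x $ j) has_derivative (\<lambda>h. (h *\<^sub>R V (flow \<sigma> V t x)) $ j)) (at t)"
    using wpoly_flow_deriv[OF V wpoly.coord[OF order_refl, of \<sigma> j], of x t]
    by (simp add: has_field_derivative_def vf_apply_coord mult_commute_abs)
qed

lemma flow_deriv:
  assumes V: "lowers \<sigma> 1 V" and f: "f differentiable at (flow \<sigma> V t x)"
  shows "((\<lambda>t. f (flow \<sigma> V t x)) has_real_derivative vf_apply V f (flow \<sigma> V t x)) (at t)"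
proof -
  from f obtain f' where f': "(f has_derivative f') (at (flow \<sigma> V t x))"
    by (auto simp: differentiable_def)
  have "((\<lambda>t. f (flow \<sigma> V t x)) has_derivative (\<lambda>h. f' (h *\<^sub>R V (flow \<sigma> V t x)))) (at t)"
    using has_derivative_compose[OF flow_has_derivative[OF V] f'] .
  then show ?thesis
    using vf_apply_has_derivative[OF f'] has_derivative_linear[OF f']
    by (simp add: has_field_derivative_def linear_scale mult.commute[of _ "f' _"] mult_commute_abs)
qed

text \<open>Instead of multiplying two exponential series, take the series at time
  \<open>- t\<close> evaluated along the flow at time \<open>t\<close>. Its derivative in
  \<open>t\<close> telescopes to a multiple of the iterate of index \<open>\<sigma> j + 1\<close>,
  which is 0, and at \<open>t = 0\<close> its value is \<open>x $ j\<close>.\<close>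

lemma flow_inverse:
  assumes V: "lowers \<sigma> 1 V"
  shows "flow \<sigma> V (- t) (flow \<sigma> V t x) = x"
proof -
  have "flow \<sigma> V (- t) (flow \<sigma> V t x) $ j = x $ j" for j
  proof -
    let ?g = "\<lambda>k. (vf_apply V ^^ k) (\<lambda>x. x $ j)"
    let ?h = "\<lambda>t. \<Sum>k\<le>\<sigma> j. (- t) ^ k / fact k * ?g k (flow \<sigma> V t x)"
    note w = wpoly_funpow[OF V wpoly.coord[OF order_refl, of \<sigma> j]]
    have "(?h has_real_derivative 0) (at t)" for t
    proof -
      let ?G = "\<lambda>k. ?g k (flow \<sigma> V t x)"
      have "((\<lambda>t. (- t) ^ k / fact k * ?g k (flow \<sigma> V t x)) has_real_derivative
          (- t) ^ k / fact k * ?G (Suc k) - real k * (- t) ^ (k - 1) / fact k * ?G k) (at t)" for k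
        using wpoly_flow_deriv[OF V w[of k], of x t]
        by (auto intro!: derivative_eq_intros simp: diff_divide_distrib)
      then have "(?h has_real_derivative
          (\<Sum>k\<le>\<sigma> j. (- t) ^ k / fact k * ?G (Suc k) - real k * (- t) ^ (k - 1) / fact k * ?G k)) (at t)"
        by (rule DERIV_sum)
      moreover have "(\<Sum>k\<le>n. (- t) ^ k / fact k * ?G (Suc k) - real k * (- t) ^ (k - 1) / fact k * ?G k)
          = (- t) ^ n / fact n * ?G (Suc n)" for n
        by (induction n) (simp_all add: fact_Suc del: of_nat_Suc funpow.simps)
      moreover have "?G (Suc (\<sigma> j)) = 0"
        using wpoly_neg[OF w[of "Suc (\<sigma> j)"]] by simp
      ultimately show ?thesis by simp
    qed
    then have "?h t = ?h 0" by (intro DERIV_isconst_all) auto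
    also have "?h 0 = x $ j"
      by (subst sum.atMost_shift) (simp add: flow_0)
    finally show ?thesis by (simp add: flow_def[of \<sigma> V "- t"])
  qed
  then show ?thesis by (simp add: vec_eq_iff)
qed

lemma flow_continuous:
  assumes V: "lowers \<sigma> 1 V"
  shows "continuous_on UNIV (\<lambda>p. flow \<sigma> V (fst p) (snd p))"
proof -
  have "continuous_on S ((vf_apply V ^^ k) (\<lambda>x. x $ j))" for S k j
    using wpoly_C1[OF wpoly_funpow[OF V wpoly.coord[OF order_refl]]] C1_cont by blast
  then have "continuous_on UNIV (\<lambda>p. (vf_apply V ^^ k) (\<lambda>x. x $ j) (snd p))" for k j
    by (rule continuous_on_compose2) (auto intro: continuous_intros)
  then show ?thesis unfolding flow_def by (intro continuous_intros) auto
qed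

text \<open>What remains of the exponential series begins with the second iterate, two degrees down.
  This is the starting case of \<open>realises\<close>.\<close>

lemma flow_expansion:
  assumes V: "lowers \<sigma> 1 V" and f: "wpoly \<sigma> d f"
  shows "wpoly \<sigma> (d - 2) (\<lambda>x. f (flow \<sigma> V 1 x) - f x - vf_apply V f x)"
proof -
  define n where "n = nat d"
  let ?a = "\<lambda>k x. 1 / fact k * (vf_apply V ^^ k) f x"
  have "f (flow \<sigma> V 1 x) - f x - vf_apply V f x = (\<Sum>k\<le>n. ?a (k + 2) x)" for x
  proof -
    have "f (flow \<sigma> V 1 x) = (\<Sum>k\<le>Suc (Suc n). ?a k x)"
      using exp_sum_flow[OF V f, of "Suc (Suc n)" 1 x] by (simp add: n_def)
    also have "\<dots> = f x + vf_apply V f x + (\<Sum>k\<le>n. ?a (k + 2) x)"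
      by (simp only: sum.atMost_Suc_shift) simp
    finally show ?thesis by simp
  qed
  moreover have "wpoly \<sigma> (d - 2) (\<lambda>x. \<Sum>k\<le>n. ?a (k + 2) x)"
    by (intro wpoly_sum wpoly_cmult wpoly_mono[OF wpoly_funpow[OF V f]]) auto
  ultimately show ?thesis by simp
qed

section \<open>Homogeneity\<close>

text \<open>Degree \<open>k\<close> as a differential operator: the component \<open>j\<close> has
  degree \<open>\<sigma> j - k\<close>. The power on the left avoids a negative exponent when
  \<open>\<sigma> j < k\<close>.\<close>

definition hom_vf :: "('n::finite \<Rightarrow> nat) \<Rightarrow> nat \<Rightarrow> (real^'n \<Rightarrow> real^'n) \<Rightarrow> bool" where
  "hom_vf \<sigma> k V \<longleftrightarrow> (\<forall>t>0. \<forall>x j. t ^ k * V (dil \<sigma> t x) $ j = t ^ \<sigma> j * V x $ j)"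

text \<open>The degree of \<open>f\<close> is \<open>e - b\<close>, kept as a pair because it may be
  negative, as it is for high iterates on a coordinate.\<close>

lemma hom_vf_apply:
  assumes V: "hom_vf \<sigma> k V" and f: "\<And>x. f differentiable at x"
    and hom: "\<And>x. t ^ b * f (dil \<sigma> t x) = t ^ e * f x" and t: "0 < t"
  shows "t ^ (k + b) * vf_apply V f (dil \<sigma> t x) = t ^ e * vf_apply V f x"
proof -
  have "(\<lambda>x. t ^ b * f (dil \<sigma> t x)) = (\<lambda>x. t ^ e * f x)" using hom by blast
  moreover have "(\<lambda>x. f (dil \<sigma> t x)) differentiable at x" for x
    using has_derivative_comp_dil[OF f] by (auto simp: differentiable_def)
  ultimately have p: "t ^ b * (t ^ \<sigma> j * pderiv_j j f (dil \<sigma> t x)) = t ^ e * pderiv_j j f x" for j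
    using pderiv_dil[OF f, where \<sigma> = \<sigma> and t = t and x = x and j = j]
      vf_apply_cmult[OF f, where V = "\<lambda>_. axis j 1" and c = "t ^ e" and x = x]
      vf_apply_cmult[of "\<lambda>x. f (dil \<sigma> t x)" x "\<lambda>_. axis j 1" "t ^ b"] by (simp add: pderiv_vf)
  have "t ^ (k + b) * vf_apply V f (dil \<sigma> t x)
      = (\<Sum>j\<in>UNIV. (t ^ k * V (dil \<sigma> t x) $ j) * (t ^ b * pderiv_j j f (dil \<sigma> t x)))"
    by (simp add: vf_apply_expand[OF f] power_add sum_distrib_left mult_ac)
  also have "\<dots> = (\<Sum>j\<in>UNIV. V x $ j * (t ^ b * (t ^ \<sigma> j * pderiv_j j f (dil \<sigma> t x))))"
    using V t by (simp add: hom_vf_def mult_ac)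
  also have "\<dots> = t ^ e * vf_apply V f x"
    by (simp add: p vf_apply_expand[OF f] sum_distrib_left mult_ac)
  finally show ?thesis .
qed

lemma flow_dil:
  assumes V: "lowers \<sigma> 1 V" "hom_vf \<sigma> 1 V" and r: "0 < r"
  shows "dil \<sigma> r (flow \<sigma> V t x) = flow \<sigma> V (r * t) (dil \<sigma> r x)"
proof -
  have "r ^ k * (vf_apply V ^^ k) (\<lambda>x. x $ j) (dil \<sigma> r x) = r ^ \<sigma> j * (vf_apply V ^^ k) (\<lambda>x. x $ j) x" for k j x
  proof (induction k arbitrary: x)
    case (Suc k)
    from hom_vf_apply[OF V(2) wpoly_diffble[OF wpoly_funpow[OF V(1) wpoly.coord[OF order_refl]]] Suc r]
    show ?case by simp
  qed (simp add: dil_def)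
  then show ?thesis
    by (auto simp: vec_eq_iff dil_def flow_def sum_distrib_left power_mult_distrib field_simps intro!: sum.cong)
qed

section \<open>Words of flows and translations along the layers\<close>

lemma Ck_const: "Ck k (\<lambda>_::real^'n. c)"
proof (induction k arbitrary: c)
  case (Suc k)
  moreover have "pderiv_j j (\<lambda>_. c) = (\<lambda>_. 0)" for j :: 'n
    by (simp add: pderiv_vf vf_apply_const fun_eq_iff)
  ultimately show ?case by simp
qed simp

lemma smooth_fun_coord: "smooth_fun (\<lambda>x::real^'n. x $ j)"
proof -
  have "pderiv_j i (\<lambda>x. x $ j) = (\<lambda>_. axis i 1 $ j)" for i :: 'n
    by (simp add: pderiv_vf vf_apply_coord fun_eq_iff)
  then have "Ck (Suc k) (\<lambda>x::real^'n. x $ j)" for k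
    using C1_diff[OF C1_coord, of j] by (simp add: Ck_const)
  moreover have "Ck 0 (\<lambda>x::real^'n. x $ j)" by (simp add: C1_cont[OF C1_coord])
  ultimately show ?thesis unfolding smooth_fun_def by (metis not0_implies_Suc)
qed

lemma homogeneous_deg1_hom_vf:
  assumes "homogeneous_deg1 \<sigma> V"
  shows "hom_vf \<sigma> 1 V"
  unfolding hom_vf_def
proof (intro allI impI)
  fix t :: real and x j assume t: "0 < t"
  have "vf_apply V ((\<lambda>x. x $ j) \<circ> dil \<sigma> t) x = t * vf_apply V (\<lambda>x. x $ j) (dil \<sigma> t x)"
    using assms t smooth_fun_coord unfolding homogeneous_deg1_def by blast
  moreover have "(\<lambda>x. x $ j) \<circ> dil \<sigma> t = (\<lambda>x. t ^ \<sigma> j * x $ j)"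
    by (simp add: fun_eq_iff dil_def)
  ultimately show "t ^ 1 * V (dil \<sigma> t x) $ j = t ^ \<sigma> j * V x $ j"
    using vf_apply_cmult[of "\<lambda>x. x $ j" x V "t ^ \<sigma> j"] C1_diff[OF C1_coord, of j x]
    by (simp add: vf_apply_coord)
qed

section \<open>Brackets as commutators of derivations, and their degrees\<close>

lemma lie_bracket_nth:
  assumes "\<And>j. (\<lambda>x. V x $ j) differentiable at x" "\<And>j. (\<lambda>x. W x $ j) differentiable at x"
  shows "lie_bracket V W x $ j = vf_apply V (\<lambda>x. W x $ j) x - vf_apply W (\<lambda>x. V x $ j) x"
proof -
  have *: "frechet_derivative Z (at x) h $ j = frechet_derivative (\<lambda>x. Z x $ j) (at x) h"
    if "\<And>j. (\<lambda>x. Z x $ j) differentiable at x" for Z :: "real^'a \<Rightarrow> real^'a" and h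
  proof -
    have "(Z has_derivative (\<lambda>h. \<chi> j. frechet_derivative (\<lambda>x. Z x $ j) (at x) h)) (at x)"
      using that by (intro has_derivative_vecI) (simp add: frechet_derivative_works[symmetric])
    then have "frechet_derivative Z (at x) = (\<lambda>h. \<chi> j. frechet_derivative (\<lambda>x. Z x $ j) (at x) h)"
      by (rule frechet_derivative_at[symmetric])
    then show ?thesis by simp
  qed
  show ?thesis
    unfolding lie_bracket_def vf_apply_def using *[OF assms(1)] *[OF assms(2)] by simp
qed

lemma lowers_nth_diffble: "lowers \<sigma> k V \<Longrightarrow> (\<lambda>x. V x $ j) differentiable at x"
  unfolding lowers_def using wpoly_diffble by blast

lemma lowers_bracket:
  assumes "lowers \<sigma> a V" "lowers \<sigma> b W" "0 \<le> a" "0 \<le> b"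
  shows "lowers \<sigma> (a + b) (lie_bracket V W)"
  unfolding lowers_def
proof
  fix j
  have "wpoly \<sigma> (int (\<sigma> j) - b - a) (vf_apply V (\<lambda>x. W x $ j))"
    "wpoly \<sigma> (int (\<sigma> j) - a - b) (vf_apply W (\<lambda>x. V x $ j))"
    using assms by (auto simp: lowers_def intro!: lowers_apply)
  then have "wpoly \<sigma> (int (\<sigma> j) - (a + b))
      (\<lambda>x. vf_apply V (\<lambda>x. W x $ j) x - vf_apply W (\<lambda>x. V x $ j) x)"
    by (intro wpoly_diff) (simp_all add: algebra_simps)
  then show "wpoly \<sigma> (int (\<sigma> j) - (a + b)) (\<lambda>x. lie_bracket V W x $ j)"
    using lowers_nth_diffble[OF assms(1)] lowers_nth_diffble[OF assms(2)]
    by (simp add: lie_bracket_nth)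
qed

text \<open>Both sides are derivations in \<open>f\<close> and agree on coordinates. Induction over
  weighted polynomials thus replaces the symmetry of second derivatives.\<close>

lemma vf_apply_bracket:
  assumes V: "lowers \<sigma> a V" "0 \<le> a" and W: "lowers \<sigma> b W" "0 \<le> b" and f: "wpoly \<sigma> d f"
  shows "vf_apply (lie_bracket V W) f x = vf_apply V (vf_apply W f) x - vf_apply W (vf_apply V f) x"
  using f
proof (induction arbitrary: x rule: wpoly.induct)
  case (zero d)
  show ?case by (simp add: vf_apply_const vf_apply_const[abs_def])
next
  case (const d c)
  show ?case by (simp add: vf_apply_const vf_apply_const[abs_def])
next
  case (coord j d)
  have "vf_apply W (\<lambda>x. x $ j) = (\<lambda>x. W x $ j)" "vf_apply V (\<lambda>x. x $ j) = (\<lambda>x. V x $ j)"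
    by (simp_all add: fun_eq_iff vf_apply_coord)
  then show ?case
    using lowers_nth_diffble[OF V(1)] lowers_nth_diffble[OF W(1)]
    by (simp add: vf_apply_coord lie_bracket_nth)
next
  case (add d f g)
  note d = add.hyps[THEN wpoly_diffble]
    add.hyps[THEN lowers_apply[OF V], THEN wpoly_diffble]
    add.hyps[THEN lowers_apply[OF W], THEN wpoly_diffble]
  have "vf_apply Z (\<lambda>x. f x + g x) = (\<lambda>x. vf_apply Z f x + vf_apply Z g x)" for Z
    by (simp add: fun_eq_iff vf_apply_add d)
  then show ?case by (simp add: vf_apply_add d add.IH)
next
  case (mult d f e g)
  note d = mult.hyps[THEN wpoly_diffble]
    mult.hyps[THEN lowers_apply[OF V], THEN wpoly_diffble]
    mult.hyps[THEN lowers_apply[OF W], THEN wpoly_diffble]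
  have "vf_apply Z (\<lambda>x. f x * g x) = (\<lambda>x. vf_apply Z f x * g x + f x * vf_apply Z g x)" for Z
    by (simp add: fun_eq_iff vf_apply_mult d)
  then show ?case by (simp add: vf_apply_add vf_apply_mult d mult.IH algebra_simps)
qed

lemma hom_vf_bracket:
  assumes V: "lowers \<sigma> k V" "hom_vf \<sigma> a V" and W: "lowers \<sigma> l W" "hom_vf \<sigma> b W"
  shows "hom_vf \<sigma> (a + b) (lie_bracket V W)"
  unfolding hom_vf_def
proof (intro allI impI)
  fix t :: real and x j assume t: "0 < t"
  have "t ^ (a + b) * vf_apply V (\<lambda>x. W x $ j) (dil \<sigma> t x) = t ^ \<sigma> j * vf_apply V (\<lambda>x. W x $ j) x"
    using W(2) t by (intro hom_vf_apply V lowers_nth_diffble[OF W(1)]) (auto simp: hom_vf_def)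
  moreover have "t ^ (b + a) * vf_apply W (\<lambda>x. V x $ j) (dil \<sigma> t x) = t ^ \<sigma> j * vf_apply W (\<lambda>x. V x $ j) x"
    using V(2) t by (intro hom_vf_apply W lowers_nth_diffble[OF V(1)]) (auto simp: hom_vf_def)
  ultimately show "t ^ (a + b) * lie_bracket V W (dil \<sigma> t x) $ j = t ^ \<sigma> j * lie_bracket V W x $ j"
    using lowers_nth_diffble[OF V(1)] lowers_nth_diffble[OF W(1)]
    by (simp add: lie_bracket_nth right_diff_distrib add.commute)
qed

text \<open>The dilations fix the origin, so a field of degree \<open>k\<close> has there only
  components of weight \<open>k\<close>; the factor 2 already separates the powers.\<close>

lemma hom_vf_zero:
  assumes "hom_vf \<sigma> k V" "\<sigma> j \<noteq> k"
  shows "V 0 $ j = 0"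
proof -
  have "dil \<sigma> 2 0 = (0 :: real^'a)" by (simp add: dil_def vec_eq_iff)
  then have "2 ^ k * V 0 $ j = 2 ^ \<sigma> j * V 0 $ j"
    using assms(1)[unfolded hom_vf_def, rule_format, of 2 0 j] by simp
  moreover have "(2::real) ^ k \<noteq> 2 ^ \<sigma> j" using assms(2) by (simp add: power_inject_exp)
  ultimately show ?thesis by simp
qed

lemma frechet_derivative_add:
  assumes "f differentiable at x" "g differentiable at x"
  shows "frechet_derivative (\<lambda>x. f x + g x) (at x) h
    = frechet_derivative f (at x) h + frechet_derivative g (at x) h"
  using frechet_derivative_at[OF has_derivative_add[OF assms[unfolded frechet_derivative_works]], symmetric]
  by simp

lemma frechet_derivative_scaleR:
  assumes "f differentiable at x"
  shows "frechet_derivative (\<lambda>x. c *\<^sub>R f x) (at x) h = c *\<^sub>R frechet_derivative f (at x) h"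
  using frechet_derivative_at[OF has_derivative_scaleR_right[OF assms[unfolded frechet_derivative_works]], symmetric]
  by simp

text \<open>The order on the index type sorts the coordinates by weight, so that a map which changes
  each coordinate by a function of lower weights is triangular.\<close>

locale hom_system =
  fixes \<sigma> :: "'n::{finite,linorder} \<Rightarrow> nat"
    and X :: "nat \<Rightarrow> (real, 'n) vec \<Rightarrow> (real, 'n) vec" and m :: nat
  assumes sigma_pos: "1 \<le> \<sigma> j"
    and sigma_mono: "j \<le> k \<Longrightarrow> \<sigma> j \<le> \<sigma> k"
    and smooth: "i < m \<Longrightarrow> smooth_vf (X i)"
    and homog: "i < m \<Longrightarrow> homogeneous_deg1 \<sigma> (X i)"
    and hoer: "hoermander X m"
begin

lemma X_hom: "i < m \<Longrightarrow> hom_vf \<sigma> 1 (X i)"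
  using homog homogeneous_deg1_hom_vf by blast

lemma X_lowers: assumes i: "i < m" shows "lowers \<sigma> 1 (X i)"
  unfolding lowers_def
proof
  fix j
  have "wpoly \<sigma> (int (\<sigma> j - 1)) (\<lambda>x. X i x $ j)"
  proof (rule homogeneous_wpoly[OF sigma_pos])
    show "smooth_fun (\<lambda>x. X i x $ j)" using smooth[OF i] by (simp add: smooth_vf_def)
    fix t :: real and x :: "(real, 'n) vec" assume t: "0 < t"
    have "t * X i (dil \<sigma> t x) $ j = t * (t ^ (\<sigma> j - 1) * X i x $ j)"
      using X_hom[OF i] t sigma_pos[of j]
      by (simp add: hom_vf_def flip: power_Suc mult.assoc)
    then show "X i (dil \<sigma> t x) $ j = t ^ (\<sigma> j - 1) * X i x $ j" using t by simp
  qed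
  then show "wpoly \<sigma> (int (\<sigma> j) - 1) (\<lambda>x. X i x $ j)"
    using sigma_pos[of j] by (simp add: of_nat_diff)
qed

abbreviation \<Phi> :: "nat \<Rightarrow> real \<Rightarrow> (real, 'n) vec \<Rightarrow> (real, 'n) vec" where
  "\<Phi> i \<equiv> flow \<sigma> (X i)"

fun wrun :: "(nat \<times> real) list \<Rightarrow> (real, 'n) vec \<Rightarrow> (real, 'n) vec" where
  "wrun [] x = x"
| "wrun ((i, t) # w) x = wrun w (\<Phi> i t x)"

definition word :: "(nat \<times> real) list \<Rightarrow> bool" where
  "word w \<longleftrightarrow> (\<forall>p\<in>set w. fst p < m)"

definition winv :: "(nat \<times> real) list \<Rightarrow> (nat \<times> real) list" where
  "winv w = rev (map (\<lambda>(i, t). (i, - t)) w)"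

definition wscale :: "real \<Rightarrow> (nat \<times> real) list \<Rightarrow> (nat \<times> real) list" where
  "wscale r w = map (\<lambda>(i, t). (i, r * t)) w"

lemma word_simps [simp]:
  "word []" "word ((i, t) # w) \<longleftrightarrow> i < m \<and> word w" "word (v @ w) \<longleftrightarrow> word v \<and> word w"
  "word (winv w) \<longleftrightarrow> word w" "word (wscale r w) \<longleftrightarrow> word w"
  by (auto simp: word_def winv_def wscale_def)

lemma winv_simps [simp]: "winv [] = []" "winv ((i, t) # w) = winv w @ [(i, - t)]"
  by (simp_all add: winv_def)

lemma wscale_simps [simp]: "wscale r [] = []" "wscale r ((i, t) # w) = (i, r * t) # wscale r w"
  by (simp_all add: wscale_def)

lemma winv_winv [simp]: "winv (winv w) = w"
  by (simp add: winv_def rev_map o_def case_prod_beta)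

lemma wrun_append: "wrun (v @ w) x = wrun w (wrun v x)"
  by (induction v arbitrary: x) auto

lemma wrun_winv: "word w \<Longrightarrow> wrun (winv w) (wrun w x) = x"
  by (induction w arbitrary: x) (auto simp: wrun_append flow_inverse X_lowers)

lemma wrun_winv2: "word w \<Longrightarrow> wrun w (wrun (winv w) x) = x"
  using wrun_winv[of "winv w" x] by simp

lemma wrun_dil: "word w \<Longrightarrow> 0 < r \<Longrightarrow> dil \<sigma> r (wrun w x) = wrun (wscale r w) (dil \<sigma> r x)"
  by (induction w arbitrary: x) (auto simp: flow_dil[OF X_lowers X_hom])

lemma flow_low:
  assumes i: "i < m" and f: "wpoly \<sigma> d f"
  shows "wpoly \<sigma> (d - 1) (\<lambda>x. f (\<Phi> i t x) - f x)"
proof -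
  have "f (\<Phi> i t x) - f x = (\<Sum>k\<le>nat d. t ^ Suc k / fact (Suc k) * (vf_apply (X i) ^^ Suc k) f x)" for x
    using exp_sum_flow[OF X_lowers[OF i] f, of "Suc (nat d)" t x]
    by (simp add: sum.atMost_Suc_shift del: sum.atMost_Suc funpow.simps(2))
  moreover have "wpoly \<sigma> (d - 1) (\<lambda>x. \<Sum>k\<le>nat d. t ^ Suc k / fact (Suc k) * (vf_apply (X i) ^^ Suc k) f x)"
    by (intro wpoly_sum wpoly_cmult wpoly_mono[OF wpoly_funpow[OF X_lowers[OF i] f]]) auto
  ultimately show ?thesis by simp
qed

lemma wrun_low:
  assumes "word w" "wpoly \<sigma> d f"
  shows "wpoly \<sigma> (d - 1) (\<lambda>x. f (wrun w x) - f x)"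
  using assms
proof (induction w arbitrary: d f)
  case Nil
  then show ?case by (simp add: wpoly.zero)
next
  case (Cons p w)
  obtain i t where p: "p = (i, t)" by force
  have i: "i < m" using Cons.prems p by simp
  let ?g = "\<lambda>x. f (wrun w x)"
  have g: "wpoly \<sigma> (d - 1) (\<lambda>x. ?g x - f x)" using Cons by (simp add: p)
  then have "wpoly \<sigma> d (\<lambda>x. (?g x - f x) + f x)"
    by (intro wpoly.add Cons.prems) (auto intro: wpoly_mono)
  then have "wpoly \<sigma> (d - 1) (\<lambda>x. ?g (\<Phi> i t x) - ?g x)"
    using flow_low[OF i, of d ?g] by simp
  from wpoly.add[OF this g] show ?case by (simp add: p)
qed

lemma wrun_wpoly:
  assumes "word w" "wpoly \<sigma> d f"
  shows "wpoly \<sigma> d (\<lambda>x. f (wrun w x))"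
  using wpoly.add[OF wpoly_mono[OF wrun_low[OF assms]] assms(2)] by simp

text \<open>The error is one degree below \<open>V f\<close>. On a coordinate of weight at most
  \<open>k\<close> it has negative degree, so there the word acts exactly as 1 + V.\<close>

definition realises :: "int \<Rightarrow> ((real, 'n) vec \<Rightarrow> (real, 'n) vec) \<Rightarrow> (nat \<times> real) list \<Rightarrow> bool" where
  "realises k V w \<longleftrightarrow> word w \<and>
     (\<forall>d f. wpoly \<sigma> d f \<longrightarrow> wpoly \<sigma> (d - k - 1) (\<lambda>x. f (wrun w x) - f x - vf_apply V f x))"

lemma realises_low:
  assumes "realises k V w" "lowers \<sigma> k V" "0 \<le> k" "wpoly \<sigma> d f"
  shows "wpoly \<sigma> (d - k) (\<lambda>x. f (wrun w x) - f x)"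
proof -
  have "wpoly \<sigma> (d - k - 1) (\<lambda>x. f (wrun w x) - f x - vf_apply V f x)"
    using assms unfolding realises_def by blast
  then have "wpoly \<sigma> (d - k) (\<lambda>x. f (wrun w x) - f x - vf_apply V f x)"
    by (rule wpoly_mono) simp
  from wpoly.add[OF this lowers_apply[OF assms(2-4)]]
  have "wpoly \<sigma> (d - k) (\<lambda>x. (f (wrun w x) - f x - vf_apply V f x) + vf_apply V f x)" .
  then show ?thesis by simp
qed

text \<open>Group commutators of words realise Lie brackets, without the Baker-Campbell-Hausdorff formula:
  a word acts on weighted polynomials as 1 + V + lower order, and such operators multiply.\<close>

lemma realises_bracket:
  assumes g: "realises a V v" "lowers \<sigma> a V" "0 \<le> a" and h: "realises b W w" "lowers \<sigma> b W" "0 \<le> b"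
  shows "realises (a + b) (lie_bracket V W) (v @ w @ winv v @ winv w)"
  unfolding realises_def
proof (intro conjI allI impI)
  have vw: "word v" "word w" using g h by (auto simp: realises_def)
  then show "word (v @ w @ winv v @ winv w)" by simp
  fix d f assume f: "wpoly \<sigma> d f"
  let ?n = "d - (a + b) - 1"
  \<comment> \<open>Absorbing the two inverse words into \<open>f1\<close> makes the value after the
    commutator and \<open>f x\<close> itself the values of \<open>f1\<close> after \<open>v\<close>,
    \<open>w\<close> in the two possible orders. Their difference produces the commutator of
    \<open>V\<close> and \<open>W\<close> on \<open>f1\<close>, and replacing \<open>f1\<close> by
    \<open>f\<close> there costs only \<open>r\<close>, one degree lower.\<close>
  define f1 where "f1 = (\<lambda>x. f (wrun (winv v @ winv w) x))"
  define r where "r = (\<lambda>x. f1 x - f x)"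
  have f1: "wpoly \<sigma> d f1" unfolding f1_def using vw f by (intro wrun_wpoly) auto
  have r: "wpoly \<sigma> (d - 1) r" unfolding r_def f1_def using vw f by (intro wrun_low) auto
  define eh where "eh = (\<lambda>x. f1 (wrun w x) - f1 x - vf_apply W f1 x)"
  define eg where "eg = (\<lambda>x. f1 (wrun v x) - f1 x - vf_apply V f1 x)"
  have eh: "wpoly \<sigma> (d - b - 1) eh" and eg: "wpoly \<sigma> (d - a - 1) eg"
    using f1 g h by (auto simp: realises_def eh_def eg_def)
  have Wf1: "wpoly \<sigma> (d - b) (vf_apply W f1)" and Vf1: "wpoly \<sigma> (d - a) (vf_apply V f1)"
    using lowers_apply[OF h(2,3) f1] lowers_apply[OF g(2,3) f1] by auto
  have 1: "wpoly \<sigma> ?n (\<lambda>x. vf_apply W f1 (wrun v x) - vf_apply W f1 x - vf_apply V (vf_apply W f1) x)"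
    using g(1)[unfolded realises_def, THEN conjunct2, rule_format, OF Wf1] by (simp add: algebra_simps)
  have 2: "wpoly \<sigma> ?n (\<lambda>x. vf_apply V f1 (wrun w x) - vf_apply V f1 x - vf_apply W (vf_apply V f1) x)"
    using h(1)[unfolded realises_def, THEN conjunct2, rule_format, OF Vf1] by (simp add: algebra_simps)
  have 3: "wpoly \<sigma> ?n (\<lambda>x. eh (wrun v x) - eh x)"
    using realises_low[OF g eh] by (simp add: algebra_simps)
  have 4: "wpoly \<sigma> ?n (\<lambda>x. eg (wrun w x) - eg x)"
    using realises_low[OF h eg] by (simp add: algebra_simps)
  have 5: "wpoly \<sigma> ?n (vf_apply (lie_bracket V W) r)"
    using lowers_apply[OF lowers_bracket[OF g(2) h(2) g(3) h(3)] _ r] g h by (simp add: algebra_simps)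
  have f1': "f1 x = f x + r x" for x by (simp add: r_def)
  have "vf_apply (lie_bracket V W) (\<lambda>x. f x + r x) x
      = vf_apply (lie_bracket V W) f x + vf_apply (lie_bracket V W) r x" for x
    using wpoly_diffble[OF f] wpoly_diffble[OF r] by (rule vf_apply_add)
  then have brf1: "vf_apply (lie_bracket V W) f1 x = vf_apply (lie_bracket V W) f x + vf_apply (lie_bracket V W) r x" for x
    by (simp add: r_def)
  have "f (wrun (v @ w @ winv v @ winv w) x) - f x - vf_apply (lie_bracket V W) f x
      = (vf_apply W f1 (wrun v x) - vf_apply W f1 x - vf_apply V (vf_apply W f1) x)
      - (vf_apply V f1 (wrun w x) - vf_apply V f1 x - vf_apply W (vf_apply V f1) x)
      + (eh (wrun v x) - eh x) - (eg (wrun w x) - eg x) + vf_apply (lie_bracket V W) r x" for x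
  proof -
    have "f (wrun (v @ w @ winv v @ winv w) x) = f1 (wrun w (wrun v x))"
      by (simp add: f1_def wrun_append)
    moreover have "f x = f1 (wrun v (wrun w x))"
      using vw by (simp add: f1_def wrun_append wrun_winv)
    moreover have "f1 (wrun w (wrun v x)) - f1 (wrun v (wrun w x))
      = (vf_apply W f1 (wrun v x) - vf_apply W f1 x)
      - (vf_apply V f1 (wrun w x) - vf_apply V f1 x)
      + (eh (wrun v x) - eh x) - (eg (wrun w x) - eg x)"
      by (simp add: eh_def eg_def)
    ultimately show ?thesis
      using brf1[of x] vf_apply_bracket[OF g(2,3) h(2,3) f1, of x] by linarith
  qed
  moreover have "wpoly \<sigma> ?n (\<lambda>x. (vf_apply W f1 (wrun v x) - vf_apply W f1 x - vf_apply V (vf_apply W f1) x)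
      - (vf_apply V f1 (wrun w x) - vf_apply V f1 x - vf_apply W (vf_apply V f1) x)
      + (eh (wrun v x) - eh x) - (eg (wrun w x) - eg x) + vf_apply (lie_bracket V W) r x)"
    by (intro wpoly.add wpoly_diff 1 2 3 4 5)
  ultimately show "wpoly \<sigma> (d - (a + b) - 1)
      (\<lambda>x. f (wrun (v @ w @ winv v @ winv w) x) - f x - vf_apply (lie_bracket V W) f x)"
    by (simp only:)
qed

text \<open>Iterated brackets without linear combinations, so that each one keeps a single degree of
  homogeneity.\<close>

inductive brk :: "nat \<Rightarrow> ((real, 'n) vec \<Rightarrow> (real, 'n) vec) \<Rightarrow> bool" where
  gen: "i < m \<Longrightarrow> brk 1 (X i)"
| bracket: "brk a V \<Longrightarrow> brk b W \<Longrightarrow> brk (a + b) (lie_bracket V W)"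

lemma brk_props: "brk k V \<Longrightarrow> lowers \<sigma> (int k) V \<and> hom_vf \<sigma> k V \<and> (\<exists>w. realises (int k) V w)"
proof (induction rule: brk.induct)
  case (gen i)
  have "realises 1 (X i) [(i, 1)]"
    using gen flow_expansion[OF X_lowers[OF gen]] by (simp add: realises_def)
  then show ?case using gen X_lowers X_hom by auto
next
  case (bracket a V b W)
  then obtain v w where vw: "realises (int a) V v" "realises (int b) W w"
    and V: "lowers \<sigma> (int a) V" "hom_vf \<sigma> a V" and W: "lowers \<sigma> (int b) W" "hom_vf \<sigma> b W"
    by blast
  show ?case
    using lowers_bracket[OF V(1) W(1)] hom_vf_bracket[OF V W]
      realises_bracket[OF vw(1) V(1) _ vw(2) W(1)] by auto
qed

text \<open>Closed under brackets by bilinearity, hence containing the Lie algebra, whose elements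
  mix degrees. At the origin it spans no more than the brackets themselves.\<close>

inductive brk_span :: "((real, 'n) vec \<Rightarrow> (real, 'n) vec) \<Rightarrow> bool" where
  base: "brk k V \<Longrightarrow> brk_span V"
| add: "brk_span V \<Longrightarrow> brk_span W \<Longrightarrow> brk_span (\<lambda>x. V x + W x)"
| scale: "brk_span V \<Longrightarrow> brk_span (\<lambda>x. c *\<^sub>R V x)"

text \<open>Needed for bilinearity: \<open>frechet_derivative\<close> is total, and only on
  differentiable fields does it respect sums and multiples.\<close>

lemma brk_span_differentiable: "brk_span V \<Longrightarrow> V differentiable at x"
proof (induction rule: brk_span.induct)
  case (base k V)
  then have "(\<lambda>x. V x $ j) differentiable at x" for j
    using brk_props lowers_nth_diffble by blast
  then have "(V has_derivative (\<lambda>h. \<chi> j. frechet_derivative (\<lambda>x. V x $ j) (at x) h)) (at x)"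
    by (intro has_derivative_vecI) (simp add: frechet_derivative_works[symmetric])
  then show ?case by (auto simp: differentiable_def)
qed auto

lemma brk_span_bracket_base:
  "brk_span W \<Longrightarrow> brk a V \<Longrightarrow> brk_span (lie_bracket V W)"
proof (induction rule: brk_span.induct)
  case (base k W)
  then show ?case using brk.bracket brk_span.base by blast
next
  case (add W W')
  have "lie_bracket V (\<lambda>x. W x + W' x) = (\<lambda>x. lie_bracket V W x + lie_bracket V W' x)"
    using add brk_span_differentiable[OF brk_span.base]
    by (simp add: fun_eq_iff lie_bracket_def frechet_derivative_add brk_span_differentiable
        linear_add[OF linear_frechet_derivative[OF brk_span_differentiable[OF brk_span.base]]])
  then show ?case using add brk_span.add by simp
next
  case (scale W c)
  have "lie_bracket V (\<lambda>x. c *\<^sub>R W x) = (\<lambda>x. c *\<^sub>R lie_bracket V W x)"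
    using scale
    by (simp add: fun_eq_iff lie_bracket_def frechet_derivative_scaleR brk_span_differentiable scaleR_diff_right
        linear_scale[OF linear_frechet_derivative[OF brk_span_differentiable[OF brk_span.base]]])
  then show ?case using scale brk_span.scale by simp
qed

lemma brk_span_bracket: "brk_span V \<Longrightarrow> brk_span W \<Longrightarrow> brk_span (lie_bracket V W)"
proof (induction rule: brk_span.induct)
  case (base k V)
  then show ?case using brk_span_bracket_base by blast
next
  case (add V V')
  have "lie_bracket (\<lambda>x. V x + V' x) W = (\<lambda>x. lie_bracket V W x + lie_bracket V' W x)"
    using add
    by (simp add: fun_eq_iff lie_bracket_def frechet_derivative_add brk_span_differentiable
        linear_add[OF linear_frechet_derivative[OF brk_span_differentiable]])
  then show ?case using add brk_span.add by simp
next
  case (scale V c)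
  have "lie_bracket (\<lambda>x. c *\<^sub>R V x) W = (\<lambda>x. c *\<^sub>R lie_bracket V W x)"
    using scale
    by (simp add: fun_eq_iff lie_bracket_def frechet_derivative_scaleR brk_span_differentiable scaleR_diff_right
        linear_scale[OF linear_frechet_derivative[OF brk_span_differentiable]])
  then show ?case using scale brk_span.scale by simp
qed

lemma lie_alg_brk_span: "V \<in> lie_alg X m \<Longrightarrow> brk_span V"
  by (induction rule: lie_alg.induct) (auto intro: brk_span.intros brk.gen brk_span_bracket)

lemma brk_span_at_0: "brk_span V \<Longrightarrow> V 0 \<in> span {W 0 | W k. brk k W}"
  by (induction rule: brk_span.induct) (auto intro: span_base span_add span_scale)

lemma span_brk_0: "span {W 0 | W k. brk k W} = UNIV"
proof -
  have "V 0 \<in> span {W 0 | W k. brk k W}" if "V \<in> lie_alg X m" for V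
    using brk_span_at_0[OF lie_alg_brk_span[OF that]] .
  then have "span {V 0 | V. V \<in> lie_alg X m} \<subseteq> span {W 0 | W k. brk k W}"
    by (intro span_minimal subspace_span) blast
  then show ?thesis using hoer unfolding hoermander_def by blast
qed

text \<open>Project onto the coordinates of weight \<open>\<sigma> j\<close>. At the origin a
  bracket of that degree is fixed by the projection and one of any other degree is killed, so the
  spanning property splits into layers.\<close>

lemma axis_in_layer_span: "axis j 1 \<in> span {W 0 | W. brk (\<sigma> j) W}"
proof -
  define P :: "(real, 'n) vec \<Rightarrow> (real, 'n) vec" where "P x = (\<chi> i. if \<sigma> i = \<sigma> j then x $ i else 0)" for x
  have linP: "linear P" by (rule linearI) (auto simp: P_def vec_eq_iff)
  have "P ` {W 0 | W k. brk k W} \<subseteq> span {W 0 | W. brk (\<sigma> j) W}"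
  proof clarify
    fix W k assume W: "brk k W"
    have z: "W 0 $ i = 0" if "\<sigma> i \<noteq> k" for i using hom_vf_zero[where \<sigma> = \<sigma> and V = W and j = i, OF _ that] brk_props[OF W] by blast
    show "P (W 0) \<in> span {W 0 | W. brk (\<sigma> j) W}"
    proof (cases "k = \<sigma> j")
      case True
      then have "P (W 0) = W 0" using z by (auto simp: P_def vec_eq_iff)
      then show ?thesis using W True by (auto intro: span_base)
    next
      case False
      then have "P (W 0) = 0" using z by (auto simp: P_def vec_eq_iff)
      then show ?thesis by (simp add: span_zero)
    qed
  qed
  then have "span (P ` {W 0 | W k. brk k W}) \<subseteq> span {W 0 | W. brk (\<sigma> j) W}"
    by (rule span_minimal) simp
  then have "P (axis j 1) \<in> span {W 0 | W. brk (\<sigma> j) W}"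
    unfolding linear_span_image[OF linP] span_brk_0 by blast
  moreover have "P (axis j 1) = axis j 1" by (auto simp: P_def vec_eq_iff axis_def)
  ultimately show ?thesis by simp
qed

section \<open>Words that act as translations on the coordinates of low weight\<close>

definition shifts :: "nat \<Rightarrow> (real, 'n) vec \<Rightarrow> (nat \<times> real) list \<Rightarrow> bool" where
  "shifts s c w \<longleftrightarrow> word w \<and> (\<forall>k. \<sigma> k \<noteq> s \<longrightarrow> c $ k = 0) \<and>
     (\<forall>x k. \<sigma> k \<le> s \<longrightarrow> wrun w x $ k = x $ k + c $ k)"

text \<open>For \<open>\<sigma> k \<le> s\<close> the error of the word has negative degree, so it
  vanishes, and the component of \<open>W\<close> has degree at most 0, so it equals its value at
  the origin.\<close>

lemma shifts_brk:
  assumes "brk s W"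
  shows "\<exists>w. shifts s (W 0) w"
proof -
  from brk_props[OF assms] obtain w where
    W: "lowers \<sigma> (int s) W" "hom_vf \<sigma> s W" "realises (int s) W w" by blast
  have "wrun w x $ k = x $ k + W 0 $ k" if k: "\<sigma> k \<le> s" for x k
  proof -
    have "wpoly \<sigma> (int (\<sigma> k) - int s - 1) (\<lambda>x. wrun w x $ k - x $ k - vf_apply W (\<lambda>x. x $ k) x)"
      using W(3) wpoly.coord[OF order_refl] unfolding realises_def by blast
    from wpoly_neg[OF this, of x] k have "wrun w x $ k = x $ k + W x $ k"
      by (simp add: vf_apply_coord)
    moreover have "W x $ k = W 0 $ k"
      using W(1) k unfolding lowers_def
      by (intro wpoly_zero_deg[OF spec[where x = k] _ sigma_pos]) auto
    ultimately show ?thesis by simp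
  qed
  then show ?thesis using W hom_vf_zero[where \<sigma> = \<sigma> and V = W, OF W(2)] unfolding shifts_def realises_def by blast
qed

lemma shifts_add: "shifts s c v \<Longrightarrow> shifts s d w \<Longrightarrow> shifts s (c + d) (v @ w)"
  by (simp add: shifts_def wrun_append)

lemma shifts_inv: assumes "shifts s c w" shows "shifts s (- c) (winv w)"
proof -
  have "wrun (winv w) x $ k = x $ k + (- c) $ k" if "\<sigma> k \<le> s" for x k
  proof -
    have "wrun w (wrun (winv w) x) $ k = wrun (winv w) x $ k + c $ k"
      using assms that by (simp add: shifts_def)
    then show ?thesis using assms by (simp add: wrun_winv2 shifts_def)
  qed
  then show ?thesis using assms by (simp add: shifts_def)
qed

lemma dil_inverse: "0 < r \<Longrightarrow> dil \<sigma> r (dil \<sigma> (inverse r) x) = x"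
  by (simp add: dil_def vec_eq_iff flip: power_mult_distrib mult.assoc)

lemma shifts_wscale:
  assumes "shifts s c w" "0 < r" shows "shifts s (r ^ s *\<^sub>R c) (wscale r w)"
proof -
  have "wrun (wscale r w) x $ k = x $ k + (r ^ s *\<^sub>R c) $ k" if "\<sigma> k \<le> s" for x k
  proof -
    let ?y = "dil \<sigma> (inverse r) x"
    have "wrun (wscale r w) x = dil \<sigma> r (wrun w ?y)"
      using wrun_dil[of w r ?y] assms by (simp add: dil_inverse shifts_def)
    then have "wrun (wscale r w) x $ k = r ^ \<sigma> k * (?y $ k + c $ k)"
      using assms that by (simp add: shifts_def dil_def)
    also have "\<dots> = dil \<sigma> r ?y $ k + r ^ \<sigma> k * c $ k" by (simp add: dil_def distrib_left)
    also have "r ^ \<sigma> k * c $ k = r ^ s * c $ k" using assms by (cases "\<sigma> k = s") (auto simp: shifts_def)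
    finally show ?thesis using assms by (simp add: dil_inverse)
  qed
  then show ?thesis using assms by (simp add: shifts_def)
qed

text \<open>A positive multiple \<open>a\<close> of a translation comes from conjugating its word
  with the dilation by the \<open>s\<close>-th root of \<open>a\<close>, a negative one from the
  inverse word, a sum from concatenation.\<close>

lemma shifts_span:
  assumes s: "1 \<le> s" and c: "c \<in> span {W 0 | W. brk s W}"
  shows "\<exists>w. shifts s c w"
  using c
proof (induction rule: span_induct_alt)
  case base
  have "shifts s 0 []" by (simp add: shifts_def)
  then show ?case by blast
next
  case (step a x y)
  obtain v where v: "shifts s y v" using step by blast
  obtain w where w: "shifts s x w" using step shifts_brk by blast
  have "\<exists>w. shifts s (a *\<^sub>R x) w"
  proof -
    consider "a = 0" | "0 < a" | "a < 0" by linarith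
    then show ?thesis
    proof cases
      case 1
      then have "shifts s (a *\<^sub>R x) []" by (simp add: shifts_def)
      then show ?thesis by blast
    next
      case 2
      then show ?thesis using shifts_wscale[OF w, of "root s a"] s by auto
    next
      case 3
      then show ?thesis using shifts_inv[OF shifts_wscale[OF w, of "root s (- a)"]] s by auto
    qed
  qed
  then show ?case using shifts_add v by blast
qed

lemma ex_unit_shift: "\<exists>w. shifts (\<sigma> j) (axis j 1) w"
  using shifts_span[OF sigma_pos axis_in_layer_span] .

definition unit_word :: "'n \<Rightarrow> (nat \<times> real) list" where
  "unit_word j = (SOME w. shifts (\<sigma> j) (axis j 1) w)"

lemma unit_word: "shifts (\<sigma> j) (axis j 1) (unit_word j)"
  unfolding unit_word_def using someI_ex[OF ex_unit_shift] .

text \<open>The times are of size \<open>\<bar>s\<bar>\<close> to the power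
  \<open>1 / \<sigma> j\<close>, the homogeneous size of a displacement \<open>s\<close> in a
  coordinate of weight \<open>\<sigma> j\<close>; the energy estimates depend on this.\<close>

definition shift_word :: "'n \<Rightarrow> real \<Rightarrow> (nat \<times> real) list" where
  "shift_word j s = wscale (root (\<sigma> j) \<bar>s\<bar>) (if 0 \<le> s then unit_word j else winv (unit_word j))"

declare flow_0 [simp]

lemma wrun_wscale_0: "wrun (wscale 0 w) x = x"
  by (induction w arbitrary: x) auto

lemma word_shift_word [simp]: "word (shift_word j s)"
  using unit_word[of j] by (simp add: shift_word_def shifts_def)

lemma wrun_shift_word:
  assumes "\<sigma> k \<le> \<sigma> j"
  shows "wrun (shift_word j s) x $ k = x $ k + (if k = j then s else 0)"
proof -
  consider "s = 0" | "0 < s" | "s < 0" by linarith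
  then show ?thesis
  proof cases
    case 1
    then show ?thesis by (simp add: shift_word_def wrun_wscale_0)
  next
    case 2
    then show ?thesis
      using shifts_wscale[OF unit_word, of "root (\<sigma> j) s" j] sigma_pos[of j] assms
      by (auto simp: shift_word_def shifts_def axis_def)
  next
    case 3
    then show ?thesis
      using shifts_wscale[OF shifts_inv[OF unit_word], of "root (\<sigma> j) (- s)" j] sigma_pos[of j] assms
      by (auto simp: shift_word_def shifts_def axis_def)
  qed
qed

end

section \<open>Triangular maps preserve Lebesgue measure\<close>

text \<open>Phrased through integrals of nonnegative functions, so that no inverse of
  \<open>T\<close> is mentioned and composition is immediate.\<close>

definition mp :: "('a::euclidean_space \<Rightarrow> 'a) \<Rightarrow> bool" where
  "mp T \<longleftrightarrow> T \<in> borel_measurable borel \<and>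
     (\<forall>F::'a \<Rightarrow> ennreal. F \<in> borel_measurable borel \<longrightarrow>
        (\<integral>\<^sup>+x. F (T x) \<partial>lborel) = (\<integral>\<^sup>+x. F x \<partial>lborel))"

lemma mp_comp:
  assumes "mp S" "mp T" shows "mp (\<lambda>x. S (T x))"
proof -
  have [measurable]: "S \<in> borel_measurable borel" "T \<in> borel_measurable borel"
    using assms by (auto simp: mp_def)
  show ?thesis
    unfolding mp_def
  proof (intro conjI allI impI)
    fix F :: "'a \<Rightarrow> ennreal" assume [measurable]: "F \<in> borel_measurable borel"
    have "(\<integral>\<^sup>+x. F (S (T x)) \<partial>lborel) = (\<integral>\<^sup>+x. F (S x) \<partial>lborel)"
      using assms(2)[unfolded mp_def, THEN conjunct2, rule_format, of "\<lambda>x. F (S x)"] by simp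
    then show "(\<integral>\<^sup>+x. F (S (T x)) \<partial>lborel) = (\<integral>\<^sup>+x. F x \<partial>lborel)"
      using assms(1) by (simp add: mp_def)
  qed simp
qed

lemma nn_integral_lborel_plus:
  fixes F :: "'a::euclidean_space \<Rightarrow> ennreal"
  assumes [measurable]: "F \<in> borel_measurable borel"
  shows "(\<integral>\<^sup>+x. F (x + c) \<partial>lborel) = (\<integral>\<^sup>+x. F x \<partial>lborel)"
proof -
  have "(\<integral>\<^sup>+x. F x \<partial>lborel) = (\<integral>\<^sup>+x. F x \<partial>distr lborel borel ((+) c))"
    by (simp add: lborel_distr_plus)
  also have "\<dots> = (\<integral>\<^sup>+x. F (c + x) \<partial>lborel)" by (subst nn_integral_distr) simp_all
  finally show ?thesis by (simp add: add.commute)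
qed

text \<open>Averaging over the translations along e turns the shear into a translation of the parameter.\<close>

lemma mp_shear:
  fixes P :: "'a::euclidean_space \<Rightarrow> real"
  assumes P [measurable]: "P \<in> borel_measurable borel" and inv: "\<And>x t. P (x + t *\<^sub>R e) = P x"
  shows "mp (\<lambda>x. x + P x *\<^sub>R e)"
  unfolding mp_def
proof (intro conjI allI impI)
  fix F :: "'a \<Rightarrow> ennreal" assume [measurable]: "F \<in> borel_measurable borel"
  define \<phi> :: "real \<Rightarrow> ennreal" where "\<phi> = indicator {0..1}"
  have [measurable]: "\<phi> \<in> borel_measurable borel" by (simp add: \<phi>_def)
  have \<phi>1: "(\<integral>\<^sup>+t. \<phi> (t + s) \<partial>lborel) = 1" for s
    by (subst nn_integral_lborel_plus) (simp_all add: \<phi>_def)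
  have "(\<integral>\<^sup>+x. F (x + P x *\<^sub>R e) \<partial>lborel)
      = (\<integral>\<^sup>+x. (\<integral>\<^sup>+t. \<phi> t * F (x + P x *\<^sub>R e) \<partial>lborel) \<partial>lborel)"
    using \<phi>1[of 0] by (simp add: nn_integral_multc)
  also have "\<dots> = (\<integral>\<^sup>+t. (\<integral>\<^sup>+x. \<phi> t * F (x + P x *\<^sub>R e) \<partial>lborel) \<partial>lborel)"
    by (rule lborel_pair.Fubini'[symmetric]) simp
  also have "\<dots> = (\<integral>\<^sup>+t. (\<integral>\<^sup>+x. \<phi> t * F (x + t *\<^sub>R e + P x *\<^sub>R e) \<partial>lborel) \<partial>lborel)"
  proof (rule nn_integral_cong)
    fix t
    show "(\<integral>\<^sup>+x. \<phi> t * F (x + P x *\<^sub>R e) \<partial>lborel) = (\<integral>\<^sup>+x. \<phi> t * F (x + t *\<^sub>R e + P x *\<^sub>R e) \<partial>lborel)"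
      using nn_integral_lborel_plus[of "\<lambda>x. \<phi> t * F (x + P x *\<^sub>R e)" "t *\<^sub>R e"] by (simp add: inv)
  qed
  also have "\<dots> = (\<integral>\<^sup>+x. (\<integral>\<^sup>+t. \<phi> t * F (x + t *\<^sub>R e + P x *\<^sub>R e) \<partial>lborel) \<partial>lborel)"
    by (rule lborel_pair.Fubini') simp
  also have "\<dots> = (\<integral>\<^sup>+x. (\<integral>\<^sup>+t. \<phi> (t - P x) * F (x + t *\<^sub>R e) \<partial>lborel) \<partial>lborel)"
  proof (rule nn_integral_cong)
    fix x
    show "(\<integral>\<^sup>+t. \<phi> t * F (x + t *\<^sub>R e + P x *\<^sub>R e) \<partial>lborel) = (\<integral>\<^sup>+t. \<phi> (t - P x) * F (x + t *\<^sub>R e) \<partial>lborel)"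
      using nn_integral_lborel_plus[of "\<lambda>t. \<phi> (t - P x) * F (x + t *\<^sub>R e)" "P x"]
      by (simp add: scaleR_left_distrib add.assoc)
  qed
  also have "\<dots> = (\<integral>\<^sup>+t. (\<integral>\<^sup>+x. \<phi> (t - P x) * F (x + t *\<^sub>R e) \<partial>lborel) \<partial>lborel)"
    by (rule lborel_pair.Fubini'[symmetric]) simp
  also have "\<dots> = (\<integral>\<^sup>+t. (\<integral>\<^sup>+x. \<phi> (t - P x) * F x \<partial>lborel) \<partial>lborel)"
  proof (rule nn_integral_cong)
    fix t
    show "(\<integral>\<^sup>+x. \<phi> (t - P x) * F (x + t *\<^sub>R e) \<partial>lborel) = (\<integral>\<^sup>+x. \<phi> (t - P x) * F x \<partial>lborel)"
      using nn_integral_lborel_plus[of "\<lambda>x. \<phi> (t - P x) * F x" "t *\<^sub>R e"] by (simp add: inv)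
  qed
  also have "\<dots> = (\<integral>\<^sup>+x. (\<integral>\<^sup>+t. \<phi> (t - P x) * F x \<partial>lborel) \<partial>lborel)"
    by (rule lborel_pair.Fubini') simp
  also have "\<dots> = (\<integral>\<^sup>+x. F x \<partial>lborel)"
  proof (rule nn_integral_cong)
    fix x
    show "(\<integral>\<^sup>+t. \<phi> (t - P x) * F x \<partial>lborel) = F x"
      using \<phi>1[of "- P x"] by (simp add: nn_integral_multc)
  qed
  finally show "(\<integral>\<^sup>+x. F (x + P x *\<^sub>R e) \<partial>lborel) = (\<integral>\<^sup>+x. F x \<partial>lborel)" .
qed simp

text \<open>\<open>T\<close> is a composition of shears that change one coordinate each. The
  coordinates are processed from the largest index downwards.\<close>

lemma mp_triangular:
  fixes T :: "(real, 'n::{finite,linorder}) vec \<Rightarrow> (real, 'n) vec"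
  assumes T [measurable]: "T \<in> borel_measurable borel"
    and tri: "\<And>k x y. (\<And>j. j < k \<Longrightarrow> x $ j = y $ j) \<Longrightarrow> T x $ k - x $ k = T y $ k - y $ k"
  shows "mp T"
proof -
  have "mp (\<lambda>x. \<chi> k. if k \<in> U then T x $ k else x $ k)" if "finite U" for U
    using that
  proof (induction U rule: finite_linorder_min_induct)
    case empty
    show ?case by (simp add: mp_def)
  next
    case (insert b U)
    let ?P = "\<lambda>x. T x $ b - x $ b"
    let ?TU = "\<lambda>x. \<chi> k. if k \<in> U then T x $ k else x $ k"
    have bU: "b \<notin> U" "\<And>j. j < b \<Longrightarrow> j \<notin> U" using insert.hyps by force+
    have nth: "(\<lambda>x::(real, 'n) vec. x $ b) \<in> borel_measurable borel"
      by (intro borel_measurable_continuous_onI continuous_intros)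
    have "mp (\<lambda>x. x + ?P x *\<^sub>R axis b 1)"
    proof (rule mp_shear)
      show "?P \<in> borel_measurable borel"
        using nth by (intro borel_measurable_diff measurable_compose[OF T nth])
      show "?P (x + t *\<^sub>R axis b 1) = ?P x" for x t
        by (rule tri) (simp add: axis_def)
    qed
    from mp_comp[OF this insert.IH]
    have "mp (\<lambda>x. ?TU x + ?P (?TU x) *\<^sub>R axis b 1)" .
    moreover have "?TU x + ?P (?TU x) *\<^sub>R axis b 1 = (\<chi> k. if k \<in> insert b U then T x $ k else x $ k)" for x
    proof -
      \<comment> \<open>The increment at \<open>b\<close> sees only indices below \<open>b\<close>,
        and \<open>?TU\<close> has not changed those yet.\<close>
      have "?P (?TU x) = ?P x" by (rule tri) (use bU in simp)
      then show ?thesis using bU(1) by (auto simp: vec_eq_iff axis_def)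
    qed
    ultimately show ?case by simp
  qed
  from this[of UNIV] show ?thesis by simp
qed

context hom_system
begin

section \<open>A measure-preserving parametrisation by words\<close>

lemma wrun_wscale_continuous:
  "word w \<Longrightarrow> continuous_on UNIV (\<lambda>p. wrun (wscale (fst p) w) (snd p))"
proof (induction w)
  case Nil
  show ?case by (simp add: continuous_on_snd)
next
  case (Cons q w)
  obtain i t where q: "q = (i, t)" by force
  have "continuous_on UNIV (\<lambda>p. \<Phi> i (fst p * t) (snd p))"
    using Cons.prems q
    by (intro continuous_on_compose2[OF flow_continuous[OF X_lowers[of i]],
          of UNIV "\<lambda>p. (fst p * t, snd p)", simplified]) (auto intro!: continuous_intros)
  then have "continuous_on UNIV (\<lambda>p. (fst p, \<Phi> i (fst p * t) (snd p)))"
    by (intro continuous_intros)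
  from continuous_on_compose2[OF Cons.IH this] Cons.prems q show ?case by simp
qed

lemma wrun_continuous: "word w \<Longrightarrow> continuous_on S (wrun w)"
proof (induction w arbitrary: S)
  case (Cons q w)
  obtain i t where q: "q = (i, t)" by force
  have "continuous_on S (\<Phi> i t)"
    using Cons.prems q
    by (intro continuous_on_compose2[OF flow_continuous[OF X_lowers[of i]],
          of S "\<lambda>x. (t, x)", simplified]) (auto intro!: continuous_intros)
  from continuous_on_compose2[OF Cons.IH[of UNIV] this] Cons.prems q show ?case by simp
qed simp

text \<open>The increment of coordinate \<open>k\<close> has degree \<open>\<sigma> k - 1\<close>,
  so it depends only on coordinates of smaller weight, and these precede \<open>k\<close>.\<close>

lemma wrun_mp:
  assumes w: "word w" shows "mp (wrun w)"
proof (rule mp_triangular)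
  show "wrun w \<in> borel_measurable borel"
    by (intro borel_measurable_continuous_onI wrun_continuous w)
  fix k and x y :: "(real, 'n) vec"
  assume eq: "\<And>j. j < k \<Longrightarrow> x $ j = y $ j"
  show "wrun w x $ k - x $ k = wrun w y $ k - y $ k"
  proof (rule wpoly_depends[OF wrun_low[OF w wpoly.coord[OF order_refl]] _ sigma_pos])
    fix j assume "int (\<sigma> j) \<le> int (\<sigma> k) - 1"
    then have "\<not> k \<le> j" using sigma_mono[of k j] by linarith
    then show "x $ j = y $ j" using eq by simp
  qed
qed

definition gword :: "'n list \<Rightarrow> (real, 'n) vec \<Rightarrow> (nat \<times> real) list" where
  "gword js \<tau> = concat (map (\<lambda>j. shift_word j (\<tau> $ j)) js)"

text \<open>The coordinates are shifted in increasing order: the word for a later index leaves every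
  earlier coordinate alone, its weight being no larger.\<close>

definition G :: "(real, 'n) vec \<Rightarrow> (real, 'n) vec \<Rightarrow> (real, 'n) vec" where
  "G \<tau> = wrun (gword (sorted_list_of_set UNIV) \<tau>)"

lemma word_gword [simp]: "word (gword js \<tau>)"
  by (induction js) (auto simp: gword_def)

lemma gword_cong: "(\<And>j. j \<in> set js \<Longrightarrow> \<tau> $ j = \<tau>' $ j) \<Longrightarrow> gword js \<tau> = gword js \<tau>'"
  unfolding gword_def by (intro arg_cong[where f = concat] map_cong) auto

lemma wrun_gword_above: "(\<And>j. j \<in> set js \<Longrightarrow> k < j) \<Longrightarrow> wrun (gword js \<tau>) x $ k = x $ k"
proof (induction js arbitrary: x)
  case (Cons j js)
  have "wrun (gword (j # js) \<tau>) x $ k = wrun (shift_word j (\<tau> $ j)) x $ k"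
    using Cons by (simp add: gword_def wrun_append)
  also have "\<dots> = x $ k"
    using Cons.prems[of j] sigma_mono[of k j] by (subst wrun_shift_word) auto
  finally show ?case .
qed (simp add: gword_def)

text \<open>Before index \<open>k\<close> is reached only the parameters below \<open>k\<close> have
  acted; its own word then adds the parameter \<open>k\<close>, and the later words fix the
  coordinate. Hence the unit diagonal in \<open>\<tau>\<close>.\<close>

lemma G_nth:
  "\<exists>as. set as = {..<k} \<and> (\<forall>\<tau> x. G \<tau> x $ k = wrun (gword as \<tau>) x $ k + \<tau> $ k)"
proof -
  let ?L = "sorted_list_of_set (UNIV :: 'n set)"
  obtain as bs where L: "?L = as @ k # bs"
    using split_list[of k ?L] by auto
  have sw: "sorted_wrt (<) (as @ k # bs)"
    unfolding L[symmetric] by (rule strict_sorted_list_of_set)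
  have "set as \<union> {k} \<union> set bs = UNIV" using arg_cong[OF L, of set] by auto
  then have "set as = {..<k}" using sw by (fastforce simp: sorted_wrt_append)
  moreover have "G \<tau> x $ k = wrun (gword as \<tau>) x $ k + \<tau> $ k" for \<tau> x
  proof -
    have "G \<tau> x = wrun (gword bs \<tau>) (wrun (shift_word k (\<tau> $ k)) (wrun (gword as \<tau>) x))"
      by (simp add: G_def L gword_def wrun_append)
    then have "G \<tau> x $ k = wrun (shift_word k (\<tau> $ k)) (wrun (gword as \<tau>) x) $ k"
      using sw by (simp add: wrun_gword_above sorted_wrt_append)
    then show ?thesis by (simp add: wrun_shift_word)
  qed
  ultimately show ?thesis by blast
qed

lemma wrun_shift_word_measurable:
  assumes [measurable]: "s \<in> borel_measurable M" "y \<in> borel_measurable M"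
  shows "(\<lambda>p. wrun (shift_word j (s p)) (y p)) \<in> borel_measurable M"
proof -
  have *: "(\<lambda>p. wrun (wscale (root (\<sigma> j) \<bar>s p\<bar>) w) (y p)) \<in> borel_measurable M" if "word w" for w
  proof -
    have [measurable]: "root (\<sigma> j) \<in> borel_measurable borel"
      by (intro borel_measurable_continuous_onI continuous_intros)
    have "(\<lambda>p. (root (\<sigma> j) \<bar>s p\<bar>, y p)) \<in> measurable M (borel \<Otimes>\<^sub>M borel)" by measurable
    then have "(\<lambda>p. (root (\<sigma> j) \<bar>s p\<bar>, y p)) \<in> measurable M borel" by (simp add: borel_prod)
    from measurable_compose[OF this borel_measurable_continuous_onI[OF wrun_wscale_continuous[OF that]]]
    show ?thesis by simp
  qed
  have w: "word (unit_word j)" using unit_word[of j] by (simp add: shifts_def)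
  have "(\<lambda>p. if 0 \<le> s p then wrun (wscale (root (\<sigma> j) \<bar>s p\<bar>) (unit_word j)) (y p)
          else wrun (wscale (root (\<sigma> j) \<bar>s p\<bar>) (winv (unit_word j))) (y p)) \<in> borel_measurable M"
    using *[OF w] *[of "winv (unit_word j)"] w by (intro measurable_If) auto
  then show ?thesis by (simp add: shift_word_def if_distrib[of "wscale _"] if_distrib[of "\<lambda>w. wrun w _"])
qed

lemma wrun_gword_measurable:
  assumes "y \<in> borel_measurable M" "\<tau> \<in> borel_measurable M"
  shows "(\<lambda>p. wrun (gword js (\<tau> p)) (y p)) \<in> borel_measurable M"
  using assms(1)
proof (induction js arbitrary: y)
  case (Cons j js)
  have "(\<lambda>p. \<tau> p $ j) \<in> borel_measurable M"
    by (rule measurable_compose[OF assms(2)])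
       (rule borel_measurable_continuous_onI, intro continuous_intros)
  from Cons.IH[OF wrun_shift_word_measurable[OF this Cons.prems]]
  show ?case by (simp add: gword_def wrun_append)
qed (simp add: gword_def)

lemma G_measurable [measurable]:
  "y \<in> borel_measurable M \<Longrightarrow> \<tau> \<in> borel_measurable M \<Longrightarrow> (\<lambda>p. G (\<tau> p) (y p)) \<in> borel_measurable M"
  unfolding G_def by (rule wrun_gword_measurable)

lemma G_mp_x: "mp (G \<tau>)"
  unfolding G_def by (intro wrun_mp) simp

text \<open>This lets a point \<open>y\<close> be replaced by the parameter that leads from
  \<open>x\<close> to \<open>y\<close>, with Jacobian 1 and for every base point at once.\<close>

lemma G_mp_\<tau>: "mp (\<lambda>\<tau>. G \<tau> x)"
proof (rule mp_triangular)
  fix k and \<tau> \<tau>' :: "(real, 'n) vec" assume eq: "\<And>j. j < k \<Longrightarrow> \<tau> $ j = \<tau>' $ j"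
  obtain as where as: "set as = {..<k}" "\<And>\<tau> x. G \<tau> x $ k = wrun (gword as \<tau>) x $ k + \<tau> $ k"
    using G_nth by blast
  have "gword as \<tau> = gword as \<tau>'" by (rule gword_cong) (use as eq in auto)
  then show "G \<tau> x $ k - \<tau> $ k = G \<tau>' x $ k - \<tau>' $ k" by (simp add: as)
qed measurable

definition dbox :: "real \<Rightarrow> (real, 'n) vec set" where
  "dbox r = {\<tau>. \<forall>j. \<bar>\<tau> $ j\<bar> \<le> r ^ \<sigma> j}"

definition times_le :: "real \<Rightarrow> (nat \<times> real) list \<Rightarrow> bool" where
  "times_le \<theta> w \<longleftrightarrow> (\<forall>p\<in>set w. \<bar>snd p\<bar> \<le> \<theta>)"

text \<open>\<open>L\<close> and \<open>T\<close> are maxima over the finitely many unit words, and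
  the root in \<open>shift_word\<close> turns the box of homogeneous radius \<open>r\<close> into
  times of order \<open>r\<close>. Uniform in \<open>js\<close> because
  \<open>G_param_bounded\<close> uses it for initial segments as well.\<close>

lemma gword_bounds:
  "\<exists>L T. 0 < T \<and> (\<forall>js r \<tau>. 0 \<le> r \<longrightarrow> \<tau> \<in> dbox r \<longrightarrow>
     length (gword js \<tau>) \<le> L * length js \<and> times_le (T * r) (gword js \<tau>))"
proof -
  define L where "L = Max (range (\<lambda>j. length (unit_word j)))"
  define S where "S = (\<Union>j. (\<lambda>p. \<bar>snd p\<bar>) ` set (unit_word j))"
  define T where "T = Max (insert 1 S)"
  have finS: "finite S" by (simp add: S_def)
  have L: "length (unit_word j) \<le> L" for j by (simp add: L_def)
  have T1: "1 \<le> T" using finS by (simp add: T_def)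
  have T: "\<bar>snd p\<bar> \<le> T" if "p \<in> set (unit_word j)" for p j
    using finS that unfolding T_def by (intro Max_ge) (auto simp: S_def)
  have len: "length (shift_word j s) \<le> L" for j s
    using L by (simp add: shift_word_def wscale_def winv_def)
  have tim: "times_le (T * r) (shift_word j s)" if "0 \<le> r" "\<bar>s\<bar> \<le> r ^ \<sigma> j" for r j s
  proof -
    have "root (\<sigma> j) \<bar>s\<bar> \<le> root (\<sigma> j) (r ^ \<sigma> j)"
      using sigma_pos[of j] that by simp
    also have "\<dots> = r" using sigma_pos[of j] that by (simp add: real_root_power_cancel)
    finally have root: "root (\<sigma> j) \<bar>s\<bar> \<le> r" .
    have root0: "0 \<le> root (\<sigma> j) \<bar>s\<bar>" by (rule real_root_ge_zero) simp
    show ?thesis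
      unfolding times_le_def
    proof
      fix p assume "p \<in> set (shift_word j s)"
      then obtain q where q: "q \<in> set (unit_word j)" "\<bar>snd p\<bar> = root (\<sigma> j) \<bar>s\<bar> * \<bar>snd q\<bar>"
        using root0 by (fastforce simp: shift_word_def wscale_def winv_def abs_mult split: if_splits)
      have "root (\<sigma> j) \<bar>s\<bar> * \<bar>snd q\<bar> \<le> r * T"
        using root root0 T[OF q(1)] that by (intro mult_mono) auto
      then show "\<bar>snd p\<bar> \<le> T * r" using q by (simp add: mult.commute)
    qed
  qed
  have "length (gword js \<tau>) \<le> L * length js \<and> times_le (T * r) (gword js \<tau>)"
    if "0 \<le> r" "\<tau> \<in> dbox r" for js r \<tau>
  proof (induction js)
    case Nil
    show ?case by (simp add: gword_def times_le_def)
  next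
    case (Cons j js)
    then show ?case
      using len[of j "\<tau> $ j"] tim[of r "\<tau> $ j" j] that
      by (auto simp: gword_def times_le_def dbox_def)
  qed
  then show ?thesis using T1 by (intro exI[of _ L] exI[of _ T]) auto
qed

lemma dbox_measurable [measurable]: "dbox r \<in> sets borel"
proof -
  have "dbox r = (\<Inter>j. {\<tau>. \<bar>\<tau> $ j\<bar> \<le> r ^ \<sigma> j})" by (auto simp: dbox_def)
  moreover have "closed {\<tau> :: (real, 'n) vec. \<bar>\<tau> $ j\<bar> \<le> r ^ \<sigma> j}" for j
    by (intro closed_Collect_le continuous_intros)
  ultimately show ?thesis by (simp add: borel_closed closed_INT)
qed

text \<open>The homogeneous dimension.\<close>

definition Q :: nat where "Q = (\<Sum>j\<in>UNIV. \<sigma> j)"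

lemma emeasure_dbox:
  assumes "0 \<le> r" shows "emeasure lborel (dbox r) = ennreal (2 ^ CARD('n) * r ^ Q)"
proof -
  have "dbox r = cbox (\<chi> j. - (r ^ \<sigma> j)) (\<chi> j. r ^ \<sigma> j)"
    by (auto simp: dbox_def mem_box_cart abs_le_iff minus_le_iff)
  moreover have "emeasure lborel (cbox (\<chi> j. - (r ^ \<sigma> j)) (\<chi> j. r ^ \<sigma> j) :: (real, 'n) vec set)
      = ennreal (\<Prod>j\<in>UNIV. 2 * r ^ \<sigma> j)"
  proof -
    have "(\<Prod>b\<in>Basis. ((\<chi> j. r ^ \<sigma> j) - (\<chi> j. - (r ^ \<sigma> j)) :: (real, 'n) vec) \<bullet> b) = (\<Prod>j\<in>UNIV. 2 * r ^ \<sigma> j)"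
      unfolding Basis_vec_def using assms
      by (subst prod.UNION_disjoint) (auto simp: inner_axis axis_eq_axis)
    then show ?thesis using assms
      by (subst emeasure_lborel_cbox) (auto simp: Basis_vec_def inner_axis)
  qed
  ultimately show ?thesis by (simp add: prod.distrib power_sum Q_def)
qed

end

section \<open>Energy bounds for increments along words\<close>

text \<open>Jensen's inequality on the unit interval, from the nonnegative variance of
  \<open>\<phi>\<close> about its mean \<open>A\<close>.\<close>

lemma sq_integral_le_nn:
  fixes \<phi> :: "real \<Rightarrow> real"
  assumes c: "continuous_on UNIV \<phi>"
  shows "ennreal ((integral {0..1} \<phi>)\<^sup>2) \<le> (\<integral>\<^sup>+\<theta>. ennreal ((\<phi> \<theta>)\<^sup>2) * indicator {0..1} \<theta> \<partial>lborel)"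
proof -
  define A where "A = integral {0..1} \<phi>"
  have c': "continuous_on {0..1} \<phi>" using c continuous_on_subset by blast
  have i1: "(\<phi> has_integral A) {0..1}"
    unfolding A_def by (intro integrable_integral integrable_continuous_real c')
  obtain I where i2: "((\<lambda>\<theta>. (\<phi> \<theta>)\<^sup>2) has_integral I) {0..1}"
    using integrable_continuous_real[of 0 1 "\<lambda>\<theta>. (\<phi> \<theta>)\<^sup>2"] c'
    by (auto simp: integrable_on_def intro!: continuous_intros)
  have i3: "((\<lambda>\<theta>. (\<phi> \<theta>)\<^sup>2 - 2 * A * \<phi> \<theta> + A\<^sup>2) has_integral (I - 2 * A * A + A\<^sup>2)) {0..1}"
    using i1 i2 has_integral_const_real[of "A\<^sup>2" 0 1]
    by (intro has_integral_add has_integral_diff has_integral_mult_right) auto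
  have "0 \<le> I - 2 * A * A + A\<^sup>2"
  proof (rule has_integral_nonneg[OF i3])
    fix \<theta>
    have "0 \<le> (\<phi> \<theta> - A)\<^sup>2" by simp
    then show "0 \<le> (\<phi> \<theta>)\<^sup>2 - 2 * A * \<phi> \<theta> + A\<^sup>2"
      by (simp add: power2_diff algebra_simps)
  qed
  then have "A\<^sup>2 \<le> I" by (simp add: power2_eq_square)
  moreover have "(\<integral>\<^sup>+\<theta>. ennreal ((\<phi> \<theta>)\<^sup>2) * indicator {0..1} \<theta> \<partial>lborel) = ennreal I"
  proof -
    have [measurable]: "\<phi> \<in> borel_measurable borel" by (rule borel_measurable_continuous_onI[OF c])
    have "((\<lambda>\<theta>. (\<phi> \<theta>)\<^sup>2 * indicator {0..1} \<theta>) has_integral I) UNIV"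
    proof -
      have "(\<lambda>\<theta>. (\<phi> \<theta>)\<^sup>2 * indicator {0..1} \<theta>) = (\<lambda>\<theta>. if \<theta> \<in> {0..1} then (\<phi> \<theta>)\<^sup>2 else 0)"
        by (simp add: fun_eq_iff indicator_def)
      then show ?thesis using i2 by (simp only: has_integral_restrict_UNIV)
    qed
    from nn_integral_has_integral_lborel[OF _ _ this]
    show ?thesis by (simp add: ennreal_mult ennreal_indicator)
  qed
  ultimately show ?thesis unfolding A_def[symmetric] by (simp add: ennreal_leI)
qed

lemma cball_borel [measurable]: "cball (x :: 'a::metric_space) R \<in> sets borel"
  by (intro borel_closed closed_cball)

context hom_system
begin

definition Xsq :: "((real, 'n) vec \<Rightarrow> real) \<Rightarrow> (real, 'n) vec \<Rightarrow> real" where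
  "Xsq f x = (\<Sum>i<m. (vf_apply (X i) f x)\<^sup>2)"

abbreviation nnb :: "real \<Rightarrow> ((real, 'n) vec \<Rightarrow> real) \<Rightarrow> ennreal" where
  "nnb R f \<equiv> (\<integral>\<^sup>+x. ennreal (f x) * indicator (cball 0 R) x \<partial>lborel)"

lemma Xsq_nonneg: "0 \<le> Xsq f x"
  by (simp add: Xsq_def sum_nonneg)

lemma X_continuous: assumes "i < m" shows "continuous_on S (X i)"
proof -
  have "continuous_on S (\<lambda>x. X i x $ j)" for j
    using smooth[OF assms] by (simp add: smooth_vf_def smooth_fun_C1 C1_cont)
  then have "continuous_on S (\<lambda>x. \<chi> j. X i x $ j)" by (rule continuous_on_vec_lambda)
  then show ?thesis by simp
qed

lemma vfX_continuous: "C1 f \<Longrightarrow> i < m \<Longrightarrow> continuous_on S (vf_apply (X i) f)"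
  by (intro C1_vf_cont X_continuous)

lemma Xsq_continuous: "C1 f \<Longrightarrow> continuous_on S (Xsq f)"
  unfolding Xsq_def[abs_def] by (intro continuous_intros vfX_continuous) auto

lemma flow_bounded: "\<exists>R'. \<forall>i t x. i < m \<longrightarrow> \<bar>t\<bar> \<le> S \<longrightarrow> norm x \<le> R \<longrightarrow> norm (\<Phi> i t x) \<le> R'"
proof -
  define U where "U = (\<Union>i<m. (\<lambda>p. \<Phi> i (fst p) (snd p)) ` ({- S..S} \<times> cball 0 R))"
  have "compact U"
    unfolding U_def
    by (intro compact_UN compact_continuous_image compact_Times compact_Icc compact_cball
        continuous_on_subset[OF flow_continuous[OF X_lowers]]) auto
  then have "\<exists>R'. \<forall>y\<in>U. norm y \<le> R'"
    using compact_imp_bounded unfolding bounded_iff[symmetric] by blast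
  then obtain R' where R': "y \<in> U \<Longrightarrow> norm y \<le> R'" for y
    by blast
  have "norm (\<Phi> i t x) \<le> R'" if "i < m" "\<bar>t\<bar> \<le> S" "norm x \<le> R" for i t x
    by (rule R'[unfolded U_def], rule UN_I[of i]) (use that in \<open>auto intro!: image_eqI[of _ _ "(t, x)"]\<close>)
  then show ?thesis by blast
qed

lemma times_le_simps [simp]:
  "times_le \<theta> []" "times_le \<theta> ((i, t) # w) \<longleftrightarrow> \<bar>t\<bar> \<le> \<theta> \<and> times_le \<theta> w"
  by (auto simp: times_le_def)

lemma wrun_bounded:
  "\<exists>R'. \<forall>w x. word w \<longrightarrow> length w \<le> L \<longrightarrow> times_le S w \<longrightarrow> norm x \<le> R \<longrightarrow> norm (wrun w x) \<le> R'"
proof (induction L arbitrary: R)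
  case 0
  show ?case by (intro exI[of _ R]) auto
next
  case (Suc L)
  obtain R1 where R1: "\<And>i t x. i < m \<Longrightarrow> \<bar>t\<bar> \<le> S \<Longrightarrow> norm x \<le> R \<Longrightarrow> norm (\<Phi> i t x) \<le> R1"
    using flow_bounded by metis
  obtain R2 where R2: "\<And>w x. word w \<Longrightarrow> length w \<le> L \<Longrightarrow> times_le S w \<Longrightarrow> norm x \<le> R1 \<Longrightarrow> norm (wrun w x) \<le> R2"
    using Suc.IH by metis
  have "norm (wrun w x) \<le> max R R2"
    if "word w" "length w \<le> Suc L" "times_le S w" "norm x \<le> R" for w x
  proof (cases w)
    case Nil
    then show ?thesis using that by simp
  next
    case (Cons p v)
    obtain i t where p: "p = (i, t)" by force
    have "norm (\<Phi> i t x) \<le> R1" by (rule R1) (use that Cons p in auto)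
    then have "norm (wrun v (\<Phi> i t x)) \<le> R2" by (intro R2) (use that Cons p in auto)
    then show ?thesis using Cons p by simp
  qed
  then show ?case by blast
qed

text \<open>The fundamental theorem of calculus along a flow line, with the time rescaled to the
  unit interval so that the sign of \<open>t\<close> does not matter.\<close>

lemma flow_sq:
  assumes i: "i < m" and f: "C1 f"
  shows "ennreal ((f (\<Phi> i t x) - f x)\<^sup>2) \<le> ennreal (t\<^sup>2) *
    (\<integral>\<^sup>+\<theta>. ennreal ((vf_apply (X i) f (\<Phi> i (\<theta> * t) x))\<^sup>2) * indicator {0..1} \<theta> \<partial>lborel)"
proof -
  let ?\<phi> = "\<lambda>\<theta>. vf_apply (X i) f (\<Phi> i (\<theta> * t) x)"
  have "continuous_on UNIV (\<lambda>\<theta>. \<Phi> i (\<theta> * t) x)"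
    by (intro continuous_on_compose2[OF flow_continuous[OF X_lowers[OF i]], of UNIV "\<lambda>\<theta>. (\<theta> * t, x)", simplified])
       (auto intro!: continuous_intros)
  then have c: "continuous_on UNIV ?\<phi>"
    by (rule continuous_on_compose2[OF vfX_continuous[OF f i, of UNIV]]) simp
  have "((\<lambda>\<theta>. f (\<Phi> i (\<theta> * t) x)) has_real_derivative t * ?\<phi> \<theta>) (at \<theta>)" for \<theta>
  proof -
    have d: "((\<lambda>\<theta>. \<theta> * t) has_real_derivative t) (at \<theta>)"
      by (auto intro!: derivative_eq_intros)
    have "((\<lambda>\<theta>. f (\<Phi> i (\<theta> * t) x)) has_real_derivative ?\<phi> \<theta> * t) (at \<theta>)"
      by (rule DERIV_chain2[OF flow_deriv[OF X_lowers[OF i] C1_diff[OF f]] d])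
    then show ?thesis by (simp only: mult.commute)
  qed
  then have "((\<lambda>\<theta>. t * ?\<phi> \<theta>) has_integral (f (\<Phi> i (1 * t) x) - f (\<Phi> i (0 * t) x))) {0..1}"
    using fundamental_theorem_of_calculus[of 0 1 "\<lambda>\<theta>. f (\<Phi> i (\<theta> * t) x)" "\<lambda>\<theta>. t * ?\<phi> \<theta>"]
      has_field_derivative_at_within has_real_derivative_iff_has_vector_derivative zero_le_one by blast
  from integral_unique[OF this] have "f (\<Phi> i t x) - f x = t * integral {0..1} ?\<phi>"
    by simp
  then have "(f (\<Phi> i t x) - f x)\<^sup>2 = t\<^sup>2 * (integral {0..1} ?\<phi>)\<^sup>2"
    by (simp only: power_mult_distrib)
  then have "ennreal ((f (\<Phi> i t x) - f x)\<^sup>2) = ennreal (t\<^sup>2) * ennreal ((integral {0..1} ?\<phi>)\<^sup>2)"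
    by (simp only: ennreal_mult zero_le_power2)
  then show ?thesis using mult_left_mono[OF sq_integral_le_nn[OF c], of "ennreal (t\<^sup>2)"] by (simp only: zero_le)
qed


lemma mp_ball_le:
  assumes T: "mp T" and F: "F \<in> borel_measurable borel"
    and b: "\<And>x. norm x \<le> R \<Longrightarrow> norm (T x) \<le> R'"
  shows "(\<integral>\<^sup>+x. F (T x) * indicator (cball 0 R) x \<partial>lborel) \<le> (\<integral>\<^sup>+x. F x * indicator (cball 0 R') x \<partial>lborel)"
proof -
  have "(\<integral>\<^sup>+x. F (T x) * indicator (cball 0 R) x \<partial>lborel)
      \<le> (\<integral>\<^sup>+x. F (T x) * indicator (cball 0 R') (T x) \<partial>lborel)"
    using b by (intro nn_integral_mono) (auto simp: indicator_def)
  also have "\<dots> = (\<integral>\<^sup>+x. F x * indicator (cball 0 R') x \<partial>lborel)"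
    using borel_measurable_times_ennreal[OF F borel_measurable_indicator[OF borel_closed[OF closed_cball]]]
    by (rule T[unfolded mp_def, THEN conjunct2, rule_format])
  finally show ?thesis .
qed

lemma flow_mp: assumes "i < m" shows "mp (\<Phi> i t)"
proof -
  have "wrun [(i, t)] = \<Phi> i t" by (simp add: fun_eq_iff)
  then show ?thesis using wrun_mp[of "[(i, t)]"] assms by simp
qed

lemma flow_time_measurable:
  assumes i: "i < m"
  shows "(\<lambda>(x, \<theta>). \<Phi> i (\<theta> * t) x) \<in> borel_measurable (borel \<Otimes>\<^sub>M borel)"
proof -
  have "continuous_on UNIV (\<lambda>p :: (real, 'n) vec \<times> real. \<Phi> i (snd p * t) (fst p))"
    by (intro continuous_on_compose2[OF flow_continuous[OF X_lowers[OF i]],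
          of UNIV "\<lambda>p. (snd p * t, fst p)", simplified]) (auto intro!: continuous_intros)
  from borel_measurable_continuous_onI[OF this] show ?thesis
    by (simp add: borel_prod case_prod_beta)
qed

text \<open>Integrate \<open>flow_sq\<close> over the ball and exchange the integrals: at each fixed
  time the flow preserves measure and maps the ball into the larger one.\<close>

lemma flow_cost:
  assumes i: "i < m" and f: "C1 f"
    and b: "\<And>s x. \<bar>s\<bar> \<le> \<bar>t\<bar> \<Longrightarrow> norm x \<le> R \<Longrightarrow> norm (\<Phi> i s x) \<le> R'"
  shows "nnb R (\<lambda>x. (f (\<Phi> i t x) - f x)\<^sup>2) \<le> ennreal (t\<^sup>2) * nnb R' (Xsq f)"
proof -
  let ?\<psi> = "\<lambda>x. ennreal ((vf_apply (X i) f x)\<^sup>2)"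
  have [measurable]: "vf_apply (X i) f \<in> borel_measurable borel"
    by (intro borel_measurable_continuous_onI vfX_continuous f i)
  note [measurable] = flow_time_measurable[OF i, of t]
  have m1: "(\<lambda>(x, \<theta>). ?\<psi> (\<Phi> i (\<theta> * t) x)) \<in> borel_measurable (borel \<Otimes>\<^sub>M borel)"
    using measurable_compose[OF flow_time_measurable[OF i, of t], of ?\<psi> borel] by (simp add: case_prod_beta)
  have m2: "(\<lambda>(x, \<theta>). ?\<psi> (\<Phi> i (\<theta> * t) x) * indicator {0..1} \<theta> * indicator (cball 0 R) x)
      \<in> borel_measurable (lborel \<Otimes>\<^sub>M lborel)"
    using m1 by measurable
  have "nnb R (\<lambda>x. (f (\<Phi> i t x) - f x)\<^sup>2)
      \<le> (\<integral>\<^sup>+x. ennreal (t\<^sup>2) * (\<integral>\<^sup>+\<theta>. ?\<psi> (\<Phi> i (\<theta> * t) x) * indicator {0..1} \<theta> \<partial>lborel) * indicator (cball 0 R) x \<partial>lborel)"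
    by (intro nn_integral_mono mult_right_mono flow_sq i f) simp
  also have "\<dots> = (\<integral>\<^sup>+x. ennreal (t\<^sup>2) * (\<integral>\<^sup>+\<theta>. ?\<psi> (\<Phi> i (\<theta> * t) x) * indicator {0..1} \<theta> * indicator (cball 0 R) x \<partial>lborel) \<partial>lborel)"
  proof (rule nn_integral_cong)
    fix x
    have [measurable]: "(\<lambda>\<theta>. ?\<psi> (\<Phi> i (\<theta> * t) x)) \<in> borel_measurable borel"
      using measurable_Pair2[OF m1, of x] by simp
    show "ennreal (t\<^sup>2) * (\<integral>\<^sup>+\<theta>. ?\<psi> (\<Phi> i (\<theta> * t) x) * indicator {0..1} \<theta> \<partial>lborel) * indicator (cball 0 R) x
      = ennreal (t\<^sup>2) * (\<integral>\<^sup>+\<theta>. ?\<psi> (\<Phi> i (\<theta> * t) x) * indicator {0..1} \<theta> * indicator (cball 0 R) x \<partial>lborel)"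
      by (subst nn_integral_multc) (simp_all add: mult.assoc)
  qed
  also have "\<dots> = ennreal (t\<^sup>2) * (\<integral>\<^sup>+x. (\<integral>\<^sup>+\<theta>. ?\<psi> (\<Phi> i (\<theta> * t) x) * indicator {0..1} \<theta> * indicator (cball 0 R) x \<partial>lborel) \<partial>lborel)"
    using m2 by (intro nn_integral_cmult) measurable
  also have "(\<integral>\<^sup>+x. (\<integral>\<^sup>+\<theta>. ?\<psi> (\<Phi> i (\<theta> * t) x) * indicator {0..1} \<theta> * indicator (cball 0 R) x \<partial>lborel) \<partial>lborel)
      = (\<integral>\<^sup>+\<theta>. (\<integral>\<^sup>+x. ?\<psi> (\<Phi> i (\<theta> * t) x) * indicator {0..1} \<theta> * indicator (cball 0 R) x \<partial>lborel) \<partial>lborel)"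
    by (rule lborel_pair.Fubini'[symmetric]) (use m2 in simp)
  also have "\<dots> \<le> (\<integral>\<^sup>+\<theta>. (nnb R' (Xsq f)) * indicator {0..1::real} \<theta> \<partial>lborel)"
  proof (rule nn_integral_mono)
    fix \<theta> :: real
    show "(\<integral>\<^sup>+x. ?\<psi> (\<Phi> i (\<theta> * t) x) * indicator {0..1} \<theta> * indicator (cball 0 R) x \<partial>lborel)
      \<le> (nnb R' (Xsq f)) * indicator {0..1::real} \<theta>"
    proof (cases "\<theta> \<in> {0..1}")
      case True
      then have \<theta>: "\<bar>\<theta> * t\<bar> \<le> \<bar>t\<bar>" by (simp add: abs_mult mult_left_le_one_le)
      have "(\<integral>\<^sup>+x. ?\<psi> (\<Phi> i (\<theta> * t) x) * indicator (cball 0 R) x \<partial>lborel)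
          \<le> (\<integral>\<^sup>+x. ?\<psi> x * indicator (cball 0 R') x \<partial>lborel)"
        by (rule mp_ball_le[OF flow_mp[OF i]]) (use b \<theta> in auto)
      also have "\<dots> \<le> nnb R' (Xsq f)"
        unfolding Xsq_def using i
        by (intro nn_integral_mono mult_right_mono ennreal_leI member_le_sum) auto
      finally show ?thesis using True by simp
    qed simp
  qed
  also have "\<dots> = nnb R' (Xsq f)"
    by (subst nn_integral_cmult) auto
  finally show ?thesis by (simp add: mult_left_mono)
qed

lemma nnb_mono: "R \<le> R' \<Longrightarrow> nnb R f \<le> nnb R' f"
  by (intro nn_integral_mono mult_left_mono) (auto simp: indicator_def)

text \<open>Each letter is split off by \<open>(a + b)^2 \<le> 2 a^2 + 2 b^2\<close>, which turns
  the constant \<open>C\<close> into \<open>2 * C + 2\<close>. Both the constant and the enlarged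
  ball thus depend on the length bound and on \<open>S\<close>, not on the particular word.\<close>

lemma word_cost:
  "\<exists>R' C. 0 \<le> C \<and> (\<forall>w \<theta> f. word w \<longrightarrow> length w \<le> L \<longrightarrow> times_le \<theta> w \<longrightarrow> \<theta> \<le> S \<longrightarrow> C1 f \<longrightarrow>
     nnb R (\<lambda>x. (f (wrun w x) - f x)\<^sup>2) \<le> ennreal (C * \<theta>\<^sup>2) * nnb R' (Xsq f))"
proof (induction L arbitrary: R)
  case 0
  show ?case by (intro exI[of _ 0]) auto
next
  case (Suc L)
  obtain R1 where R1: "\<And>i t x. i < m \<Longrightarrow> \<bar>t\<bar> \<le> S \<Longrightarrow> norm x \<le> R \<Longrightarrow> norm (\<Phi> i t x) \<le> R1"
    using flow_bounded by metis
  obtain R2 C where C: "0 \<le> C" and IH': "\<forall>w \<theta> f. word w \<longrightarrow> length w \<le> L \<longrightarrow> times_le \<theta> w \<longrightarrow> \<theta> \<le> S \<longrightarrow> C1 f \<longrightarrow>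
     nnb R1 (\<lambda>x. (f (wrun w x) - f x)\<^sup>2) \<le> ennreal (C * \<theta>\<^sup>2) * nnb R2 (Xsq f)"
    using Suc.IH[of R1] by (elim exE conjE)
  note IH = IH'[rule_format]
  define R' where "R' = max R1 R2"
  have "nnb R (\<lambda>x. (f (wrun w x) - f x)\<^sup>2) \<le> ennreal ((2 * C + 2) * \<theta>\<^sup>2) * nnb R' (Xsq f)"
    if w: "word w" "length w \<le> Suc L" "times_le \<theta> w" "\<theta> \<le> S" and f: "C1 f" for w \<theta> f
  proof (cases w)
    case Nil
    then show ?thesis by simp
  next
    case (Cons p v)
    obtain i t where p: "p = (i, t)" by force
    have i: "i < m" and t: "\<bar>t\<bar> \<le> \<theta>" and v: "word v" "length v \<le> L" "times_le \<theta> v"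
      using w Cons p by auto
    have fm [measurable]: "f \<in> borel_measurable borel" by (intro borel_measurable_continuous_onI C1_cont f)
    have [measurable]: "wrun v \<in> borel_measurable borel" "\<Phi> i t \<in> borel_measurable borel"
      using wrun_mp[OF v(1)] flow_mp[OF i] by (auto simp: mp_def)
    let ?a = "\<lambda>x. (f (wrun v x) - f x)\<^sup>2" and ?b = "\<lambda>x. (f (\<Phi> i t x) - f x)\<^sup>2"
    have "nnb R (\<lambda>x. (f (wrun w x) - f x)\<^sup>2)
      \<le> (\<integral>\<^sup>+x. 2 * (ennreal (?a (\<Phi> i t x)) * indicator (cball 0 R) x) + 2 * (ennreal (?b x) * indicator (cball 0 R) x) \<partial>lborel)"
    proof (rule nn_integral_mono)
      fix x
      have "(f (wrun w x) - f x)\<^sup>2 \<le> 2 * ?a (\<Phi> i t x) + 2 * ?b x"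
        using sum_squares_bound[of "f (wrun v (\<Phi> i t x)) - f (\<Phi> i t x)" "f (\<Phi> i t x) - f x"]
        by (simp add: Cons p power2_eq_square algebra_simps)
      then have "ennreal ((f (wrun w x) - f x)\<^sup>2) \<le> ennreal (2 * ?a (\<Phi> i t x) + 2 * ?b x)"
        by (rule ennreal_leI)
      also have "\<dots> = 2 * ennreal (?a (\<Phi> i t x)) + 2 * ennreal (?b x)"
        by (simp add: ennreal_plus ennreal_mult)
      finally have "ennreal ((f (wrun w x) - f x)\<^sup>2) \<le> 2 * ennreal (?a (\<Phi> i t x)) + 2 * ennreal (?b x)" .
      then show "ennreal ((f (wrun w x) - f x)\<^sup>2) * indicator (cball 0 R) x
        \<le> 2 * (ennreal (?a (\<Phi> i t x)) * indicator (cball 0 R) x) + 2 * (ennreal (?b x) * indicator (cball 0 R) x)"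
        by (simp add: indicator_def)
    qed
    also have "\<dots> = 2 * nnb R (\<lambda>x. ?a (\<Phi> i t x)) + 2 * nnb R ?b"
      by (subst nn_integral_add) (simp_all add: nn_integral_cmult)
    also have "\<dots> \<le> 2 * (ennreal (C * \<theta>\<^sup>2) * nnb R2 (Xsq f)) + 2 * (ennreal (t\<^sup>2) * nnb R1 (Xsq f))"
    proof (intro add_mono mult_left_mono)
      have "nnb R (\<lambda>x. ?a (\<Phi> i t x)) \<le> nnb R1 ?a"
        using R1 i t w by (intro mp_ball_le[OF flow_mp[OF i], of "\<lambda>x. ennreal (?a x)"]) auto
      also have "\<dots> \<le> ennreal (C * \<theta>\<^sup>2) * nnb R2 (Xsq f)"
        using IH v w f by blast
      finally show "nnb R (\<lambda>x. ?a (\<Phi> i t x)) \<le> ennreal (C * \<theta>\<^sup>2) * nnb R2 (Xsq f)" .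
      show "nnb R ?b \<le> ennreal (t\<^sup>2) * nnb R1 (Xsq f)"
        using R1[OF i] t w by (intro flow_cost i f) force
    qed auto
    also have "\<dots> \<le> 2 * (ennreal (C * \<theta>\<^sup>2) * nnb R' (Xsq f)) + 2 * (ennreal (\<theta>\<^sup>2) * nnb R' (Xsq f))"
    proof -
      have "t\<^sup>2 \<le> \<theta>\<^sup>2" using t by (intro abs_le_square_iff[THEN iffD1]) simp
      then show ?thesis
        by (intro add_mono mult_left_mono mult_mono nnb_mono ennreal_leI) (simp_all add: R'_def)
    qed
    also have "\<dots> = (2 * ennreal (C * \<theta>\<^sup>2) + 2 * ennreal (\<theta>\<^sup>2)) * nnb R' (Xsq f)"
      by (simp add: distrib_right mult.assoc)
    also have "2 * ennreal (C * \<theta>\<^sup>2) + 2 * ennreal (\<theta>\<^sup>2) = ennreal ((2 * C + 2) * \<theta>\<^sup>2)"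
    proof -
      have "ennreal ((2 * C + 2) * \<theta>\<^sup>2) = ennreal (2 * (C * \<theta>\<^sup>2) + 2 * \<theta>\<^sup>2)"
        by (simp add: algebra_simps)
      also have "\<dots> = ennreal 2 * ennreal (C * \<theta>\<^sup>2) + ennreal 2 * ennreal (\<theta>\<^sup>2)"
        using C by (simp add: ennreal_plus ennreal_mult del: ennreal_numeral)
      finally show ?thesis by simp
    qed
    finally show ?thesis .
  qed
  then show ?case using C by (intro exI[of _ R'] exI[of _ "2 * C + 2"]) auto
qed

text \<open>The factor \<open>r\<^sup>2\<close> is the gain from small parameters; in Nash's
  inequality it becomes the small coefficient of the energy.\<close>

lemma G_cost:
  "\<exists>R' C. 0 \<le> C \<and> (\<forall>r \<tau> f. 0 \<le> r \<longrightarrow> r \<le> r0 \<longrightarrow> \<tau> \<in> dbox r \<longrightarrow> C1 f \<longrightarrow>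
     nnb R (\<lambda>x. (f (G \<tau> x) - f x)\<^sup>2) \<le> ennreal (C * r\<^sup>2) * nnb R' (Xsq f))"
proof -
  obtain L T where T: "0 < T" and LT: "\<And>js r \<tau>. 0 \<le> r \<Longrightarrow> \<tau> \<in> dbox r \<Longrightarrow>
     length (gword js \<tau>) \<le> L * length js \<and> times_le (T * r) (gword js \<tau>)"
    using gword_bounds by metis
  let ?L = "L * length (sorted_list_of_set (UNIV :: 'n set))"
  obtain R' C where C: "0 \<le> C" and c': "\<forall>w \<theta> f. word w \<longrightarrow> length w \<le> ?L \<longrightarrow> times_le \<theta> w \<longrightarrow> \<theta> \<le> T * r0 \<longrightarrow> C1 f \<longrightarrow>
     nnb R (\<lambda>x. (f (wrun w x) - f x)\<^sup>2) \<le> ennreal (C * \<theta>\<^sup>2) * nnb R' (Xsq f)"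
    using word_cost[of ?L "T * r0" R] by (elim exE conjE)
  note c = c'[rule_format]
  have "nnb R (\<lambda>x. (f (G \<tau> x) - f x)\<^sup>2) \<le> ennreal ((C * T\<^sup>2) * r\<^sup>2) * nnb R' (Xsq f)"
    if "0 \<le> r" "r \<le> r0" "\<tau> \<in> dbox r" "C1 f" for r \<tau> f
    using c[of "gword (sorted_list_of_set UNIV) \<tau>" "T * r" f] LT[OF that(1,3), of "sorted_list_of_set UNIV"] that T
    by (simp add: G_def power_mult_distrib mult.assoc)
  then show ?thesis using C by (intro exI[of _ R'] exI[of _ "C * T\<^sup>2"]) auto
qed

section \<open>Nash and Poincare inequalities\<close>

text \<open>Average over parameters in \<open>dbox r\<close> the pointwise bound of
  \<open>\<phi>(x)^2\<close> by the squared increment from \<open>x\<close> to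
  \<open>G \<tau> x\<close> plus twice the product of the absolute values at both points.
  \<open>G_cost\<close> bounds the increments; in the product the parameter integral is extended to
  the whole space, where \<open>G_mp_\<tau>\<close> makes it the L1 norm. The volume of the box is
  left as a factor to stay within \<open>ennreal\<close>.\<close>

lemma Nash_nn:
  "\<exists>C\<ge>0. \<forall>\<phi> r. C1 \<phi> \<longrightarrow> (\<forall>x. 2 < norm x \<longrightarrow> \<phi> x = 0) \<longrightarrow> 0 < r \<longrightarrow> r \<le> 1 \<longrightarrow>
     ennreal (2 ^ CARD('n) * r ^ Q) * (\<integral>\<^sup>+x. ennreal ((\<phi> x)\<^sup>2) \<partial>lborel)
      \<le> ennreal (2 ^ CARD('n) * r ^ Q) * (ennreal (C * r\<^sup>2) * (\<integral>\<^sup>+x. ennreal (Xsq \<phi> x) \<partial>lborel))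
        + 2 * (\<integral>\<^sup>+x. ennreal \<bar>\<phi> x\<bar> \<partial>lborel) * (\<integral>\<^sup>+x. ennreal \<bar>\<phi> x\<bar> \<partial>lborel)"
proof -
  obtain R' C where C: "0 \<le> C" and c': "\<forall>r \<tau> f. 0 \<le> r \<longrightarrow> r \<le> 1 \<longrightarrow> \<tau> \<in> dbox r \<longrightarrow> C1 f \<longrightarrow>
     nnb 2 (\<lambda>x. (f (G \<tau> x) - f x)\<^sup>2) \<le> ennreal (C * r\<^sup>2) * nnb R' (Xsq f)"
    using G_cost[of 1 2] by (elim exE conjE)
  note c = c'[rule_format]
  show ?thesis
  proof (intro exI[of _ C] conjI allI impI C)
    fix \<phi> :: "(real, 'n) vec \<Rightarrow> real" and r :: real
    assume \<phi>: "C1 \<phi>" and supp: "\<forall>x. 2 < norm x \<longrightarrow> \<phi> x = 0" and r: "0 < r" "r \<le> 1"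
    have [measurable]: "\<phi> \<in> borel_measurable borel"
      by (intro borel_measurable_continuous_onI C1_cont \<phi>)
    let ?J = "\<integral>\<^sup>+x. ennreal \<bar>\<phi> x\<bar> \<partial>lborel"
    let ?E = "ennreal (C * r\<^sup>2) * (\<integral>\<^sup>+x. ennreal (Xsq \<phi> x) \<partial>lborel)"
    let ?V = "ennreal (2 ^ CARD('n) * r ^ Q)"
    have V: "(\<integral>\<^sup>+\<tau>. c * indicator (dbox r) \<tau> \<partial>lborel) = ?V * c" for c
      using emeasure_dbox[of r] r by (simp add: nn_integral_cmult_indicator mult.commute)
    have G [measurable]: "(\<lambda>(x, \<tau>). G \<tau> x) \<in> borel_measurable (borel \<Otimes>\<^sub>M borel)" by measurable
    have Gx [measurable]: "G \<tau> \<in> borel_measurable borel" for \<tau> using G_mp_x by (simp add: mp_def)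
    have G\<tau> [measurable]: "(\<lambda>\<tau>. G \<tau> x) \<in> borel_measurable borel" for x by measurable
    let ?a = "\<lambda>x \<tau>. (ennreal ((\<phi> (G \<tau> x) - \<phi> x)\<^sup>2) * indicator (cball 0 2) x) * indicator (dbox r) \<tau>"
    let ?b = "\<lambda>x \<tau>. 2 * (ennreal \<bar>\<phi> x\<bar> * ennreal \<bar>\<phi> (G \<tau> x)\<bar>)"
    have "?V * (\<integral>\<^sup>+x. ennreal ((\<phi> x)\<^sup>2) \<partial>lborel)
        = (\<integral>\<^sup>+x. (\<integral>\<^sup>+\<tau>. ennreal ((\<phi> x)\<^sup>2) * indicator (dbox r) \<tau> \<partial>lborel) \<partial>lborel)"
      unfolding V by (rule nn_integral_cmult[symmetric]) simp
    also have "\<dots> \<le> (\<integral>\<^sup>+x. (\<integral>\<^sup>+\<tau>. ?a x \<tau> + ?b x \<tau> \<partial>lborel) \<partial>lborel)"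
    proof (intro nn_integral_mono)
      fix x \<tau> :: "(real, 'n) vec"
      show "ennreal ((\<phi> x)\<^sup>2) * indicator (dbox r) \<tau> \<le> ?a x \<tau> + ?b x \<tau>"
      proof (cases "\<tau> \<in> dbox r \<and> norm x \<le> 2")
        case True
        have "(\<phi> (G \<tau> x) - \<phi> x)\<^sup>2 = (\<phi> (G \<tau> x))\<^sup>2 + (\<phi> x)\<^sup>2 - 2 * (\<phi> x * \<phi> (G \<tau> x))"
          by (simp add: power2_eq_square algebra_simps)
        then have "(\<phi> x)\<^sup>2 \<le> (\<phi> (G \<tau> x) - \<phi> x)\<^sup>2 + 2 * (\<bar>\<phi> x\<bar> * \<bar>\<phi> (G \<tau> x)\<bar>)"
          using abs_ge_self[of "\<phi> x * \<phi> (G \<tau> x)"] zero_le_power2[of "\<phi> (G \<tau> x)"]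
          unfolding abs_mult by linarith
        then have "ennreal ((\<phi> x)\<^sup>2) \<le> ennreal ((\<phi> (G \<tau> x) - \<phi> x)\<^sup>2 + 2 * (\<bar>\<phi> x\<bar> * \<bar>\<phi> (G \<tau> x)\<bar>))"
          by (rule ennreal_leI)
        also have "\<dots> = ennreal ((\<phi> (G \<tau> x) - \<phi> x)\<^sup>2) + 2 * (ennreal \<bar>\<phi> x\<bar> * ennreal \<bar>\<phi> (G \<tau> x)\<bar>)"
          by (simp add: ennreal_plus ennreal_mult)
        finally show ?thesis using True by simp
      next
        case False
        then show ?thesis using supp by (auto simp: not_le)
      qed
    qed
    also have "\<dots> = (\<integral>\<^sup>+x. (\<integral>\<^sup>+\<tau>. ?a x \<tau> \<partial>lborel) \<partial>lborel) + (\<integral>\<^sup>+x. (\<integral>\<^sup>+\<tau>. ?b x \<tau> \<partial>lborel) \<partial>lborel)"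
      by (subst nn_integral_add[symmetric], measurable, measurable)
         (intro nn_integral_cong nn_integral_add; measurable)
    also have "(\<integral>\<^sup>+x. (\<integral>\<^sup>+\<tau>. ?b x \<tau> \<partial>lborel) \<partial>lborel) = 2 * ?J * ?J"
    proof -
      have "(\<integral>\<^sup>+\<tau>. ?b x \<tau> \<partial>lborel) = 2 * ennreal \<bar>\<phi> x\<bar> * ?J" for x
        using G_mp_\<tau>[of x, unfolded mp_def, THEN conjunct2, rule_format, of "\<lambda>y. ennreal \<bar>\<phi> y\<bar>"]
        by (simp add: nn_integral_cmult mult.assoc)
      then show ?thesis by (simp add: nn_integral_cmult nn_integral_multc mult.assoc)
    qed
    also have "(\<integral>\<^sup>+x. (\<integral>\<^sup>+\<tau>. ?a x \<tau> \<partial>lborel) \<partial>lborel) = (\<integral>\<^sup>+\<tau>. (\<integral>\<^sup>+x. ?a x \<tau> \<partial>lborel) \<partial>lborel)"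
      by (rule lborel_pair.Fubini'[symmetric]) simp
    also have "\<dots> \<le> (\<integral>\<^sup>+\<tau>. ?E * indicator (dbox r) \<tau> \<partial>lborel)"
    proof (rule nn_integral_mono)
      fix \<tau> :: "(real, 'n) vec"
      have "(\<integral>\<^sup>+x. ?a x \<tau> \<partial>lborel) = nnb 2 (\<lambda>x. (\<phi> (G \<tau> x) - \<phi> x)\<^sup>2) * indicator (dbox r) \<tau>"
        by (rule nn_integral_multc) measurable
      also have "\<dots> \<le> ?E * indicator (dbox r) \<tau>"
      proof (cases "\<tau> \<in> dbox r")
        case True
        have "nnb 2 (\<lambda>x. (\<phi> (G \<tau> x) - \<phi> x)\<^sup>2) \<le> ennreal (C * r\<^sup>2) * nnb R' (Xsq \<phi>)"
          by (rule c) (use r True \<phi> in auto)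
        also have "nnb R' (Xsq \<phi>) \<le> (\<integral>\<^sup>+x. ennreal (Xsq \<phi> x) \<partial>lborel)"
          by (intro nn_integral_mono) (simp add: indicator_def)
        finally show ?thesis using True by (simp add: mult_left_mono)
      qed simp
      finally show "(\<integral>\<^sup>+x. ?a x \<tau> \<partial>lborel) \<le> ?E * indicator (dbox r) \<tau>" .
    qed
    also have "\<dots> = ?V * ?E" by (rule V)
    finally show "?V * (\<integral>\<^sup>+x. ennreal ((\<phi> x)\<^sup>2) \<partial>lborel) \<le> ?V * ?E + 2 * ?J * ?J"
      by (simp add: add_right_mono)
  qed
qed

text \<open>The parameters are found one after another: by \<open>G_nth\<close> the parameter
  \<open>k\<close> is the coordinate \<open>k\<close> of \<open>G \<tau> x\<close> minus that of a
  point reached from \<open>x\<close> with the earlier parameters only, and these are bounded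
  already.\<close>

lemma G_param_bounded: "\<exists>r\<ge>0. \<forall>x \<tau>. norm x \<le> R \<longrightarrow> norm (G \<tau> x) \<le> R \<longrightarrow> \<tau> \<in> dbox r"
proof -
  obtain L T where LT: "\<And>js r \<tau>. 0 \<le> r \<Longrightarrow> \<tau> \<in> dbox r \<Longrightarrow>
     length (gword js \<tau>) \<le> L * length js \<and> times_le (T * r) (gword js \<tau>)"
    using gword_bounds by metis
  have pow: "\<bar>s\<bar> \<le> max 1 b ^ \<sigma> j" if "\<bar>s\<bar> \<le> b" for s b :: real and j
  proof -
    have "max 1 b ^ 1 \<le> max 1 b ^ \<sigma> j" using sigma_pos by (intro power_increasing) auto
    then show ?thesis using that by simp
  qed
  have "\<exists>b. \<forall>x \<tau>. norm x \<le> R \<longrightarrow> norm (G \<tau> x) \<le> R \<longrightarrow> \<bar>\<tau> $ k\<bar> \<le> b" for k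
  proof (induction k rule: measure_induct_rule[where f = "\<lambda>k. card {..<k}"])
    case (less k)
    have "card {..<j} < card {..<k}" if "j < k" for j
      using that by (intro psubset_card_mono) auto
    then have "\<forall>j. \<exists>b. j < k \<longrightarrow> (\<forall>x \<tau>. norm x \<le> R \<longrightarrow> norm (G \<tau> x) \<le> R \<longrightarrow> \<bar>\<tau> $ j\<bar> \<le> b)"
      using less.IH by blast
    then obtain b where b: "\<And>j x \<tau>. j < k \<Longrightarrow> norm x \<le> R \<Longrightarrow> norm (G \<tau> x) \<le> R \<Longrightarrow> \<bar>\<tau> $ j\<bar> \<le> b j"
      by metis
    define B where "B = Max (range b)"
    have bB: "b j \<le> B" for j by (simp add: B_def)
    define r where "r = max 1 B"
    obtain as where as: "set as = {..<k}" "\<And>\<tau> x. G \<tau> x $ k = wrun (gword as \<tau>) x $ k + \<tau> $ k"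
      using G_nth by blast
    obtain R' where R': "\<And>w x. word w \<Longrightarrow> length w \<le> L * length as \<Longrightarrow> times_le (T * r) w \<Longrightarrow> norm x \<le> R \<Longrightarrow> norm (wrun w x) \<le> R'"
      using wrun_bounded by metis
    have "\<bar>\<tau> $ k\<bar> \<le> R + R'" if x: "norm x \<le> R" "norm (G \<tau> x) \<le> R" for x \<tau>
    proof -
      \<comment> \<open>Zeroing the parameters from \<open>k\<close> on puts the vector into a box
        without changing the word over the indices below \<open>k\<close>.\<close>
      define \<tau>' where "\<tau>' = (\<chi> j. if j < k then \<tau> $ j else 0)"
      have "\<bar>\<tau>' $ j\<bar> \<le> r ^ \<sigma> j" for j
        using pow[of "\<tau> $ j" B j] b[OF _ x, of j] bB[of j] by (auto simp: \<tau>'_def r_def)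
      then have "\<tau>' \<in> dbox r" by (simp add: dbox_def)
      moreover have "gword as \<tau> = gword as \<tau>'" by (rule gword_cong) (simp add: \<tau>'_def as)
      ultimately have "norm (wrun (gword as \<tau>) x) \<le> R'"
        using LT[of r \<tau>' as] by (intro R') (auto simp: x r_def)
      then have "\<bar>wrun (gword as \<tau>) x $ k\<bar> \<le> R'" using component_le_norm_cart order_trans by blast
      moreover have "\<bar>G \<tau> x $ k\<bar> \<le> R" using x component_le_norm_cart order_trans by blast
      ultimately show ?thesis using as(2)[of \<tau> x] by linarith
    qed
    then show ?case by blast
  qed
  then obtain b where b: "\<And>k x \<tau>. norm x \<le> R \<Longrightarrow> norm (G \<tau> x) \<le> R \<Longrightarrow> \<bar>\<tau> $ k\<bar> \<le> b k" by metis
  have "b k \<le> Max (range b)" for k by simp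
  then have "\<tau> \<in> dbox (max 1 (Max (range b)))" if "norm x \<le> R" "norm (G \<tau> x) \<le> R" for x \<tau>
    using pow b[OF that] order_trans unfolding dbox_def by blast
  then show ?thesis by (intro exI[of _ "max 1 (Max (range b))"]) auto
qed

text \<open>Substitute \<open>y = G \<tau> x\<close> in the inner integral. By
  \<open>G_param_bounded\<close> only a fixed box of parameters joins points of the ball, and on it
  \<open>G_cost\<close> applies. The larger ball on the right is harmless, as the energy of a
  solution is bounded on every ball.\<close>

lemma Poincare_nn:
  "\<exists>R' C. 0 \<le> C \<and> (\<forall>u. C1 u \<longrightarrow>
     (\<integral>\<^sup>+x. (\<integral>\<^sup>+y. ennreal ((u y - u x)\<^sup>2) * indicator (cball 0 2) y * indicator (cball 0 2) x \<partial>lborel) \<partial>lborel)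
      \<le> ennreal C * nnb R' (Xsq u))"
proof -
  obtain r where r0: "0 \<le> r" and r: "\<And>x \<tau>. norm x \<le> 2 \<Longrightarrow> norm (G \<tau> x) \<le> 2 \<Longrightarrow> \<tau> \<in> dbox r"
    using G_param_bounded[of 2] by metis
  obtain R' C where C: "0 \<le> C" and c': "\<forall>r' \<tau> f. 0 \<le> r' \<longrightarrow> r' \<le> r \<longrightarrow> \<tau> \<in> dbox r' \<longrightarrow> C1 f \<longrightarrow>
     nnb 2 (\<lambda>x. (f (G \<tau> x) - f x)\<^sup>2) \<le> ennreal (C * r'\<^sup>2) * nnb R' (Xsq f)"
    using G_cost[of r 2] by (elim exE conjE)
  note c = c'[rule_format, OF r0 order_refl]
  have "(\<integral>\<^sup>+x. (\<integral>\<^sup>+y. ennreal ((u y - u x)\<^sup>2) * indicator (cball 0 2) y * indicator (cball 0 2) x \<partial>lborel) \<partial>lborel)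
      \<le> ennreal (2 ^ CARD('n) * r ^ Q * (C * r\<^sup>2)) * nnb R' (Xsq u)" if u: "C1 u" for u
  proof -
    have [measurable]: "u \<in> borel_measurable borel"
      by (intro borel_measurable_continuous_onI C1_cont u)
    have G [measurable]: "(\<lambda>(x, \<tau>). G \<tau> x) \<in> borel_measurable (borel \<Otimes>\<^sub>M borel)" by measurable
    have Gx [measurable]: "G \<tau> \<in> borel_measurable borel" for \<tau> using G_mp_x by (simp add: mp_def)
    let ?E = "ennreal (C * r\<^sup>2) * nnb R' (Xsq u)"
    let ?a = "\<lambda>x \<tau>. (ennreal ((u (G \<tau> x) - u x)\<^sup>2) * indicator (cball 0 2) x) * indicator (dbox r) \<tau>"
    have "(\<integral>\<^sup>+x. (\<integral>\<^sup>+y. ennreal ((u y - u x)\<^sup>2) * indicator (cball 0 2) y * indicator (cball 0 2) x \<partial>lborel) \<partial>lborel)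
        = (\<integral>\<^sup>+x. (\<integral>\<^sup>+\<tau>. ennreal ((u (G \<tau> x) - u x)\<^sup>2) * indicator (cball 0 2) (G \<tau> x) * indicator (cball 0 2) x \<partial>lborel) \<partial>lborel)"
      by (intro nn_integral_cong G_mp_\<tau>[unfolded mp_def, THEN conjunct2, rule_format, symmetric]) measurable
    also have "\<dots> \<le> (\<integral>\<^sup>+x. (\<integral>\<^sup>+\<tau>. ?a x \<tau> \<partial>lborel) \<partial>lborel)"
      using r by (intro nn_integral_mono) (auto simp: indicator_def)
    also have "\<dots> = (\<integral>\<^sup>+\<tau>. (\<integral>\<^sup>+x. ?a x \<tau> \<partial>lborel) \<partial>lborel)"
      by (rule lborel_pair.Fubini'[symmetric]) simp
    also have "\<dots> \<le> (\<integral>\<^sup>+\<tau>. ?E * indicator (dbox r) \<tau> \<partial>lborel)"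
    proof (rule nn_integral_mono)
      fix \<tau> :: "(real, 'n) vec"
      have "(\<integral>\<^sup>+x. ?a x \<tau> \<partial>lborel) = nnb 2 (\<lambda>x. (u (G \<tau> x) - u x)\<^sup>2) * indicator (dbox r) \<tau>"
        by (rule nn_integral_multc) measurable
      then show "(\<integral>\<^sup>+x. ?a x \<tau> \<partial>lborel) \<le> ?E * indicator (dbox r) \<tau>"
        using c[OF _ u] by (cases "\<tau> \<in> dbox r") auto
    qed
    also have "\<dots> = ?E * ennreal (2 ^ CARD('n) * r ^ Q)"
      using emeasure_dbox[OF r0] by (simp add: nn_integral_cmult)
    also have "\<dots> = ennreal (2 ^ CARD('n) * r ^ Q * (C * r\<^sup>2)) * nnb R' (Xsq u)"
      using C r0 by (simp add: ennreal_mult mult_ac)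
    finally show ?thesis .
  qed
  then show ?thesis using C r0 by (intro exI[of _ R'] exI[of _ "2 ^ CARD('n) * r ^ Q * (C * r\<^sup>2)"]) auto
qed

end

section \<open>Integration by parts and the Caccioppoli inequality\<close>

lemma mp_distr: "mp T \<Longrightarrow> distr lborel borel T = lborel"
proof (rule measure_eqI)
  assume T: "mp T"
  then have [measurable]: "T \<in> borel_measurable borel" by (simp add: mp_def)
  fix A assume "A \<in> sets (distr lborel borel T)"
  then have A [measurable]: "A \<in> sets borel" by simp
  have "emeasure (distr lborel borel T) A = (\<integral>\<^sup>+x. indicator A x \<partial>distr lborel borel T)"
    by simp
  also have "\<dots> = (\<integral>\<^sup>+x. indicator A (T x) \<partial>lborel)"
    by (subst nn_integral_distr) simp_all
  also have "\<dots> = (\<integral>\<^sup>+x. indicator A x \<partial>lborel)"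
    using T[unfolded mp_def, THEN conjunct2, rule_format, of "indicator A"] by simp
  finally show "emeasure (distr lborel borel T) A = emeasure lborel A" by simp
qed simp

lemma mp_integral:
  fixes g :: "'a::euclidean_space \<Rightarrow> real"
  assumes T: "mp T" and g: "g \<in> borel_measurable borel"
  shows "(\<integral>x. g (T x) \<partial>lborel) = (\<integral>x. g x \<partial>lborel)"
proof -
  have "T \<in> measurable lborel borel" using T by (simp add: mp_def)
  from integral_distr[OF this g] show ?thesis by (simp add: mp_distr[OF T])
qed

lemma compact_support_integrable:
  fixes h :: "'a::euclidean_space \<Rightarrow> real"
  assumes h: "continuous_on UNIV h" and supp: "\<And>x. R < norm x \<Longrightarrow> h x = 0"
  shows "integrable lborel h"
proof -
  have "integrable lborel (\<lambda>x. indicator (cball 0 R) x *\<^sub>R h x)"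
    using h by (intro borel_integrable_compact continuous_on_subset[OF h]) auto
  moreover have "(\<lambda>x. indicator (cball 0 R) x *\<^sub>R h x) = h"
    using supp by (auto simp: fun_eq_iff indicator_def not_le)
  ultimately show ?thesis by simp
qed

lemma vf_apply_zero_outside:
  assumes "\<And>x. R < norm x \<Longrightarrow> f x = 0" "R < norm x"
  shows "vf_apply V f x = 0"
proof (rule vf_apply_has_derivative)
  show "(f has_derivative (\<lambda>_. 0)) (at x)"
  proof (rule has_derivative_transform_within_open[where f = "\<lambda>_. 0" and s = "- cball 0 R"])
    show "open (- cball (0::real^'a) R)" by (simp add: open_Compl)
  qed (use assms in auto)
qed

context hom_system
begin

text \<open>The fields are divergence free, here in the form that their flows preserve measure:
  averaging the derivative over flow times in the unit interval does not change its integral, and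
  turns it into the integral of \<open>f\<close> after the time-one flow minus that of
  \<open>f\<close>.\<close>

lemma integral_vf_zero:
  assumes i: "i < m" and f: "C1 f" and supp: "\<And>x. R < norm x \<Longrightarrow> f x = 0"
  shows "(\<integral>x. vf_apply (X i) f x \<partial>lborel) = 0"
proof -
  let ?g = "vf_apply (X i) f"
  have cg: "continuous_on UNIV ?g" by (rule vfX_continuous[OF f i])
  have gm [measurable]: "?g \<in> borel_measurable borel" by (rule borel_measurable_continuous_onI[OF cg])
  have ig: "integrable lborel ?g"
    by (rule compact_support_integrable[OF cg]) (rule vf_apply_zero_outside[OF supp])
  have i_f: "integrable lborel f"
    by (rule compact_support_integrable[OF C1_cont[OF f] supp])
  have fm [measurable]: "f \<in> borel_measurable borel"
    by (intro borel_measurable_continuous_onI C1_cont f)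
  have flowm [measurable]: "(\<lambda>p. \<Phi> i (snd p) (fst p)) \<in> borel_measurable (borel \<Otimes>\<^sub>M borel)"
    using flow_time_measurable[OF i, of 1] by (simp add: case_prod_beta)
  have [measurable]: "\<Phi> i t \<in> borel_measurable borel" for t
    using flow_mp[OF i] by (simp add: mp_def)
  let ?H = "\<lambda>x \<theta>. ?g (\<Phi> i \<theta> x) * indicator {0..1} (\<theta>::real)"
  have int: "integrable (lborel \<Otimes>\<^sub>M lborel) (case_prod ?H)"
  proof (rule integrableI_bounded)
    show "case_prod ?H \<in> borel_measurable (lborel \<Otimes>\<^sub>M lborel)"
      by (simp add: case_prod_beta)
    have "(\<integral>\<^sup>+p. ennreal (norm (case_prod ?H p)) \<partial>(lborel \<Otimes>\<^sub>M lborel))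
        = (\<integral>\<^sup>+\<theta>. (\<integral>\<^sup>+x. ennreal \<bar>?g (\<Phi> i \<theta> x)\<bar> * indicator {0..1} \<theta> \<partial>lborel) \<partial>lborel)"
      by (subst lborel_pair.nn_integral_snd[symmetric])
         (auto simp: case_prod_beta abs_mult ennreal_mult intro!: nn_integral_cong split: split_indicator)
    also have "\<dots> = (\<integral>\<^sup>+\<theta>. (\<integral>\<^sup>+x. ennreal \<bar>?g x\<bar> \<partial>lborel) * indicator {0..1} (\<theta>::real) \<partial>lborel)"
    proof (rule nn_integral_cong)
      fix \<theta> :: real
      have "(\<integral>\<^sup>+x. ennreal \<bar>?g (\<Phi> i \<theta> x)\<bar> \<partial>lborel) = (\<integral>\<^sup>+x. ennreal \<bar>?g x\<bar> \<partial>lborel)"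
        using flow_mp[OF i, of \<theta>, unfolded mp_def, THEN conjunct2, rule_format, of "\<lambda>x. ennreal \<bar>?g x\<bar>"]
        by simp
      then show "(\<integral>\<^sup>+x. ennreal \<bar>?g (\<Phi> i \<theta> x)\<bar> * indicator {0..1} \<theta> \<partial>lborel)
          = (\<integral>\<^sup>+x. ennreal \<bar>?g x\<bar> \<partial>lborel) * indicator {0..1} \<theta>"
        by (simp add: nn_integral_multc)
    qed
    also have "\<dots> = (\<integral>\<^sup>+x. ennreal \<bar>?g x\<bar> \<partial>lborel)" by (simp add: nn_integral_cmult)
    also have "\<dots> < \<infinity>" using ig by (simp add: integrable_iff_bounded)
    finally show "(\<integral>\<^sup>+p. ennreal (norm (case_prod ?H p)) \<partial>(lborel \<Otimes>\<^sub>M lborel)) < \<infinity>" .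
  qed
  have "(\<integral>x. ?g x \<partial>lborel) = (\<integral>\<theta>. (\<integral>x. ?H x \<theta> \<partial>lborel) \<partial>lborel)"
    by (simp add: mp_integral[OF flow_mp[OF i] gm])
  also have "\<dots> = (\<integral>x. (\<integral>\<theta>. ?H x \<theta> \<partial>lborel) \<partial>lborel)"
    by (rule lborel_pair.Fubini_integral[OF int])
  also have "\<dots> = (\<integral>x. f (\<Phi> i 1 x) - f x \<partial>lborel)"
  proof (rule Bochner_Integration.integral_cong[OF refl])
    fix x
    have "continuous_on UNIV (\<lambda>\<theta>. \<Phi> i \<theta> x)"
      using flow_has_derivative[OF X_lowers[OF i]] has_derivative_continuous
      by (metis continuous_at_imp_continuous_on)
    then have "continuous_on UNIV (\<lambda>\<theta>. ?g (\<Phi> i \<theta> x))"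
      by (rule continuous_on_compose2[OF cg]) simp
    then show "(\<integral>\<theta>. ?H x \<theta> \<partial>lborel) = f (\<Phi> i 1 x) - f x"
      using integral_FTC_Icc_real[of 0 1 "\<lambda>\<theta>. f (\<Phi> i \<theta> x)" "\<lambda>\<theta>. ?g (\<Phi> i \<theta> x)"]
        flow_deriv[OF X_lowers[OF i] C1_diff[OF f]]
      by (simp add: continuous_on_eq_continuous_at)
  qed
  also have "\<dots> = (\<integral>x. f (\<Phi> i 1 x) \<partial>lborel) - (\<integral>x. f x \<partial>lborel)"
  proof (rule Bochner_Integration.integral_diff[OF _ i_f])
    have "integrable (distr lborel borel (\<Phi> i 1)) f" by (simp add: mp_distr[OF flow_mp[OF i]] i_f)
    then show "integrable lborel (\<lambda>x. f (\<Phi> i 1 x))"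
      by (subst (asm) integrable_distr_eq) simp_all
  qed
  also have "\<dots> = 0" by (simp add: mp_integral[OF flow_mp[OF i] fm])
  finally show ?thesis .
qed

definition sol :: "((real, 'n) vec \<Rightarrow> real) \<Rightarrow> bool" where
  "sol u \<longleftrightarrow> Ck 2 u \<and> (\<forall>x. (\<Sum>i<m. vf_apply (X i) (vf_apply (X i) u) x) = Xsq u x)"

lemma Ck2_C1: "Ck 2 u \<Longrightarrow> C1 u"
  unfolding numeral_2_eq_2 by (rule Ck_Suc_imp_C1)

lemma Ck2_vf_C1:
  assumes "Ck 2 u" "i < m" shows "C1 (vf_apply (X i) u)"
proof -
  have "vf_apply (X i) u = (\<lambda>x. \<Sum>j\<in>UNIV. X i x $ j * pderiv_j j u x)"
    using assms by (simp add: fun_eq_iff vf_apply_expand Ck2_iff)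
  moreover have "C1 (\<lambda>x. X i x $ j)" for j
    using smooth[OF assms(2)] by (simp add: smooth_vf_def smooth_fun_C1)
  ultimately show ?thesis using assms by (simp add: Ck2_iff C1_sum C1_mult)
qed

lemma sol_C1: "sol u \<Longrightarrow> C1 u"
  by (simp add: sol_def Ck2_C1)

text \<open>Integrate the derivatives of \<open>\<zeta> i\<close> along \<open>X i\<close> and sum.
  The equation turns the second-order term into a gradient term, so the squared gradient carries the
  coefficient \<open>H + H'\<close>; \<open>\<epsilon>\<close> is its sign and \<open>\<mu>\<close>
  bounds its size relative to \<open>H\<close>. Half of it absorbs the cross term with the
  derivative of \<open>\<eta>\<close>.\<close>

lemma Caccioppoli_weighted:
  assumes u: "sol u"
    and dH: "\<And>s. (H has_real_derivative H' s) (at s)" and cH': "continuous_on UNIV H'"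
    and H0: "\<And>s. 0 \<le> H s" and \<mu>: "0 < \<mu>"
    and \<epsilon>: "\<epsilon> = 1 \<or> \<epsilon> = -1" and HH: "\<And>s. \<mu> * H s \<le> \<epsilon> * (H s + H' s)"
    and \<eta>: "C1 \<eta>" and supp: "\<And>x. R < norm x \<Longrightarrow> \<eta> x = 0"
  shows "(\<integral>x. (\<eta> x)\<^sup>2 * H (u x) * Xsq u x \<partial>lborel) \<le> 4 / \<mu>\<^sup>2 * (\<integral>x. H (u x) * Xsq \<eta> x \<partial>lborel)"
proof -
  note C1u = sol_C1[OF u]
  have cu: "continuous_on UNIV u" by (rule C1_cont[OF C1u])
  have cH: "continuous_on UNIV H" using dH by (meson DERIV_isCont continuous_at_imp_continuous_on)
  have cHu: "continuous_on UNIV (\<lambda>x. H (u x))" "continuous_on UNIV (\<lambda>x. H' (u x))"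
    by (rule continuous_on_compose2[OF cH cu] continuous_on_compose2[OF cH' cu], simp)+
  have C1H: "C1 (\<lambda>x. H (u x))" by (rule C1_comp_real[OF C1u dH cHu(2)])
  define \<zeta> where "\<zeta> i x = (\<eta> x * \<eta> x) * H (u x) * vf_apply (X i) u x" for i x
  have C1\<zeta>: "C1 (\<zeta> i)" if "i < m" for i
    unfolding \<zeta>_def[abs_def] using u that
    by (intro C1_mult \<eta> C1H Ck2_vf_C1) (simp_all add: sol_def)
  have \<zeta>0: "\<zeta> i x = 0" if "R < norm x" for i x using supp[OF that] by (simp add: \<zeta>_def)
  have vf\<zeta>: "vf_apply (X i) (\<zeta> i) x = 2 * \<eta> x * vf_apply (X i) \<eta> x * H (u x) * vf_apply (X i) u x
      + (\<eta> x)\<^sup>2 * H' (u x) * (vf_apply (X i) u x)\<^sup>2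
      + (\<eta> x)\<^sup>2 * H (u x) * vf_apply (X i) (vf_apply (X i) u) x" if i: "i < m" for i x
  proof -
    have d: "\<eta> differentiable at x" "(\<lambda>x. H (u x)) differentiable at x"
      "vf_apply (X i) u differentiable at x" "u differentiable at x"
      using C1_diff[OF \<eta>] C1_diff[OF C1H] C1_diff[OF Ck2_vf_C1[OF _ i]] C1_diff[OF C1u] u
      by (auto simp: sol_def)
    have "vf_apply (X i) (\<zeta> i) x = vf_apply (X i) (\<lambda>x. (\<eta> x * \<eta> x) * H (u x)) x * vf_apply (X i) u x
        + (\<eta> x * \<eta> x) * H (u x) * vf_apply (X i) (vf_apply (X i) u) x"
      unfolding \<zeta>_def[abs_def] by (intro vf_apply_mult differentiable_mult d)
    also have "vf_apply (X i) (\<lambda>x. (\<eta> x * \<eta> x) * H (u x)) x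
        = vf_apply (X i) (\<lambda>x. \<eta> x * \<eta> x) x * H (u x) + (\<eta> x * \<eta> x) * vf_apply (X i) (\<lambda>x. H (u x)) x"
      by (intro vf_apply_mult differentiable_mult d)
    also have "vf_apply (X i) (\<lambda>x. \<eta> x * \<eta> x) x = 2 * \<eta> x * vf_apply (X i) \<eta> x"
      using vf_apply_mult[OF d(1) d(1), of "X i"] by simp
    also have "vf_apply (X i) (\<lambda>x. H (u x)) x = H' (u x) * vf_apply (X i) u x"
      by (rule vf_apply_comp_real[OF d(4) dH])
    finally show ?thesis by (simp add: algebra_simps power2_eq_square)
  qed
  have pw: "\<mu> / 2 * ((\<eta> x)\<^sup>2 * H (u x) * Xsq u x) - 2 / \<mu> * (H (u x) * Xsq \<eta> x)
      \<le> \<epsilon> * (\<Sum>i<m. vf_apply (X i) (\<zeta> i) x)" for x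
  proof -
    let ?h = "H (u x)" and ?h' = "H' (u x)" and ?e = "\<eta> x"
    let ?u = "\<lambda>i. vf_apply (X i) u x" and ?n = "\<lambda>i. vf_apply (X i) \<eta> x"
    have "(\<Sum>i<m. vf_apply (X i) (\<zeta> i) x)
        = (\<Sum>i<m. 2 * ?e * ?n i * ?h * ?u i) + (\<Sum>i<m. ?e\<^sup>2 * ?h' * (?u i)\<^sup>2)
          + ?e\<^sup>2 * ?h * (\<Sum>i<m. vf_apply (X i) (vf_apply (X i) u) x)"
      by (simp add: vf\<zeta> sum.distrib sum_distrib_left mult.assoc)
    also have "(\<Sum>i<m. vf_apply (X i) (vf_apply (X i) u) x) = (\<Sum>i<m. (?u i)\<^sup>2)"
      using u by (simp add: sol_def Xsq_def)
    finally have eq: "\<epsilon> * (\<Sum>i<m. vf_apply (X i) (\<zeta> i) x)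
        = (\<Sum>i<m. \<epsilon> * (2 * ?e * ?n i * ?h * ?u i) + ?e\<^sup>2 * (\<epsilon> * (?h + ?h')) * (?u i)\<^sup>2)"
      by (simp add: sum.distrib sum_distrib_left distrib_left distrib_right mult_ac)
    have "\<mu> / 2 * (?e\<^sup>2 * ?h * Xsq u x) - 2 / \<mu> * (?h * Xsq \<eta> x)
        = (\<Sum>i<m. \<mu> / 2 * (?e\<^sup>2 * ?h * (?u i)\<^sup>2) - 2 / \<mu> * (?h * (?n i)\<^sup>2))"
      by (simp add: Xsq_def sum_distrib_left sum_subtractf)
    also have "\<dots> \<le> \<epsilon> * (\<Sum>i<m. vf_apply (X i) (\<zeta> i) x)"
      unfolding eq
    proof (rule sum_mono)
      fix i
      let ?a = "?e * ?u i" and ?b = "?n i"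
      \<comment> \<open>Young's inequality for the cross term, weighted so that it spends exactly
        half of the good term \<open>\<mu> * ?h * ?a\<^sup>2\<close>.\<close>
      have "0 \<le> ?h * ((\<mu> * ?a + 2 * \<epsilon> * ?b)\<^sup>2 / (2 * \<mu>))" using H0 \<mu> by simp
      also have "\<dots> = \<mu> / 2 * (?h * ?a\<^sup>2) + \<epsilon> * (2 * ?a * ?b * ?h) + 2 / \<mu> * (?h * ?b\<^sup>2)"
        using \<mu> \<epsilon> by (auto simp: field_simps power2_eq_square)
      finally have "- (\<mu> / 2 * (?h * ?a\<^sup>2)) - 2 / \<mu> * (?h * ?b\<^sup>2) \<le> \<epsilon> * (2 * ?a * ?b * ?h)" by linarith
      moreover have "?a\<^sup>2 * (\<mu> * ?h) \<le> ?a\<^sup>2 * (\<epsilon> * (?h + ?h'))"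
        using HH by (intro mult_left_mono) auto
      moreover have "?a\<^sup>2 * (\<mu> * ?h) = 2 * (\<mu> / 2 * (?h * ?a\<^sup>2))" by simp
      ultimately have "\<mu> / 2 * (?h * ?a\<^sup>2) - 2 / \<mu> * (?h * ?b\<^sup>2)
          \<le> \<epsilon> * (2 * ?a * ?b * ?h) + ?a\<^sup>2 * (\<epsilon> * (?h + ?h'))"
        by linarith
      then show "\<mu> / 2 * (?e\<^sup>2 * ?h * (?u i)\<^sup>2) - 2 / \<mu> * (?h * (?n i)\<^sup>2)
          \<le> \<epsilon> * (2 * ?e * ?n i * ?h * ?u i) + ?e\<^sup>2 * (\<epsilon> * (?h + ?h')) * (?u i)\<^sup>2"
        by (simp add: power_mult_distrib mult_ac)
    qed
    finally show ?thesis .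
  qed
  have int\<zeta>: "integrable lborel (vf_apply (X i) (\<zeta> i))" if i: "i < m" for i
    by (rule compact_support_integrable[OF vfX_continuous[OF C1\<zeta>[OF i] i]])
       (rule vf_apply_zero_outside[OF \<zeta>0])
  have int1: "integrable lborel (\<lambda>x. (\<eta> x)\<^sup>2 * H (u x) * Xsq u x)"
    by (rule compact_support_integrable[where R = R])
       (auto intro!: continuous_intros cHu C1_cont[OF \<eta>] Xsq_continuous[OF C1u] simp: supp)
  have int2: "integrable lborel (\<lambda>x. H (u x) * Xsq \<eta> x)"
  proof (rule compact_support_integrable[where R = R])
    show "continuous_on UNIV (\<lambda>x. H (u x) * Xsq \<eta> x)"
      by (intro continuous_intros cHu Xsq_continuous \<eta>)
    show "H (u x) * Xsq \<eta> x = 0" if "R < norm x" for x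
      using vf_apply_zero_outside[OF supp that] by (simp add: Xsq_def)
  qed
  have "\<mu> / 2 * (\<integral>x. (\<eta> x)\<^sup>2 * H (u x) * Xsq u x \<partial>lborel) - 2 / \<mu> * (\<integral>x. H (u x) * Xsq \<eta> x \<partial>lborel)
      = (\<integral>x. \<mu> / 2 * ((\<eta> x)\<^sup>2 * H (u x) * Xsq u x) - 2 / \<mu> * (H (u x) * Xsq \<eta> x) \<partial>lborel)"
    using int1 int2 by simp
  also have "\<dots> \<le> (\<integral>x. \<epsilon> * (\<Sum>i<m. vf_apply (X i) (\<zeta> i) x) \<partial>lborel)"
    by (intro integral_mono pw Bochner_Integration.integrable_diff integrable_mult_right
        Bochner_Integration.integrable_sum int\<zeta> int1 int2) simp
  also have "\<dots> = \<epsilon> * (\<Sum>i<m. (\<integral>x. vf_apply (X i) (\<zeta> i) x \<partial>lborel))"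
    using int\<zeta> by simp
  also have "\<dots> = 0" using integral_vf_zero[OF _ C1\<zeta> \<zeta>0] by simp
  finally have "\<mu> / 2 * (\<integral>x. (\<eta> x)\<^sup>2 * H (u x) * Xsq u x \<partial>lborel) \<le> 2 / \<mu> * (\<integral>x. H (u x) * Xsq \<eta> x \<partial>lborel)"
    by simp
  then have "2 / \<mu> * (\<mu> / 2 * (\<integral>x. (\<eta> x)\<^sup>2 * H (u x) * Xsq u x \<partial>lborel))
      \<le> 2 / \<mu> * (2 / \<mu> * (\<integral>x. H (u x) * Xsq \<eta> x \<partial>lborel))"
    using \<mu> by (intro mult_left_mono) auto
  then show ?thesis using \<mu> by (simp add: power2_eq_square)
qed

text \<open>The iteration uses nothing else about powers of exp (-u). The constant is 4 times the square of the
  3/2 in the hypotheses of cacc_exp_aux.\<close>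

definition cacc :: "((real, 'n) vec \<Rightarrow> real) \<Rightarrow> bool" where
  "cacc f \<longleftrightarrow> C1 f \<and> (\<forall>x. 0 \<le> f x) \<and> (\<forall>\<eta> R. C1 \<eta> \<longrightarrow> (\<forall>x. R < norm x \<longrightarrow> \<eta> x = 0) \<longrightarrow>
     (\<integral>x. (\<eta> x)\<^sup>2 * Xsq f x \<partial>lborel) \<le> 9 * (\<integral>x. (f x)\<^sup>2 * Xsq \<eta> x \<partial>lborel))"

lemma Xsq_comp:
  assumes "C1 u" "(F has_real_derivative F') (at (u x))"
  shows "Xsq (\<lambda>x. F (u x)) x = F'\<^sup>2 * Xsq u x"
  using assms by (simp add: Xsq_def vf_apply_comp_real C1_diff power_mult_distrib sum_distrib_left)

text \<open>For the weight \<open>exp (2 * p * s)\<close> the coefficient \<open>H + H'\<close> is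
  \<open>(1 + 2 * p) * H\<close>. The gradient of the power brings the factor
  \<open>p\<^sup>2\<close>, which the second half of \<open>p\<close> compares with
  \<open>\<mu>\<^sup>2\<close>, so that no exponent is left in the constant.\<close>

lemma cacc_exp_aux:
  assumes u: "sol u" and \<mu>: "0 < \<mu>" and \<epsilon>: "\<epsilon> = 1 \<or> \<epsilon> = -1"
    and p: "\<mu> \<le> \<epsilon> * (1 + 2 * p)" "\<bar>p\<bar> \<le> 3 / 2 * \<mu>"
  shows "cacc (\<lambda>x. exp (p * u x))"
  unfolding cacc_def
proof (intro conjI allI impI)
  note C1u = sol_C1[OF u]
  have dF: "((\<lambda>s. exp (p * s)) has_real_derivative p * exp (p * s)) (at s)" for s
    by (auto intro!: derivative_eq_intros)
  have c: "continuous_on UNIV (\<lambda>x. exp (p * u x))" by (intro continuous_intros C1_cont C1u)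
  show C1F: "C1 (\<lambda>x. exp (p * u x))"
    by (rule C1_comp_real[OF C1u dF]) (intro continuous_intros C1_cont C1u)
  show "0 \<le> exp (p * u x)" for x by simp
  fix \<eta> :: "(real, 'n) vec \<Rightarrow> real" and R assume \<eta>: "C1 \<eta>" and supp: "\<forall>x. R < norm x \<longrightarrow> \<eta> x = 0"
  let ?H = "\<lambda>s. (exp (p * s))\<^sup>2"
  have "(\<integral>x. (\<eta> x)\<^sup>2 * Xsq (\<lambda>x. exp (p * u x)) x \<partial>lborel)
      \<le> (\<integral>x. 9 / 4 * \<mu>\<^sup>2 * ((\<eta> x)\<^sup>2 * ?H (u x) * Xsq u x) \<partial>lborel)"
  proof (rule integral_mono)
    show "integrable lborel (\<lambda>x. (\<eta> x)\<^sup>2 * Xsq (\<lambda>x. exp (p * u x)) x)"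
      "integrable lborel (\<lambda>x. 9 / 4 * \<mu>\<^sup>2 * ((\<eta> x)\<^sup>2 * ?H (u x) * Xsq u x))"
      using supp
      by (auto intro!: compact_support_integrable[where R = R] continuous_intros C1_cont[OF \<eta>]
          C1_cont[OF C1u] Xsq_continuous[OF C1u] Xsq_continuous[OF C1F])
    fix x
    have "p\<^sup>2 \<le> (3 / 2 * \<mu>)\<^sup>2" using p(2) \<mu> by (intro abs_le_square_iff[THEN iffD1]) simp
    also have "\<dots> = 9 / 4 * \<mu>\<^sup>2" by (simp add: power2_eq_square)
    finally have "p\<^sup>2 * ((\<eta> x)\<^sup>2 * ?H (u x) * Xsq u x) \<le> 9 / 4 * \<mu>\<^sup>2 * ((\<eta> x)\<^sup>2 * ?H (u x) * Xsq u x)"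
      by (rule mult_right_mono) (simp add: Xsq_nonneg)
    then show "(\<eta> x)\<^sup>2 * Xsq (\<lambda>x. exp (p * u x)) x \<le> 9 / 4 * \<mu>\<^sup>2 * ((\<eta> x)\<^sup>2 * ?H (u x) * Xsq u x)"
      by (simp add: Xsq_comp[OF C1u dF] power_mult_distrib mult_ac)
  qed
  also have "\<dots> = 9 / 4 * \<mu>\<^sup>2 * (\<integral>x. (\<eta> x)\<^sup>2 * ?H (u x) * Xsq u x \<partial>lborel)" by simp
  also have "\<dots> \<le> 9 / 4 * \<mu>\<^sup>2 * (4 / \<mu>\<^sup>2 * (\<integral>x. ?H (u x) * Xsq \<eta> x \<partial>lborel))"
  proof (intro mult_left_mono Caccioppoli_weighted[OF u _ _ _ \<mu> \<epsilon> _ \<eta>])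
    show "(?H has_real_derivative 2 * p * (exp (p * s))\<^sup>2) (at s)" for s
      by (auto intro!: derivative_eq_intros simp: power2_eq_square)
    show "continuous_on UNIV (\<lambda>s. 2 * p * (exp (p * s))\<^sup>2)" by (intro continuous_intros)
    show "\<mu> * ?H s \<le> \<epsilon> * (?H s + 2 * p * (exp (p * s))\<^sup>2)" for s
      using mult_right_mono[OF p(1), of "?H s"] by (simp add: algebra_simps)
    show "R < norm x \<Longrightarrow> \<eta> x = 0" for x using supp by blast
  qed auto
  also have "\<dots> = 9 * (\<integral>x. ?H (u x) * Xsq \<eta> x \<partial>lborel)" using \<mu> by simp
  finally show "(\<integral>x. (\<eta> x)\<^sup>2 * Xsq (\<lambda>x. exp (p * u x)) x \<partial>lborel) \<le> 9 * (\<integral>x. ?H (u x) * Xsq \<eta> x \<partial>lborel)" .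
qed

text \<open>The Caccioppoli inequality for the powers of exp (-u) degenerates at the exponent 1/2, which the
  sequence 3 * 2 ^ k jumps over.\<close>

lemma cacc_exp:
  assumes u: "sol u" and \<epsilon>: "\<epsilon> = 1 \<or> \<epsilon> = -1" and q: "0 < q" "q \<le> 3 / 8 \<or> 3 / 4 \<le> q"
  shows "cacc (\<lambda>x. exp (\<epsilon> * q * u x))"
proof -
  \<comment> \<open>In the last two cases the ratio of \<open>q\<close> to
    \<open>\<bar>1 - 2 * q\<bar>\<close> reaches its largest value 3/2 at the end points 3/8 and
    3/4.\<close>
  consider "\<epsilon> = 1" | "\<epsilon> = -1" "q \<le> 3 / 8" | "\<epsilon> = -1" "3 / 4 \<le> q" using \<epsilon> q by linarith
  then show ?thesis
  proof cases
    case 1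
    then show ?thesis using q by (intro cacc_exp_aux[OF u, of "1 + 2 * q" 1]) auto
  next
    case 2
    then show ?thesis using q by (intro cacc_exp_aux[OF u, of "1 - 2 * q" 1]) auto
  next
    case 3
    then show ?thesis using q by (intro cacc_exp_aux[OF u, of "2 * q - 1" "-1"]) auto
  qed
qed

end

section \<open>The iteration\<close>

text \<open>Squared positive parts are the building blocks of the cutoffs: continuously
  differentiable and zero on a half-line.\<close>

lemma sqpos_deriv: "((\<lambda>s::real. (max 0 s)\<^sup>2) has_real_derivative 2 * max 0 s) (at s)"
proof -
  consider "s < 0" | "s = 0" | "0 < s" by linarith
  then show ?thesis
  proof cases
    case 1
    have "((\<lambda>s::real. (max 0 s)\<^sup>2) has_real_derivative 0) (at s)"
      by (rule has_field_derivative_transform_within_open[where f = "\<lambda>_. 0" and S = "{..<0}"]) (use 1 in auto)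
    then show ?thesis using 1 by simp
  next
    case 2
    have "((\<lambda>h::real. ((max 0 (0 + h))\<^sup>2 - (max 0 0)\<^sup>2) / h) \<longlongrightarrow> 0) (at 0)"
    proof (rule Lim_null_comparison)
      show "\<forall>\<^sub>F h in at (0::real). norm (((max 0 (0 + h))\<^sup>2 - (max 0 0)\<^sup>2) / h) \<le> \<bar>h\<bar>"
        by (intro always_eventually) (auto simp: max_def power2_eq_square)
      show "((\<lambda>h::real. \<bar>h\<bar>) \<longlongrightarrow> 0) (at 0)" by (intro tendsto_rabs_zero tendsto_ident_at)
    qed
    then show ?thesis using 2 by (simp add: DERIV_def)
  next
    case 3
    have "((\<lambda>s::real. (max 0 s)\<^sup>2) has_real_derivative 2 * s) (at s)"
      by (rule has_field_derivative_transform_within_open[where f = "\<lambda>s. s\<^sup>2" and S = "{0<..}"])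
         (use 3 in \<open>auto intro!: derivative_eq_intros\<close>)
    then show ?thesis using 3 by simp
  qed
qed

text \<open>Iterate along radii that approach \<open>R0\<close> with gaps shrinking by a factor
  \<open>l\<close>: the error terms grow like the powers of \<open>1 / l ^ \<nu>\<close> and are
  damped by those of \<open>\<theta>\<close>. The bound \<open>B\<close> only sends the last term to
  0 and leaves no trace in \<open>C\<close>.\<close>

lemma absorption:
  fixes \<theta> :: real and \<nu> :: nat
  assumes \<theta>: "0 \<le> \<theta>" "\<theta> < 1"
  shows "\<exists>C\<ge>0. \<forall>f A B r0 R0. r0 < R0 \<longrightarrow> 0 \<le> A \<longrightarrow> (\<forall>r. r0 \<le> r \<longrightarrow> r \<le> R0 \<longrightarrow> f r \<le> B) \<longrightarrow>
    (\<forall>r R. r0 \<le> r \<longrightarrow> r < R \<longrightarrow> R \<le> R0 \<longrightarrow> f r \<le> \<theta> * f R + A / (R - r) ^ \<nu>) \<longrightarrow>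
    f r0 \<le> C * A / (R0 - r0) ^ \<nu>"
proof -
  \<comment> \<open>Close enough to 1 that \<open>\<theta> < l ^ \<nu>\<close>; the root of order
    \<open>Suc \<nu>\<close> makes sense for \<open>\<nu> = 0\<close> too.\<close>
  define l where "l = root (Suc \<nu>) ((1 + \<theta>) / 2)"
  have l: "0 < l" "l < 1" using \<theta> by (auto simp: l_def)
  have "l ^ Suc \<nu> = (1 + \<theta>) / 2" using \<theta> unfolding l_def by (intro real_root_pow_pos2) auto
  then have "\<theta> < l ^ Suc \<nu>" using \<theta> by (simp only:) simp
  also have "l ^ Suc \<nu> \<le> l ^ \<nu>" using l by (intro power_decreasing) auto
  finally have "\<theta> < l ^ \<nu>" .
  define q where "q = \<theta> / l ^ \<nu>"
  have q: "0 \<le> q" "q < 1" using \<open>\<theta> < l ^ \<nu>\<close> \<theta> l by (auto simp: q_def)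
  define C where "C = 1 / ((1 - l) ^ \<nu> * (1 - q))"
  have C: "0 \<le> C" using l q by (simp add: C_def)
  have "f r0 \<le> C * A / (R0 - r0) ^ \<nu>"
    if rR: "r0 < R0" and A: "0 \<le> A" and bd: "\<And>r. r0 \<le> r \<Longrightarrow> r \<le> R0 \<Longrightarrow> f r \<le> B"
      and step: "\<And>r R. r0 \<le> r \<Longrightarrow> r < R \<Longrightarrow> R \<le> R0 \<Longrightarrow> f r \<le> \<theta> * f R + A / (R - r) ^ \<nu>"
    for f :: "real \<Rightarrow> real" and A B r0 R0
  proof -
    define \<rho> where "\<rho> n = R0 - (R0 - r0) * l ^ n" for n :: nat
    define D where "D = A / ((R0 - r0) * (1 - l)) ^ \<nu>"
    have D: "0 \<le> D" using A rR l by (simp add: D_def)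
    have \<rho>: "r0 \<le> \<rho> n" "\<rho> n \<le> R0" for n
    proof -
      have "(R0 - r0) * l ^ n \<le> (R0 - r0) * 1"
        using rR l by (intro mult_left_mono power_le_one) auto
      then show "r0 \<le> \<rho> n" by (simp add: \<rho>_def)
      show "\<rho> n \<le> R0" using rR l by (simp add: \<rho>_def)
    qed
    have gap: "\<rho> (Suc n) - \<rho> n = (R0 - r0) * (1 - l) * l ^ n" for n
      by (simp add: \<rho>_def algebra_simps)
    have st: "f (\<rho> n) \<le> \<theta> * f (\<rho> (Suc n)) + D * (1 / l ^ \<nu>) ^ n" for n
    proof -
      have "\<rho> n < \<rho> (Suc n)" using gap[of n] rR l by (simp add: algebra_simps) (smt (verit) gap mult_pos_pos zero_less_power)
      then have "f (\<rho> n) \<le> \<theta> * f (\<rho> (Suc n)) + A / (\<rho> (Suc n) - \<rho> n) ^ \<nu>"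
        using \<rho> by (intro step)
      also have "A / (\<rho> (Suc n) - \<rho> n) ^ \<nu> = D * (1 / l ^ \<nu>) ^ n"
        unfolding gap D_def by (simp add: power_mult_distrib power_divide flip: power_mult) (simp add: mult.commute)
      finally show ?thesis .
    qed
    have it: "f r0 \<le> \<theta> ^ n * f (\<rho> n) + D * (\<Sum>k<n. q ^ k)" for n
    proof (induction n)
      case 0
      show ?case by (simp add: \<rho>_def)
    next
      case (Suc n)
      have "\<theta> ^ n * f (\<rho> n) \<le> \<theta> ^ n * (\<theta> * f (\<rho> (Suc n)) + D * (1 / l ^ \<nu>) ^ n)"
        using st \<theta> by (intro mult_left_mono) auto
      also have "\<dots> = \<theta> ^ Suc n * f (\<rho> (Suc n)) + D * q ^ n"
        by (simp add: q_def algebra_simps power_divide)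
      finally show ?case using Suc by (simp add: algebra_simps)
    qed
    have "f r0 \<le> \<theta> ^ n * B + D * (1 / (1 - q))" for n
    proof -
      have "\<theta> ^ n * f (\<rho> n) \<le> \<theta> ^ n * B" using bd \<rho> \<theta> by (intro mult_left_mono) auto
      moreover have "(\<Sum>k<n. q ^ k) \<le> 1 / (1 - q)"
        using q by (simp add: sum_gp_strict divide_right_mono)
      then have "D * (\<Sum>k<n. q ^ k) \<le> D * (1 / (1 - q))" using D by (intro mult_left_mono)
      ultimately show ?thesis using it[of n] by linarith
    qed
    moreover have "(\<lambda>n. \<theta> ^ n * B + D * (1 / (1 - q))) \<longlonglongrightarrow> 0 * B + D * (1 / (1 - q))"
      using \<theta> by (intro tendsto_intros LIMSEQ_realpow_zero)
    ultimately have "f r0 \<le> D * (1 / (1 - q))"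
      using LIMSEQ_le_const[of _ "0 * B + D * (1 / (1 - q))" "f r0"] by force
    also have "\<dots> = C * A / (R0 - r0) ^ \<nu>" by (simp add: C_def D_def power_mult_distrib)
    finally show ?thesis .
  qed
  then show ?thesis using C by (intro exI[of _ C]) blast
qed

text \<open>The normalised quantity \<open>A * b ^ Suc n * a n\<close> is at most squared in each
  step.\<close>

lemma quadratic_recursion:
  fixes a :: "nat \<Rightarrow> real"
  assumes a0: "\<And>n. 0 \<le> a n" and A: "0 < A" and b: "0 < b" and rec: "\<And>n. a (Suc n) \<le> A * b ^ n * (a n)\<^sup>2"
  shows "a n \<le> (A * b * a 0) ^ (2 ^ n) / (A * b ^ Suc n)"
proof (induction n)
  case 0
  show ?case using A b by simp
next
  case (Suc n)
  let ?z = "(A * b * a 0) ^ (2 ^ n)"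
  have "a (Suc n) \<le> A * b ^ n * (a n)\<^sup>2" by (rule rec)
  also have "\<dots> \<le> A * b ^ n * (?z / (A * b ^ Suc n))\<^sup>2"
    using A b a0 Suc by (intro mult_left_mono power_mono) auto
  also have "\<dots> = ?z\<^sup>2 / (A * b ^ Suc (Suc n))"
    using A b by (simp add: power2_eq_square field_simps)
  also have "?z\<^sup>2 = (A * b * a 0) ^ (2 ^ Suc n)" by (simp add: power_mult[symmetric] mult.commute)
  finally show ?case .
qed

text \<open>3/8 and 3/4 are consecutive members of the sequence, at \<open>k = -3\<close> and
  \<open>k = -2\<close>.\<close>

lemma Moser_exponent: "(3 * 2 powi k :: real) \<le> 3 / 8 \<or> 3 / 4 \<le> (3 * 2 powi k :: real)"
proof (cases "k \<le> -3")
  case True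
  then have "(2::real) powi k \<le> 2 powi (-3)" by (intro power_int_increasing) auto
  also have "(2::real) powi (-3) = 1 / 8" by (simp add: power_int_def power_divide)
  finally show ?thesis by simp
next
  case False
  have "1 / 4 = (2::real) powi (-2)" by (simp add: power_int_def power_divide)
  also have "\<dots> \<le> 2 powi k" using False by (intro power_int_increasing) auto
  finally show ?thesis by simp
qed

lemma ex_dyadic:
  fixes t :: real
  assumes "0 < t" shows "\<exists>k. t \<le> 3 * 2 powi k \<and> 3 * 2 powi k \<le> 2 * t"
proof -
  define k where "k = \<lceil>log 2 (t / 3)\<rceil>"
  have k: "(2::real) powi k = 2 powr k" by (simp add: powr_real_of_int')
  have l: "2 powr (log 2 (t / 3)) = t / 3" using assms by simp
  have "log 2 (t / 3) \<le> k" "k \<le> log 2 (t / 3) + 1" unfolding k_def by linarith+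
  then have "2 powr (log 2 (t / 3)) \<le> 2 powr k" "2 powr k \<le> 2 powr (log 2 (t / 3) + 1)" by simp_all
  then show ?thesis using l by (intro exI[of _ k]) (simp add: k powr_add)
qed

context hom_system
begin

section \<open>Integrals over balls, Nash's inequality for real integrals, and cutoffs\<close>

abbreviation bint :: "real \<Rightarrow> ((real, 'n) vec \<Rightarrow> real) \<Rightarrow> real" where
  "bint R h \<equiv> (\<integral>x. h x * indicator (cball 0 R) x \<partial>lborel)"

lemma bint_integrable:
  fixes h :: "(real, 'n) vec \<Rightarrow> real"
  assumes "continuous_on UNIV h"
  shows "integrable lborel (\<lambda>x. h x * indicator (cball 0 R) x)"
proof -
  have "integrable lborel (\<lambda>x. indicator (cball 0 R) x *\<^sub>R h x)"
    by (intro borel_integrable_compact continuous_on_subset[OF assms]) auto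
  then show ?thesis by (simp add: mult.commute)
qed

lemma bint_mono:
  assumes "continuous_on UNIV h" "continuous_on UNIV g" "\<And>x. norm x \<le> R \<Longrightarrow> h x \<le> g x"
  shows "bint R h \<le> bint R g"
  by (intro integral_mono bint_integrable assms) (use assms(3) in \<open>auto simp: indicator_def\<close>)

lemma bint_mono_R:
  assumes "continuous_on UNIV h" "\<And>x. 0 \<le> h x" "r \<le> R"
  shows "bint r h \<le> bint R h"
  by (intro integral_mono bint_integrable assms) (use assms(2,3) in \<open>auto simp: indicator_def\<close>)

lemma nnb_eq_bint:
  assumes "continuous_on UNIV h" "\<And>x. 0 \<le> h x"
  shows "nnb R h = ennreal (bint R h)"
proof -
  have "nnb R h = (\<integral>\<^sup>+x. ennreal (h x * indicator (cball 0 R) x) \<partial>lborel)"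
    by (intro nn_integral_cong) (simp add: indicator_def)
  then show ?thesis
    using nn_integral_eq_integral[OF bint_integrable[OF assms(1)]] assms(2) by simp
qed

lemma Nash:
  "\<exists>C\<ge>1. \<forall>\<phi> r. C1 \<phi> \<longrightarrow> (\<forall>x. 2 < norm x \<longrightarrow> \<phi> x = 0) \<longrightarrow> 0 < r \<longrightarrow> r \<le> 1 \<longrightarrow>
     (\<integral>x. (\<phi> x)\<^sup>2 \<partial>lborel) \<le> C * r\<^sup>2 * (\<integral>x. Xsq \<phi> x \<partial>lborel) + C / r ^ Q * (\<integral>x. \<bar>\<phi> x\<bar> \<partial>lborel)\<^sup>2"
proof -
  obtain C where C: "0 \<le> C" and N: "\<forall>\<phi> r. C1 \<phi> \<longrightarrow> (\<forall>x. 2 < norm x \<longrightarrow> \<phi> x = 0) \<longrightarrow> 0 < r \<longrightarrow> r \<le> 1 \<longrightarrow>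
     ennreal (2 ^ CARD('n) * r ^ Q) * (\<integral>\<^sup>+x. ennreal ((\<phi> x)\<^sup>2) \<partial>lborel)
      \<le> ennreal (2 ^ CARD('n) * r ^ Q) * (ennreal (C * r\<^sup>2) * (\<integral>\<^sup>+x. ennreal (Xsq \<phi> x) \<partial>lborel))
        + 2 * (\<integral>\<^sup>+x. ennreal \<bar>\<phi> x\<bar> \<partial>lborel) * (\<integral>\<^sup>+x. ennreal \<bar>\<phi> x\<bar> \<partial>lborel)"
    using Nash_nn by (elim exE conjE)
  have "(\<integral>x. (\<phi> x)\<^sup>2 \<partial>lborel) \<le> (C + 2) * r\<^sup>2 * (\<integral>x. Xsq \<phi> x \<partial>lborel) + (C + 2) / r ^ Q * (\<integral>x. \<bar>\<phi> x\<bar> \<partial>lborel)\<^sup>2"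
    if \<phi>: "C1 \<phi>" and supp: "\<And>x. 2 < norm x \<Longrightarrow> \<phi> x = 0" and r: "0 < r" "r \<le> 1" for \<phi> r
  proof -
    define A where "A = (\<integral>x. (\<phi> x)\<^sup>2 \<partial>lborel)"
    define B where "B = (\<integral>x. Xsq \<phi> x \<partial>lborel)"
    define J where "J = (\<integral>x. \<bar>\<phi> x\<bar> \<partial>lborel)"
    define V where "V = 2 ^ CARD('n) * r ^ Q"
    have V: "r ^ Q \<le> V" "0 < V" using r by (auto simp: V_def)
    have i: "integrable lborel (\<lambda>x. (\<phi> x)\<^sup>2)" "integrable lborel (Xsq \<phi>)" "integrable lborel (\<lambda>x. \<bar>\<phi> x\<bar>)"
      using vf_apply_zero_outside[where R = 2 and f = \<phi>, OF supp]
      by (auto intro!: compact_support_integrable[where R = 2] continuous_intros C1_cont[OF \<phi>] Xsq_continuous[OF \<phi>]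
          simp: supp Xsq_def)
    have pos: "0 \<le> A" "0 \<le> B" "0 \<le> J" by (simp_all add: A_def B_def J_def Xsq_nonneg)
    have "ennreal (2 ^ CARD('n) * r ^ Q) * (\<integral>\<^sup>+x. ennreal ((\<phi> x)\<^sup>2) \<partial>lborel)
      \<le> ennreal (2 ^ CARD('n) * r ^ Q) * (ennreal (C * r\<^sup>2) * (\<integral>\<^sup>+x. ennreal (Xsq \<phi> x) \<partial>lborel))
        + 2 * (\<integral>\<^sup>+x. ennreal \<bar>\<phi> x\<bar> \<partial>lborel) * (\<integral>\<^sup>+x. ennreal \<bar>\<phi> x\<bar> \<partial>lborel)"
      by (rule N[rule_format]) (use \<phi> supp r in auto)
    then have "ennreal V * ennreal A \<le> ennreal V * (ennreal (C * r\<^sup>2) * ennreal B) + 2 * ennreal J * ennreal J"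
      using i by (simp add: nn_integral_eq_integral Xsq_nonneg A_def B_def J_def V_def)
    also have "\<dots> = ennreal (V * (C * r\<^sup>2 * B) + 2 * J * J)"
      using V C pos by (simp add: ennreal_plus ennreal_mult)
    finally have "ennreal (V * A) \<le> ennreal (V * (C * r\<^sup>2 * B) + 2 * J * J)"
      using V pos by (simp add: ennreal_mult)
    then have "V * A \<le> V * (C * r\<^sup>2 * B) + 2 * J * J"
      using V C pos by (subst (asm) ennreal_le_iff) auto
    then have "A \<le> C * r\<^sup>2 * B + 2 * J * J / V"
      using V by (simp add: field_simps)
    also have "2 * J * J / V \<le> 2 * J * J / r ^ Q"
      using V r pos by (intro divide_left_mono) auto
    also have "2 * J * J / r ^ Q \<le> (C + 2) / r ^ Q * J\<^sup>2"
    proof -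
      have "2 * (J * J) \<le> (C + 2) * (J * J)" using C pos by (intro mult_right_mono) auto
      then show ?thesis using r by (simp add: power2_eq_square divide_right_mono mult.assoc)
    qed
    also have "C * r\<^sup>2 * B \<le> (C + 2) * r\<^sup>2 * B"
      using C pos by (intro mult_right_mono) auto
    finally show ?thesis by (simp add: A_def B_def J_def)
  qed
  then show ?thesis using C by (intro exI[of _ "C + 2"]) auto
qed

text \<open>A profile made of two nested squared positive parts, applied to the squared norm to
  avoid the singularity of the norm at 0. \<open>K\<close> involves only \<open>R0\<close>,
  \<open>m\<close> and a bound for the fields on the ball of radius \<open>R0\<close>.\<close>

lemma cutoff:
  "\<exists>K\<ge>0. \<forall>r R. 1 \<le> r \<longrightarrow> r < R \<longrightarrow> R \<le> R0 \<longrightarrow> (\<exists>\<eta>. C1 \<eta> \<and> (\<forall>x. 0 \<le> \<eta> x \<and> \<eta> x \<le> 1) \<and>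
     (\<forall>x. norm x \<le> r \<longrightarrow> \<eta> x = 1) \<and> (\<forall>x. R < norm x \<longrightarrow> \<eta> x = 0) \<and>
     (\<forall>x. Xsq \<eta> x \<le> K / (R - r)\<^sup>2 * indicator (cball 0 R) x))"
proof -
  have "compact (\<Union>i<m. X i ` cball 0 R0)"
    by (intro compact_UN compact_continuous_image X_continuous compact_cball) auto
  then have "\<exists>M. \<forall>y\<in>(\<Union>i<m. X i ` cball 0 R0). norm y \<le> M"
    using compact_imp_bounded unfolding bounded_iff[symmetric] by blast
  then obtain M where M': "\<forall>y\<in>(\<Union>i<m. X i ` cball 0 R0). norm y \<le> M" by blast
  have M: "norm (X i x) \<le> M" if "i < m" "norm x \<le> R0" for i x using M' that by auto
  define K where "K = real m * (8 * (R0 * M))\<^sup>2"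
  have "\<exists>\<eta>. C1 \<eta> \<and> (\<forall>x. 0 \<le> \<eta> x \<and> \<eta> x \<le> 1) \<and>
     (\<forall>x. norm x \<le> r \<longrightarrow> \<eta> x = 1) \<and> (\<forall>x. R < norm x \<longrightarrow> \<eta> x = 0) \<and>
     (\<forall>x. Xsq \<eta> x \<le> K / (R - r)\<^sup>2 * indicator (cball 0 R) x)"
    if r: "1 \<le> r" "r < R" "R \<le> R0" for r R
  proof -
    \<comment> \<open>The profile lives in the variable \<open>x \<bullet> x\<close>;
      \<open>r \<ge> 1\<close> ensures \<open>d \<ge> R - r\<close>, so its slope is controlled by
      \<open>R - r\<close>.\<close>
    define d where "d = R\<^sup>2 - r\<^sup>2"
    have d: "R - r \<le> d" "0 < d"
    proof -
      have "(R - r) * 1 \<le> (R - r) * (R + r)" using r by (intro mult_left_mono) auto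
      then show "R - r \<le> d" by (simp add: d_def power2_eq_square algebra_simps)
      then show "0 < d" using r by linarith
    qed
    define y where "y t = (t - r\<^sup>2) / d" for t
    define h where "h t = (max 0 (1 - (max 0 (y t))\<^sup>2))\<^sup>2" for t :: real
    define h' where "h' t = 2 * max 0 (1 - (max 0 (y t))\<^sup>2) * - (2 * max 0 (y t) * (1 / d))" for t :: real
    define \<eta> where "\<eta> x = h (x \<bullet> x)" for x :: "(real, 'n) vec"
    have dy: "(y has_real_derivative 1 / d) (at t)" for t
      unfolding y_def[abs_def] using d by (auto intro!: derivative_eq_intros)
    have dh: "(h has_real_derivative h' t) (at t)" for t
    proof -
      have "((\<lambda>t. 1 - (max 0 (y t))\<^sup>2) has_real_derivative - (2 * max 0 (y t) * (1 / d))) (at t)"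
        using DERIV_diff[OF DERIV_const DERIV_chain2[OF sqpos_deriv dy]] by simp
      from DERIV_chain2[OF sqpos_deriv this] show ?thesis unfolding h_def[abs_def] h'_def .
    qed
    have cy: "continuous_on UNIV y" unfolding y_def[abs_def] using d by (intro continuous_intros) auto
    have ch': "continuous_on UNIV h'"
      unfolding h'_def[abs_def] using d by (intro continuous_intros cy) auto
    have n2: "C1 (\<lambda>x::(real, 'n) vec. x \<bullet> x)"
      by (simp add: inner_vec_def C1_sum C1_mult C1_coord)
    have C1\<eta>: "C1 \<eta>"
      unfolding \<eta>_def[abs_def]
      by (rule C1_comp_real[OF n2 dh]) (rule continuous_on_compose2[OF ch' C1_cont[OF n2]], simp)
    have b: "0 \<le> \<eta> x \<and> \<eta> x \<le> 1" for x
    proof -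
      have "(max 0 (1 - (max 0 (y (x \<bullet> x)))\<^sup>2))\<^sup>2 \<le> 1\<^sup>2"
        by (intro power_mono) auto
      then show ?thesis by (simp add: \<eta>_def h_def)
    qed
    have one: "\<eta> x = 1" if "norm x \<le> r" for x
    proof -
      have "x \<bullet> x \<le> r\<^sup>2" using that by (simp add: dot_square_norm power_mono)
      then have "y (x \<bullet> x) \<le> 0" using d by (simp add: y_def divide_le_0_iff)
      then show ?thesis by (simp add: \<eta>_def h_def max_absorb1)
    qed
    have out: "1 - (max 0 (y (x \<bullet> x)))\<^sup>2 \<le> 0" if "R < norm x" for x :: "(real, 'n) vec"
    proof -
      have "R\<^sup>2 \<le> x \<bullet> x" using that r by (simp add: dot_square_norm power_mono)
      then have "1 \<le> y (x \<bullet> x)" using d by (simp add: y_def d_def)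
      then have "1 \<le> (max 0 (y (x \<bullet> x)))\<^sup>2" by (simp add: one_le_power max_def)
      then show ?thesis by simp
    qed
    have zero: "\<eta> x = 0" if "R < norm x" for x using out[OF that] by (simp add: \<eta>_def h_def max_absorb1)
    have h'b: "\<bar>h' t\<bar> \<le> 4 / d" for t
    proof -
      let ?p = "max 0 (y t)"
      have "max 0 (1 - ?p\<^sup>2) * ?p \<le> 1"
      proof (cases "?p \<le> 1")
        case True
        then show ?thesis by (intro mult_le_one) auto
      next
        case False
        then have "1 \<le> ?p\<^sup>2" by (simp add: one_le_power)
        then show ?thesis by (simp add: max_absorb1)
      qed
      moreover have "0 \<le> max 0 (1 - ?p\<^sup>2) * ?p" by simp
      moreover have "h' t = - (4 / d * (max 0 (1 - ?p\<^sup>2) * ?p))" by (simp add: h'_def)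
      ultimately show ?thesis using d by (simp add: abs_mult divide_right_mono)
    qed
    have "Xsq \<eta> x \<le> K / (R - r)\<^sup>2 * indicator (cball 0 R) x" for x
    proof (cases "norm x \<le> R")
      case True
      have "(vf_apply (X i) \<eta> x)\<^sup>2 \<le> (8 * (R0 * M) / (R - r))\<^sup>2" if i: "i < m" for i
      proof -
        have "((\<lambda>x::(real, 'n) vec. x \<bullet> x) has_derivative (\<lambda>h. x \<bullet> h + h \<bullet> x)) (at x)"
          by (intro has_derivative_inner has_derivative_ident)
        from vf_apply_has_derivative[OF this]
        have "vf_apply (X i) (\<lambda>x. x \<bullet> x) x = 2 * (x \<bullet> X i x)" by (simp add: inner_commute)
        then have v: "vf_apply (X i) \<eta> x = h' (x \<bullet> x) * (2 * (x \<bullet> X i x))"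
          unfolding \<eta>_def[abs_def] using vf_apply_comp_real[OF C1_diff[OF n2] dh] by simp
        have "\<bar>x \<bullet> X i x\<bar> \<le> norm x * norm (X i x)" by (rule Cauchy_Schwarz_ineq2)
        also have "\<dots> \<le> R0 * M" using M[OF i, of x] True r by (intro mult_mono) auto
        finally have xX: "\<bar>x \<bullet> X i x\<bar> \<le> R0 * M" .
        have "\<bar>h' (x \<bullet> x)\<bar> * \<bar>x \<bullet> X i x\<bar> \<le> 4 / d * (R0 * M)"
          using h'b d xX by (intro mult_mono) auto
        also have "\<dots> \<le> 4 / (R - r) * (R0 * M)"
          using d r xX by (intro mult_right_mono divide_left_mono) auto
        finally have "\<bar>vf_apply (X i) \<eta> x\<bar> \<le> 8 * (R0 * M) / (R - r)"
          unfolding v by (simp add: abs_mult)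
        also have "\<dots> \<le> \<bar>8 * (R0 * M) / (R - r)\<bar>" by (rule abs_ge_self)
        finally show ?thesis by (rule abs_le_square_iff[THEN iffD1])
      qed
      then have "Xsq \<eta> x \<le> (\<Sum>i<m. (8 * (R0 * M) / (R - r))\<^sup>2)"
        unfolding Xsq_def by (intro sum_mono) simp
      then show ?thesis using True by (simp add: K_def power_divide)
    next
      case False
      then show ?thesis using vf_apply_zero_outside[where R = R and f = \<eta>, OF zero] by (simp add: Xsq_def)
    qed
    then show ?thesis using C1\<eta> b one zero by (intro exI[of _ \<eta>]) blast
  qed
  moreover have "0 \<le> K" by (simp add: K_def)
  ultimately show ?thesis by (intro exI[of _ K]) blast
qed


text \<open>Nash's inequality, its energy term bounded by the Caccioppoli inequality and then absorbed.\<close>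

lemma L2_le_L1:
  "\<exists>C\<ge>1. \<forall>f r R. cacc f \<longrightarrow> 1 \<le> r \<longrightarrow> r < R \<longrightarrow> R \<le> 2 \<longrightarrow>
     bint r (\<lambda>x. (f x)\<^sup>2) \<le> C / (R - r) ^ Q * (bint R f)\<^sup>2"
proof -
  obtain N where N1: "1 \<le> N" and N: "\<forall>\<phi> r. C1 \<phi> \<longrightarrow> (\<forall>x. 2 < norm x \<longrightarrow> \<phi> x = 0) \<longrightarrow> 0 < r \<longrightarrow> r \<le> 1 \<longrightarrow>
     (\<integral>x. (\<phi> x)\<^sup>2 \<partial>lborel) \<le> N * r\<^sup>2 * (\<integral>x. Xsq \<phi> x \<partial>lborel) + N / r ^ Q * (\<integral>x. \<bar>\<phi> x\<bar> \<partial>lborel)\<^sup>2"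
    using Nash by (elim exE conjE)
  obtain K where K0: "0 \<le> K" and K: "\<forall>r R. 1 \<le> r \<longrightarrow> r < R \<longrightarrow> R \<le> 2 \<longrightarrow> (\<exists>\<eta>. C1 \<eta> \<and> (\<forall>x. 0 \<le> \<eta> x \<and> \<eta> x \<le> 1) \<and>
     (\<forall>x. norm x \<le> r \<longrightarrow> \<eta> x = 1) \<and> (\<forall>x. R < norm x \<longrightarrow> \<eta> x = 0) \<and>
     (\<forall>x. Xsq \<eta> x \<le> K / (R - r)\<^sup>2 * indicator (cball 0 R) x))"
    using cutoff[of 2] by (elim exE conjE)
  have half: "0 \<le> (1 / 2 :: real)" "(1 / 2 :: real) < 1" by simp_all
  obtain A where A0: "0 \<le> A" and A: "\<forall>(f :: real \<Rightarrow> real) D B r0 R0. r0 < R0 \<longrightarrow> 0 \<le> D \<longrightarrow> (\<forall>r. r0 \<le> r \<longrightarrow> r \<le> R0 \<longrightarrow> f r \<le> B) \<longrightarrow>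
    (\<forall>r R. r0 \<le> r \<longrightarrow> r < R \<longrightarrow> R \<le> R0 \<longrightarrow> f r \<le> 1 / 2 * f R + D / (R - r) ^ Q) \<longrightarrow>
    f r0 \<le> A * D / (R0 - r0) ^ Q"
    using absorption[OF half, of Q] by (elim exE conjE)
  \<comment> \<open>Nash's inequality is used at the scale \<open>\<rho> = (R - r) / a\<close>. The
    choice of \<open>a\<close> brings the energy contribution \<open>20 * N * K / a\<^sup>2\<close>
    below 1/2, and the summand 1 gives \<open>a \<ge> 1\<close>, hence
    \<open>\<rho> \<le> 1\<close>.\<close>
  define a where "a = sqrt (40 * N * K + 1)"
  have a2: "a\<^sup>2 = 40 * N * K + 1" using K0 N1 by (simp add: a_def)
  have a1: "1 \<le> a" using K0 N1 by (simp add: a_def)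
  have main: "bint r0 (\<lambda>x. (f x)\<^sup>2) \<le> A * (N * a ^ Q * (bint R0 f)\<^sup>2) / (R0 - r0) ^ Q"
    if f: "cacc f" and r0: "1 \<le> r0" "r0 < R0" "R0 \<le> 2" for f r0 R0
  proof (rule A[rule_format, where B = "bint R0 (\<lambda>x. (f x)\<^sup>2)"])
    have C1f: "C1 f" and f0: "\<And>x. 0 \<le> f x" using f by (auto simp: cacc_def)
    note cf = C1_cont[OF C1f]
    have cf2: "continuous_on UNIV (\<lambda>x. (f x)\<^sup>2)" by (intro continuous_intros cf)
    show "r0 < R0" by fact
    show "0 \<le> N * a ^ Q * (bint R0 f)\<^sup>2" using N1 a1 by simp
    show "bint r (\<lambda>x. (f x)\<^sup>2) \<le> bint R0 (\<lambda>x. (f x)\<^sup>2)" if "r \<le> R0" for r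
      by (rule bint_mono_R[OF cf2 _ that]) simp
    fix r R assume r: "r0 \<le> r" "r < R" "R \<le> R0"
    obtain \<eta> where \<eta>: "C1 \<eta>" and \<eta>01: "\<And>x. 0 \<le> \<eta> x" "\<And>x. \<eta> x \<le> 1"
      and \<eta>1: "\<And>x. norm x \<le> r \<Longrightarrow> \<eta> x = 1" and \<eta>0: "\<And>x. R < norm x \<Longrightarrow> \<eta> x = 0"
      and \<eta>X: "\<And>x. Xsq \<eta> x \<le> K / (R - r)\<^sup>2 * indicator (cball 0 R) x"
      using K[rule_format, of r R] r r0 by auto
    define \<phi> where "\<phi> x = \<eta> x * f x" for x
    have C1\<phi>: "C1 \<phi>" unfolding \<phi>_def[abs_def] by (intro C1_mult \<eta> C1f)
    have \<phi>0: "\<phi> x = 0" if "R < norm x" for x using \<eta>0[OF that] by (simp add: \<phi>_def)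
    have c\<phi>2: "continuous_on UNIV (\<lambda>x. (\<phi> x)\<^sup>2)" by (intro continuous_intros C1_cont[OF C1\<phi>])
    note cX = Xsq_continuous[OF \<eta>] Xsq_continuous[OF C1f] Xsq_continuous[OF C1\<phi>]
    have X\<eta>0: "Xsq \<eta> x = 0" "Xsq \<phi> x = 0" if "R < norm x" for x
      using vf_apply_zero_outside[where R = R and f = \<eta>, OF \<eta>0 that]
        vf_apply_zero_outside[where R = R and f = \<phi>, OF \<phi>0 that] by (simp_all add: Xsq_def)
    define \<rho> where "\<rho> = (R - r) / a"
    have \<rho>: "0 < \<rho>" "\<rho> \<le> 1" using r r0 a1 by (auto simp: \<rho>_def divide_le_eq)
    have X\<phi>: "Xsq \<phi> x \<le> 2 * ((\<eta> x)\<^sup>2 * Xsq f x) + 2 * ((f x)\<^sup>2 * Xsq \<eta> x)" for x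
    proof -
      have "(vf_apply (X i) \<phi> x)\<^sup>2 \<le> 2 * ((\<eta> x)\<^sup>2 * (vf_apply (X i) f x)\<^sup>2) + 2 * ((f x)\<^sup>2 * (vf_apply (X i) \<eta> x)\<^sup>2)" for i
      proof -
        have "vf_apply (X i) \<phi> x = vf_apply (X i) \<eta> x * f x + \<eta> x * vf_apply (X i) f x"
          unfolding \<phi>_def[abs_def] by (rule vf_apply_mult[OF C1_diff[OF \<eta>] C1_diff[OF C1f]])
        then show ?thesis
          using sum_squares_bound[of "vf_apply (X i) \<eta> x * f x" "\<eta> x * vf_apply (X i) f x"]
          by (simp add: power2_eq_square algebra_simps)
      qed
      then have "Xsq \<phi> x \<le> (\<Sum>i<m. 2 * ((\<eta> x)\<^sup>2 * (vf_apply (X i) f x)\<^sup>2) + 2 * ((f x)\<^sup>2 * (vf_apply (X i) \<eta> x)\<^sup>2))"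
        unfolding Xsq_def by (intro sum_mono)
      then show ?thesis by (simp add: Xsq_def sum.distrib sum_distrib_left)
    qed
    have i1: "integrable lborel (\<lambda>x. (\<eta> x)\<^sup>2 * Xsq f x)" "integrable lborel (\<lambda>x. (f x)\<^sup>2 * Xsq \<eta> x)"
      "integrable lborel (Xsq \<phi>)" "integrable lborel (\<lambda>x. (\<phi> x)\<^sup>2)" "integrable lborel (\<lambda>x. \<bar>\<phi> x\<bar>)"
      by (auto intro!: compact_support_integrable[where R = R] continuous_intros cX C1_cont[OF \<eta>] cf C1_cont[OF C1\<phi>]
          simp: \<eta>0 X\<eta>0 \<phi>0)
    have "(\<integral>x. Xsq \<phi> x \<partial>lborel) \<le> (\<integral>x. 2 * ((\<eta> x)\<^sup>2 * Xsq f x) + 2 * ((f x)\<^sup>2 * Xsq \<eta> x) \<partial>lborel)"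
      using i1 by (intro integral_mono X\<phi>) auto
    also have "\<dots> = 2 * (\<integral>x. (\<eta> x)\<^sup>2 * Xsq f x \<partial>lborel) + 2 * (\<integral>x. (f x)\<^sup>2 * Xsq \<eta> x \<partial>lborel)"
      using i1 by simp
    also have "(\<integral>x. (\<eta> x)\<^sup>2 * Xsq f x \<partial>lborel) \<le> 9 * (\<integral>x. (f x)\<^sup>2 * Xsq \<eta> x \<partial>lborel)"
      using f \<eta> \<eta>0 unfolding cacc_def by blast
    also have "(\<integral>x. (f x)\<^sup>2 * Xsq \<eta> x \<partial>lborel) \<le> (\<integral>x. K / (R - r)\<^sup>2 * ((f x)\<^sup>2 * indicator (cball 0 R) x) \<partial>lborel)"
    proof (rule integral_mono[OF i1(2)])
      show "integrable lborel (\<lambda>x. K / (R - r)\<^sup>2 * ((f x)\<^sup>2 * indicator (cball 0 R) x))"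
        by (intro integrable_mult_right bint_integrable cf2)
      show "(f x)\<^sup>2 * Xsq \<eta> x \<le> K / (R - r)\<^sup>2 * ((f x)\<^sup>2 * indicator (cball 0 R) x)" for x
        using mult_left_mono[OF \<eta>X[of x], of "(f x)\<^sup>2"] by (simp add: mult_ac)
    qed
    also have "\<dots> = K / (R - r)\<^sup>2 * bint R (\<lambda>x. (f x)\<^sup>2)" by simp
    \<comment> \<open>20 = 2 * 9 + 2: the factor 2 of the product rule and the 9 of
      \<open>cacc\<close>.\<close>
    finally have E: "(\<integral>x. Xsq \<phi> x \<partial>lborel) \<le> 20 * (K / (R - r)\<^sup>2 * bint R (\<lambda>x. (f x)\<^sup>2))" by simp
    have J: "(\<integral>x. \<bar>\<phi> x\<bar> \<partial>lborel)\<^sup>2 \<le> (bint R0 f)\<^sup>2"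
    proof (rule power_mono)
      show "(\<integral>x. \<bar>\<phi> x\<bar> \<partial>lborel) \<le> bint R0 f"
      proof (rule integral_mono[OF i1(5) bint_integrable[OF cf]])
        show "\<bar>\<phi> x\<bar> \<le> f x * indicator (cball 0 R0) x" for x
          using \<eta>01[of x] f0[of x] \<phi>0[of x] r
          by (auto simp: \<phi>_def indicator_def abs_mult mult_left_le_one_le)
      qed
    qed simp
    have "bint r (\<lambda>x. (f x)\<^sup>2) \<le> (\<integral>x. (\<phi> x)\<^sup>2 \<partial>lborel)"
    proof (rule integral_mono[OF bint_integrable[OF cf2] i1(4)])
      show "(f x)\<^sup>2 * indicator (cball 0 r) x \<le> (\<phi> x)\<^sup>2" for x
        using \<eta>1[of x] by (auto simp: \<phi>_def indicator_def)
    qed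
    also have "\<dots> \<le> N * \<rho>\<^sup>2 * (\<integral>x. Xsq \<phi> x \<partial>lborel) + N / \<rho> ^ Q * (\<integral>x. \<bar>\<phi> x\<bar> \<partial>lborel)\<^sup>2"
      by (rule N[rule_format]) (use C1\<phi> \<phi>0 r r0 \<rho> in auto)
    also have "N / \<rho> ^ Q * (\<integral>x. \<bar>\<phi> x\<bar> \<partial>lborel)\<^sup>2 \<le> N / \<rho> ^ Q * (bint R0 f)\<^sup>2"
      using J N1 \<rho> by (intro mult_left_mono) auto
    also have "N * \<rho>\<^sup>2 * (\<integral>x. Xsq \<phi> x \<partial>lborel) \<le> N * \<rho>\<^sup>2 * (20 * (K / (R - r)\<^sup>2 * bint R (\<lambda>x. (f x)\<^sup>2)))"
      using N1 by (intro mult_left_mono E) auto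
    also have "\<dots> = (20 * N * K / a\<^sup>2) * bint R (\<lambda>x. (f x)\<^sup>2)"
      using r by (simp add: \<rho>_def power_divide)
    also have "\<dots> \<le> 1 / 2 * bint R (\<lambda>x. (f x)\<^sup>2)"
    proof (rule mult_right_mono)
      have "0 < a\<^sup>2" using a1 by simp
      then show "20 * N * K / a\<^sup>2 \<le> 1 / 2" by (subst divide_le_eq) (simp add: a2)
    qed (simp add: integral_nonneg)
    also have "N / \<rho> ^ Q * (bint R0 f)\<^sup>2 = N * a ^ Q * (bint R0 f)\<^sup>2 / (R - r) ^ Q"
      by (simp add: \<rho>_def power_divide)
    finally show "bint r (\<lambda>x. (f x)\<^sup>2) \<le> 1 / 2 * bint R (\<lambda>x. (f x)\<^sup>2) + N * a ^ Q * (bint R0 f)\<^sup>2 / (R - r) ^ Q"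
      by simp
  qed
  show ?thesis
  proof (intro exI[of _ "A * N * a ^ Q + 1"] conjI allI impI)
    show "1 \<le> A * N * a ^ Q + 1" using A0 N1 a1 by simp
    fix f r R assume *: "cacc f" "1 \<le> r" "r < R" "R \<le> (2::real)"
    have "bint r (\<lambda>x. (f x)\<^sup>2) \<le> (A * N * a ^ Q) / (R - r) ^ Q * (bint R f)\<^sup>2"
      using main[OF *] by (simp add: mult.assoc)
    also have "\<dots> \<le> (A * N * a ^ Q + 1) / (R - r) ^ Q * (bint R f)\<^sup>2"
      using *(3) by (intro mult_right_mono divide_right_mono) auto
    finally show "bint r (\<lambda>x. (f x)\<^sup>2) \<le> (A * N * a ^ Q + 1) / (R - r) ^ Q * (bint R f)\<^sup>2" .
  qed
qed

text \<open>The constant does not depend on the exponent: this is what the lemma of Bombieri and Giusti needs.\<close>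

lemma sup_le_L1:
  "\<exists>C\<ge>1. \<forall>u \<epsilon> k r R x. sol u \<longrightarrow> (\<epsilon> = 1 \<or> \<epsilon> = -1) \<longrightarrow> 1 \<le> r \<longrightarrow> r < R \<longrightarrow> R \<le> 2 \<longrightarrow> norm x \<le> r \<longrightarrow>
     exp (\<epsilon> * (3 * 2 powi k) * u x) \<le> C / (R - r) ^ Q * bint R (\<lambda>x. exp (\<epsilon> * (3 * 2 powi k) * u x))"
proof -
  obtain C where C1: "1 \<le> C" and C: "\<forall>f r R. cacc f \<longrightarrow> 1 \<le> r \<longrightarrow> r < R \<longrightarrow> R \<le> 2 \<longrightarrow>
     bint r (\<lambda>x. (f x)\<^sup>2) \<le> C / (R - r) ^ Q * (bint R f)\<^sup>2"
    using L2_le_L1 by (elim exE conjE)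
  have "exp (\<epsilon> * (3 * 2 powi k) * u x0) \<le> (C * 4 ^ Q * 2 ^ Q) / (R - r) ^ Q * bint R (\<lambda>x. exp (\<epsilon> * (3 * 2 powi k) * u x))"
    if u: "sol u" and \<epsilon>: "\<epsilon> = 1 \<or> \<epsilon> = -1" and r: "1 \<le> r" "r < R" "R \<le> 2" and x0: "norm x0 \<le> r"
    for u \<epsilon> k r R x0
  proof -
    note C1u = sol_C1[OF u]
    define w where "w x = exp (\<epsilon> * (3 * 2 powi k) * u x)" for x
    have w0: "0 < w x" for x by (simp add: w_def)
    have cw: "continuous_on UNIV w"
      unfolding w_def[abs_def] by (intro continuous_intros C1_cont[OF C1u])
    have wn: "w x ^ (2 ^ n) = exp (\<epsilon> * (3 * 2 powi (k + int n)) * u x)" for n x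
      by (simp add: w_def exp_of_nat_mult[symmetric] power_int_add mult_ac)
    have cacc: "cacc (\<lambda>x. w x ^ (2 ^ n))" for n
      unfolding wn by (rule cacc_exp[OF u \<epsilon> _ Moser_exponent]) simp
    \<comment> \<open>The radii decrease from \<open>R\<close> only towards the midpoint of
      \<open>r\<close> and \<open>R\<close>, so a small ball about \<open>x0\<close> stays inside
      all of them.\<close>
    define \<rho> where "\<rho> n = r + (R - r) * (1 / 2 + (1 / 2) ^ Suc n)" for n :: nat
    have \<rho>: "(r + R) / 2 \<le> \<rho> n" "\<rho> n \<le> R" for n
    proof -
      have "(R - r) * (1 / 2) \<le> (R - r) * (1 / 2 + (1 / 2) ^ Suc n)"
        using r by (intro mult_left_mono) auto
      then show "(r + R) / 2 \<le> \<rho> n" by (simp add: \<rho>_def field_simps)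
      have "(1 / 2 :: real) ^ Suc n \<le> 1 / 2" by (simp add: power_le_one)
      then have "(R - r) * (1 / 2 + (1 / 2) ^ Suc n) \<le> (R - r) * 1"
        using r by (intro mult_left_mono) auto
      then show "\<rho> n \<le> R" by (simp add: \<rho>_def)
    qed
    have gap: "\<rho> n - \<rho> (Suc n) = (R - r) / 4 * (1 / 2) ^ n" for n
      by (simp add: \<rho>_def algebra_simps)
    define a where "a n = bint (\<rho> n) (\<lambda>x. w x ^ (2 ^ n))" for n
    define A where "A = C * 4 ^ Q / (R - r) ^ Q"
    have A: "0 < A" using C1 r by (simp add: A_def)
    have rec: "a (Suc n) \<le> A * (2 ^ Q) ^ n * (a n)\<^sup>2" for n
    proof -
      have "\<rho> (Suc n) < \<rho> n" using gap[of n] r by (smt (verit) divide_pos_pos mult_pos_pos zero_less_power)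
      then have "bint (\<rho> (Suc n)) (\<lambda>x. (w x ^ (2 ^ n))\<^sup>2)
          \<le> C / (\<rho> n - \<rho> (Suc n)) ^ Q * (bint (\<rho> n) (\<lambda>x. w x ^ (2 ^ n)))\<^sup>2"
        using \<rho>[of n] \<rho>[of "Suc n"] r by (intro C[rule_format] cacc) auto
      moreover have "(w x ^ (2 ^ n))\<^sup>2 = w x ^ (2 ^ Suc n)" for x by (simp add: power_mult[symmetric] mult.commute)
      moreover have "C / (\<rho> n - \<rho> (Suc n)) ^ Q = A * (2 ^ Q) ^ n"
        by (simp add: gap A_def power_mult_distrib power_divide power_mult[symmetric] mult.commute[of n])
      ultimately show ?thesis by (simp only: a_def)
    qed
    have a0: "0 \<le> a n" for n using w0 by (simp add: a_def less_imp_le integral_nonneg)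
    define z where "z = A * 2 ^ Q * a 0"
    have an: "a n \<le> z ^ (2 ^ n) / A" for n
    proof -
      have "a n \<le> z ^ (2 ^ n) / (A * (2 ^ Q) ^ Suc n)"
        unfolding z_def by (rule quadratic_recursion[OF a0 A _ rec]) simp
      also have "\<dots> \<le> z ^ (2 ^ n) / A"
      proof (rule divide_left_mono)
        have "1 \<le> ((2::real) ^ Q) ^ Suc n" by (intro one_le_power) simp
        then show "A \<le> A * (2 ^ Q) ^ Suc n" using A by simp
        show "0 \<le> z ^ (2 ^ n)" using A a0 by (simp add: z_def)
      qed (use A in auto)
      finally show ?thesis .
    qed
    \<comment> \<open>The supremum as a limit of norms: if \<open>z < y < w x0\<close>, then
      \<open>w\<close> exceeds \<open>y\<close> on a ball of volume \<open>v\<close> about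
      \<open>x0\<close>, so \<open>y ^ (2 ^ n) * v \<le> z ^ (2 ^ n) / A\<close> for all
      \<open>n\<close>, which is false for large \<open>n\<close>.\<close>
    have "w x0 \<le> z"
    proof (rule ccontr)
      assume "\<not> w x0 \<le> z"
      then have zw: "z < w x0" by simp
      define y where "y = (z + w x0) / 2"
      have y: "z < y" "y < w x0" using zw by (auto simp: y_def)
      have z0: "0 \<le> z" using A a0 by (simp add: z_def)
      have "open {x. y < w x}" by (intro open_Collect_less cw continuous_on_const)
      then obtain e where e: "0 < e" "ball x0 e \<subseteq> {x. y < w x}"
        using y(2) openE by blast
      define e' where "e' = min (e / 2) ((R - r) / 2)"
      have e': "0 < e'" "e' < e" using e r by (auto simp: e'_def)
      have e'': "e' \<le> (R - r) / 2" unfolding e'_def by (rule min.cobounded2)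
      define v where "v = measure lborel (cball x0 e')"
      have v: "0 < v" using e' content_cball_pos[of e' x0] by (simp add: v_def)
      have key: "y ^ (2 ^ n) * v \<le> z ^ (2 ^ n) / A" for n
      proof -
        have "y ^ (2 ^ n) * v = (\<integral>x. y ^ (2 ^ n) * indicator (cball x0 e') x \<partial>lborel)"
          by (simp add: v_def)
        also have "\<dots> \<le> a n"
          unfolding a_def
        proof (rule integral_mono)
          show "integrable lborel (\<lambda>x. y ^ (2 ^ n) * indicator (cball x0 e') x)"
            using emeasure_lborel_cball_finite[of x0 e'] by simp
          show "integrable lborel (\<lambda>x. w x ^ (2 ^ n) * indicator (cball 0 (\<rho> n)) x)"
            by (intro bint_integrable continuous_intros cw)
          fix x
          show "y ^ (2 ^ n) * indicator (cball x0 e') x \<le> w x ^ (2 ^ n) * indicator (cball 0 (\<rho> n)) x"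
          proof (cases "x \<in> cball x0 e'")
            case True
            then have "norm x \<le> norm x0 + e'"
              using norm_triangle_sub[of x x0] by (simp add: dist_norm norm_minus_commute)
            then have "norm x \<le> \<rho> n" using x0 e'' \<rho>(1)[of n] by (simp add: field_simps)
            moreover have "y ^ (2 ^ n) \<le> w x ^ (2 ^ n)"
              using e(2) e' True y z0 by (intro power_mono) (auto simp: subset_iff less_imp_le)
            ultimately show ?thesis using True by simp
          next
            case False
            then show ?thesis using w0 by (simp add: less_imp_le)
          qed
        qed
        also have "\<dots> \<le> z ^ (2 ^ n) / A" by (rule an)
        finally show ?thesis .
      qed
      have "0 < y * v" using y z0 v by (intro mult_pos_pos) auto
      also have "\<dots> \<le> z / A" using key[of 0] by simp
      finally have "0 < z / A" .
      then have zp: "0 < z" using A by (simp add: zero_less_divide_iff)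
      have "1 < y / z" using y zp by simp
      then obtain n where "1 / (A * v) < (y / z) ^ n" using real_arch_pow by blast
      also have "\<dots> \<le> (y / z) ^ (2 ^ n)" using \<open>1 < y / z\<close> by (intro power_increasing) auto
      finally have "z ^ (2 ^ n) / A < y ^ (2 ^ n) * v" using A v zp by (simp add: power_divide field_simps)
      with key[of n] show False by simp
    qed
    also have "z = (C * 4 ^ Q * 2 ^ Q) / (R - r) ^ Q * a 0" by (simp add: z_def A_def)
    also have "a 0 = bint R w" by (simp add: a_def \<rho>_def field_simps)
    finally show ?thesis by (simp only: w_def)
  qed
  moreover have "1 \<le> C * 4 ^ Q * 2 ^ Q"
    using C1 mult_mono[OF mult_mono[OF C1, of 1 "4 ^ Q"], of 1 "2 ^ Q"] by simp
  ultimately show ?thesis by (intro exI[of _ "C * 4 ^ Q * 2 ^ Q"] conjI) blast+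
qed

end

section \<open>Harnack inequality and conclusion\<close>

context hom_system
begin

text \<open>By the chain rule and the equation for \<open>u\<close>, the operator applied to
  \<open>F(u)\<close> is \<open>F'' + F'\<close> times the squared gradient. The condition on
  \<open>F\<close> says that \<open>exp (- F)\<close> is an affine function of
  \<open>exp (- s)\<close>.\<close>

lemma sol_comp:
  assumes u: "sol u"
    and F: "\<And>x. (F has_real_derivative F' (u x)) (at (u x))"
    and F': "\<And>x. (F' has_real_derivative F'' (u x)) (at (u x))"
    and eq: "\<And>x. F'' (u x) + F' (u x) = (F' (u x))\<^sup>2"
    and c: "continuous_on UNIV (\<lambda>x. F'' (u x))"
  shows "sol (\<lambda>x. F (u x))"
proof -
  note C1u = sol_C1[OF u]
  have C2: "Ck 2 u" using u by (simp add: sol_def)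
  have C1F': "C1 (\<lambda>x. F' (u x))" by (rule C1_comp_real[OF C1u F' c])
  have C1F: "C1 (\<lambda>x. F (u x))" by (rule C1_comp_real[OF C1u F C1_cont[OF C1F']])
  have vf: "vf_apply V (\<lambda>x. F (u x)) = (\<lambda>x. F' (u x) * vf_apply V u x)" for V
    by (simp add: fun_eq_iff vf_apply_comp_real[OF C1_diff[OF C1u] F])
  have "C1 (pderiv_j j (\<lambda>x. F (u x)))" for j
    unfolding pderiv_vf vf using C2 by (intro C1_mult C1F') (simp add: Ck2_iff flip: pderiv_vf)
  then have "Ck 2 (\<lambda>x. F (u x))" using C1_diff[OF C1F] by (simp add: Ck2_iff)
  moreover have "(\<Sum>i<m. vf_apply (X i) (vf_apply (X i) (\<lambda>x. F (u x))) x) = Xsq (\<lambda>x. F (u x)) x" for x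
  proof -
    have "(\<Sum>i<m. vf_apply (X i) (vf_apply (X i) (\<lambda>x. F (u x))) x)
        = (\<Sum>i<m. F'' (u x) * (vf_apply (X i) u x)\<^sup>2 + F' (u x) * vf_apply (X i) (vf_apply (X i) u) x)"
    proof (intro sum.cong refl)
      fix i assume "i \<in> {..<m}"
      then have i: "i < m" by simp
      show "vf_apply (X i) (vf_apply (X i) (\<lambda>x. F (u x))) x
          = F'' (u x) * (vf_apply (X i) u x)\<^sup>2 + F' (u x) * vf_apply (X i) (vf_apply (X i) u) x"
        unfolding vf
        by (simp add: vf_apply_mult[OF C1_diff[OF C1F'] C1_diff[OF Ck2_vf_C1[OF C2 i]]]
            vf_apply_comp_real[OF C1_diff[OF C1u] F'] power2_eq_square)
    qed
    also have "\<dots> = F'' (u x) * Xsq u x + F' (u x) * (\<Sum>i<m. vf_apply (X i) (vf_apply (X i) u) x)"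
      by (simp add: Xsq_def sum.distrib sum_distrib_left)
    also have "\<dots> = (F'' (u x) + F' (u x)) * Xsq u x"
      using u by (simp add: sol_def distrib_right)
    also have "\<dots> = Xsq (\<lambda>x. F (u x)) x" by (simp add: eq Xsq_comp[OF C1u F])
    finally show ?thesis .
  qed
  ultimately show ?thesis by (simp add: sol_def)
qed

lemma sol_diff_const: "sol u \<Longrightarrow> sol (\<lambda>x. u x - c)"
  by (rule sol_comp[where F = "\<lambda>s. s - c" and F' = "\<lambda>_. 1" and F'' = "\<lambda>_. 0"])
     (auto intro!: derivative_eq_intros)

lemma C1_dil:
  assumes f: "C1 f" shows "C1 (\<lambda>x. f (dil \<sigma> r x))"
proof (rule C1_I)
  show "(\<lambda>x. f (dil \<sigma> r x)) differentiable at x" for x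
    unfolding differentiable_def by (rule exI) (rule has_derivative_comp_dil[OF C1_diff[OF f]])
  fix j
  have "continuous_on UNIV (\<lambda>x. r ^ \<sigma> j * pderiv_j j f (dil \<sigma> r x))"
  proof (rule continuous_on_mult_left)
    have "continuous_on UNIV (\<lambda>x::(real, 'n) vec. dil \<sigma> r x)"
      unfolding dil_def by (intro continuous_intros)
    then show "continuous_on UNIV (\<lambda>x. pderiv_j j f (dil \<sigma> r x))"
      by (rule continuous_on_compose2[where t = UNIV, rotated]) (use f in \<open>auto simp: C1_def\<close>)
  qed
  moreover have "pderiv_j j (\<lambda>x. f (dil \<sigma> r x)) = (\<lambda>x. r ^ \<sigma> j * pderiv_j j f (dil \<sigma> r x))"
    by (rule ext) (rule pderiv_dil[OF C1_diff[OF f]])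
  ultimately show "continuous_on UNIV (pderiv_j j (\<lambda>x. f (dil \<sigma> r x)))" by (simp only:)
qed

lemma vf_apply_dil:
  assumes f: "C1 f" and i: "i < m" and r: "0 < r"
  shows "vf_apply (X i) (\<lambda>x. f (dil \<sigma> r x)) x = r * vf_apply (X i) f (dil \<sigma> r x)"
proof -
  have "dil \<sigma> r (X i x) = r *\<^sub>R X i (dil \<sigma> r x)"
    using X_hom[OF i, unfolded hom_vf_def, rule_format, OF r, of x]
    by (simp add: vec_eq_iff dil_def[of \<sigma> r "X i x"])
  moreover have "vf_apply (X i) (\<lambda>x. f (dil \<sigma> r x)) x = frechet_derivative f (at (dil \<sigma> r x)) (dil \<sigma> r (X i x))"
    by (rule vf_apply_has_derivative[OF has_derivative_comp_dil[OF C1_diff[OF f]]])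
  ultimately show ?thesis
    by (simp add: vf_apply_def linear_scale[OF linear_frechet_derivative[OF C1_diff[OF f]]])
qed

text \<open>Both sides of the equation pick up the factor \<open>r\<^sup>2\<close>.\<close>

lemma sol_dil:
  assumes u: "sol u" and r: "0 < r" shows "sol (\<lambda>x. u (dil \<sigma> r x))"
proof -
  note C1u = sol_C1[OF u]
  have C2: "Ck 2 u" using u by (simp add: sol_def)
  have "pderiv_j j (\<lambda>x. u (dil \<sigma> r x)) = (\<lambda>x. r ^ \<sigma> j * pderiv_j j u (dil \<sigma> r x))" for j
    by (rule ext) (rule pderiv_dil[OF C1_diff[OF C1u]])
  then have "C1 (pderiv_j j (\<lambda>x. u (dil \<sigma> r x)))" for j
    using C2 by (simp add: Ck2_iff C1_mult C1_const C1_dil)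
  then have "Ck 2 (\<lambda>x. u (dil \<sigma> r x))" using C1_diff[OF C1_dil[OF C1u]] by (simp add: Ck2_iff)
  moreover have "vf_apply (X i) (vf_apply (X i) (\<lambda>x. u (dil \<sigma> r x))) x
      = r\<^sup>2 * vf_apply (X i) (vf_apply (X i) u) (dil \<sigma> r x)" if i: "i < m" for i x
  proof -
    note C1v = Ck2_vf_C1[OF C2 i]
    have "vf_apply (X i) (\<lambda>x. u (dil \<sigma> r x)) = (\<lambda>x. r * vf_apply (X i) u (dil \<sigma> r x))"
      by (rule ext) (rule vf_apply_dil[OF C1u i r])
    then show ?thesis
      by (simp add: vf_apply_cmult[OF C1_diff[OF C1_dil[OF C1v]]] vf_apply_dil[OF C1v i r] power2_eq_square)
  qed
  ultimately show ?thesis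
    using u by (simp add: sol_def Xsq_def vf_apply_dil[OF C1u _ r] power_mult_distrib flip: sum_distrib_left)
qed

text \<open>\<open>Caccioppoli_weighted\<close> with the constant weight 1 bounds the energy of
  \<open>u\<close> by that of a cutoff: nothing on the right depends on \<open>u\<close>, so the
  bound is uniform over all solutions.\<close>

lemma sol_mean_square:
  "\<exists>C\<ge>0. \<forall>u. sol u \<longrightarrow> (\<exists>c. bint 2 (\<lambda>x. (u x - c)\<^sup>2) \<le> C)"
proof -
  obtain R' P where P0: "0 \<le> P" and P: "\<forall>u. C1 u \<longrightarrow>
     (\<integral>\<^sup>+x. (\<integral>\<^sup>+y. ennreal ((u y - u x)\<^sup>2) * indicator (cball 0 2) y * indicator (cball 0 2) x \<partial>lborel) \<partial>lborel)
      \<le> ennreal P * nnb R' (Xsq u)"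
    using Poincare_nn by (elim exE conjE)
  define r where "r = max 1 R'"
  obtain K where K0: "0 \<le> K" and K: "\<forall>r' R. 1 \<le> r' \<longrightarrow> r' < R \<longrightarrow> R \<le> r + 1 \<longrightarrow> (\<exists>\<eta>. C1 \<eta> \<and> (\<forall>x. 0 \<le> \<eta> x \<and> \<eta> x \<le> 1) \<and>
     (\<forall>x. norm x \<le> r' \<longrightarrow> \<eta> x = 1) \<and> (\<forall>x. R < norm x \<longrightarrow> \<eta> x = 0) \<and>
     (\<forall>x. Xsq \<eta> x \<le> K / (R - r')\<^sup>2 * indicator (cball 0 R) x))"
    using cutoff[of "r + 1"] by (elim exE conjE)
  obtain \<eta> :: "(real, 'n) vec \<Rightarrow> real" where \<eta>: "C1 \<eta>" and \<eta>1: "\<And>x. norm x \<le> r \<Longrightarrow> \<eta> x = 1" and \<eta>0: "\<And>x. r + 1 < norm x \<Longrightarrow> \<eta> x = 0"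
    using K[rule_format, of r "r + 1"] by (auto simp: r_def)
  define E where "E = 4 * (\<integral>x. Xsq \<eta> x \<partial>lborel)"
  have E0: "0 \<le> E" by (simp add: E_def Xsq_nonneg)
  define v where "v = measure lborel (cball (0::(real, 'n) vec) 2)"
  have v: "0 < v" using content_cball_pos[of 2 "0::(real, 'n) vec"] by (simp add: v_def)
  \<comment> \<open>If every constant failed, so would all values \<open>u x\<close> with
    \<open>x\<close> in the ball; integrating over these \<open>x\<close> would make the double
    integral of \<open>Poincare_nn\<close> at least \<open>P * E + 1\<close>.\<close>
  have "\<exists>c. bint 2 (\<lambda>x. (u x - c)\<^sup>2) \<le> (P * E + 1) / v" if u: "sol u" for u
  proof (rule ccontr)
    assume no: "\<not> ?thesis"
    note C1u = sol_C1[OF u]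
    have cu: "continuous_on UNIV (\<lambda>y. (u y - c)\<^sup>2)" for c by (intro continuous_intros C1_cont[OF C1u])
    have "bint R' (Xsq u) \<le> (\<integral>x. (\<eta> x)\<^sup>2 * 1 * Xsq u x \<partial>lborel)"
    proof (rule integral_mono[OF bint_integrable[OF Xsq_continuous[OF C1u]]])
      show "integrable lborel (\<lambda>x. (\<eta> x)\<^sup>2 * 1 * Xsq u x)"
        by (rule compact_support_integrable[where R = "r + 1"])
           (auto intro!: continuous_intros C1_cont[OF \<eta>] Xsq_continuous[OF C1u] simp: \<eta>0)
      show "Xsq u x * indicator (cball 0 R') x \<le> (\<eta> x)\<^sup>2 * 1 * Xsq u x" for x
        using \<eta>1[of x] by (auto simp: indicator_def r_def Xsq_nonneg)
    qed
    also have "\<dots> \<le> 4 / 1\<^sup>2 * (\<integral>x. 1 * Xsq \<eta> x \<partial>lborel)"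
      by (rule Caccioppoli_weighted[OF u, where H = "\<lambda>_. 1" and H' = "\<lambda>_. 0" and \<epsilon> = 1])
         (use \<eta> \<eta>0 in auto)
    finally have "nnb R' (Xsq u) \<le> ennreal E"
      by (simp add: nnb_eq_bint[OF Xsq_continuous[OF C1u]] Xsq_nonneg E_def ennreal_leI)
    then have "ennreal P * nnb R' (Xsq u) \<le> ennreal (P * E)"
      using P0 by (simp add: ennreal_mult' mult_left_mono)
    then have up: "(\<integral>\<^sup>+x. (\<integral>\<^sup>+y. ennreal ((u y - u x)\<^sup>2) * indicator (cball 0 2) y * indicator (cball 0 2) x \<partial>lborel) \<partial>lborel)
        \<le> ennreal (P * E)"
      using P[rule_format, OF C1u] by (rule order_trans[rotated])
    have "ennreal (P * E + 1) = (\<integral>\<^sup>+x. ennreal ((P * E + 1) / v) * indicator (cball (0::(real, 'n) vec) 2) x \<partial>lborel)"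
    proof -
      have "emeasure lborel (cball (0::(real, 'n) vec) 2) = ennreal v"
        using emeasure_lborel_cball_finite[of "0::(real, 'n) vec" 2]
        by (simp add: v_def emeasure_eq_ennreal_measure)
      then show ?thesis
        using v P0 E0 by (simp add: nn_integral_cmult_indicator flip: ennreal_mult)
    qed
    also have "\<dots> \<le> (\<integral>\<^sup>+x. (\<integral>\<^sup>+y. ennreal ((u y - u x)\<^sup>2) * indicator (cball 0 2) y * indicator (cball 0 2) x \<partial>lborel) \<partial>lborel)"
    proof (rule nn_integral_mono)
      fix x :: "(real, 'n) vec"
      have "ennreal ((P * E + 1) / v) \<le> nnb 2 (\<lambda>y. (u y - u x)\<^sup>2)"
        using no by (simp add: nnb_eq_bint[OF cu] ennreal_leI less_imp_le not_le)
      then show "ennreal ((P * E + 1) / v) * indicator (cball 0 2) x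
          \<le> (\<integral>\<^sup>+y. ennreal ((u y - u x)\<^sup>2) * indicator (cball 0 2) y * indicator (cball 0 2) x \<partial>lborel)"
        by (simp add: indicator_def)
    qed
    also note up
    finally have "ennreal (P * E + 1) \<le> ennreal (P * E)" .
    then show False using P0 E0 by (subst (asm) ennreal_le_iff) auto
  qed
  then show ?thesis using P0 E0 v by (intro exI[of _ "(P * E + 1) / v"]) auto
qed

text \<open>With L the supremum, the exponent q makes exp (q L / 2) comparable to a power of L, at most L ^ 2, so
  that the Chebyshev bound C0 / L ^ 2 for the set where the function exceeds L / 2 pays for exp (q L).\<close>

lemma sup_bound:
  "\<exists>M. \<forall>u \<epsilon> x. sol u \<longrightarrow> (\<epsilon> = 1 \<or> \<epsilon> = -1) \<longrightarrow> bint 2 (\<lambda>x. (u x)\<^sup>2) \<le> C0 \<longrightarrow> norm x \<le> 1 \<longrightarrow> \<epsilon> * u x \<le> M"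
proof -
  obtain C where C1: "1 \<le> C" and C: "\<forall>u \<epsilon> k r R x. sol u \<longrightarrow> (\<epsilon> = 1 \<or> \<epsilon> = -1) \<longrightarrow> 1 \<le> r \<longrightarrow> r < R \<longrightarrow> R \<le> 2 \<longrightarrow> norm x \<le> r \<longrightarrow>
     exp (\<epsilon> * (3 * 2 powi k) * u x) \<le> C / (R - r) ^ Q * bint R (\<lambda>x. exp (\<epsilon> * (3 * 2 powi k) * u x))"
    using sup_le_L1 by (elim exE conjE)
  have \<theta>: "0 \<le> (3 / 4 :: real)" "(3 / 4 :: real) < 1" by simp_all
  obtain A where A0: "0 \<le> A" and A: "\<forall>(f :: real \<Rightarrow> real) D B r0 R0. r0 < R0 \<longrightarrow> 0 \<le> D \<longrightarrow> (\<forall>r. r0 \<le> r \<longrightarrow> r \<le> R0 \<longrightarrow> f r \<le> B) \<longrightarrow>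
    (\<forall>r R. r0 \<le> r \<longrightarrow> r < R \<longrightarrow> R \<le> R0 \<longrightarrow> f r \<le> 3 / 4 * f R + D / (R - r) ^ (2 * Q)) \<longrightarrow>
    f r0 \<le> A * D / (R0 - r0) ^ (2 * Q)"
    using absorption[OF \<theta>, of "2 * Q"] by (elim exE conjE)
  define v where "v = measure lborel (cball (0::(real, 'n) vec) 2)"
  define W where "W = v + 4 * \<bar>C0\<bar> + 1"
  have v0: "0 \<le> v" by (simp add: v_def)
  have W1: "1 \<le> W" using v0 by (simp add: W_def)
  define D where "D = 3 + (C * W)\<^sup>2"
  have "\<epsilon> * u x0 \<le> A * D / (2 - 1) ^ (2 * Q)"
    if u: "sol u" and \<epsilon>: "\<epsilon> = 1 \<or> \<epsilon> = -1" and L2: "bint 2 (\<lambda>x. (u x)\<^sup>2) \<le> C0" and x0: "norm x0 \<le> 1" for u \<epsilon> x0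
  proof -
    note C1u = sol_C1[OF u]
    have cu: "continuous_on S u" for S by (rule C1_cont[OF C1u])
    define s where "s x = max 0 (\<epsilon> * u x)" for x
    have cs: "continuous_on S s" for S unfolding s_def[abs_def] by (intro continuous_intros cu)
    have bdd: "bdd_above (s ` cball 0 r)" for r
      by (intro bounded_imp_bdd_above compact_imp_bounded compact_continuous_image cs compact_cball)
    define f where "f r = (SUP x\<in>cball 0 r. s x)" for r :: real
    have sf: "s x \<le> f r" if "norm x \<le> r" for x r
      unfolding f_def using that by (intro cSUP_upper bdd) auto
    have f_le: "f r \<le> b" if "0 \<le> r" "\<And>x. norm x \<le> r \<Longrightarrow> s x \<le> b" for r b
      unfolding f_def using that by (intro cSUP_least) auto
    have f0: "0 \<le> f r" if "0 \<le> r" for r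
      using sf[of 0 r] that by (auto simp: s_def)
    have fm: "f r \<le> f R" if "0 \<le> r" "r \<le> R" for r R
      using that by (intro f_le sf) auto
    have "f 1 \<le> A * D / (2 - 1) ^ (2 * Q)"
    proof (rule A[rule_format, where B = "f 2"])
      show "0 \<le> D" by (simp add: D_def)
      show "f r \<le> f 2" if "1 \<le> r" "r \<le> 2" for r using that by (intro fm) auto
      fix r R :: real assume r: "1 \<le> r" "r < R" "R \<le> 2"
      define L where "L = f R"
      define g where "g = R - r"
      have g: "0 < g" "g \<le> 1" using r by (auto simp: g_def)
      define H where "H = C * W / g ^ Q"
      have gQ: "0 < g ^ Q" "g ^ Q \<le> 1" using g by (auto intro: power_le_one)
      have H1: "1 \<le> H"
      proof -
        have "1 * 1 \<le> C * W" using C1 W1 by (intro mult_mono) auto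
        then show ?thesis using gQ by (simp add: H_def)
      qed
      have H2: "H\<^sup>2 = (C * W)\<^sup>2 / g ^ (2 * Q)" by (simp add: H_def power_divide power_mult[symmetric] mult.commute)
      show "f r \<le> 3 / 4 * f R + D / (R - r) ^ (2 * Q)"
      \<comment> \<open>A small \<open>L\<close> is covered by the error term alone. Comparing with
        \<open>H\<^sup>2\<close> produces the power \<open>2 * Q\<close> in the absorption.\<close>
      proof (cases "L \<le> 3 \<or> L \<le> H\<^sup>2")
        case True
        have "f r \<le> L" unfolding L_def using r by (intro fm) auto
        also have "L \<le> 3 + H\<^sup>2" using True by (auto intro: add_increasing add_increasing2)
        also have "3 \<le> 3 / g ^ (2 * Q)" using g by (subst le_divide_eq) (simp add: power_le_one)
        also have "3 / g ^ (2 * Q) + H\<^sup>2 = D / g ^ (2 * Q)" by (simp add: H2 D_def add_divide_distrib)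
        also have "\<dots> \<le> 3 / 4 * f R + D / g ^ (2 * Q)" using f0[of R] r by simp
        finally show ?thesis by (simp add: g_def)
      next
        case False
        then have L3: "3 < L" and LH: "H\<^sup>2 < L" by auto
        define l where "l = ln L"
        have l0: "0 < l" using L3 by (simp add: l_def)
        have lH: "ln H \<le> l / 2"
        proof -
          have "2 * ln H = ln (H\<^sup>2)" using H1 by (simp add: ln_realpow)
          also have "\<dots> \<le> l" unfolding l_def using LH H1 by (intro ln_mono) auto
          finally show ?thesis by simp
        qed
        \<comment> \<open>The exponent is \<open>2 * l / L\<close> up to a factor of 2, rounded to
          an admissible one. Its lower bound gives \<open>ln H \<le> q * L / 4\<close>, its upper
          bound \<open>e \<le> L\<^sup>2\<close>.\<close>
        obtain k where k: "2 * l / L \<le> 3 * 2 powi k" "3 * 2 powi k \<le> 2 * (2 * l / L)"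
          using ex_dyadic[of "2 * l / L"] l0 L3 by auto
        define q :: real where "q = 3 * 2 powi k"
        have q0: "0 < q" by (simp add: q_def)
        have ql: "2 * l \<le> q * L" "q * L \<le> 4 * l"
          using k L3 by (simp_all add: q_def[symmetric] field_simps)
        define e where "e = exp (q * L / 2)"
        have e0: "0 < e" by (simp add: e_def)
        have "e \<le> exp (2 * l)" using ql by (simp add: e_def)
        also have "exp (2 * l) = L\<^sup>2" using L3 by (simp add: l_def exp_double)
        finally have eL: "e \<le> L\<^sup>2" .
        have pw: "exp (\<epsilon> * q * u x) \<le> e + e * (4 * (u x)\<^sup>2)" if x: "norm x \<le> R" for x
        proof (cases "\<epsilon> * u x \<le> L / 2")
          case True
          then have "\<epsilon> * q * u x \<le> q * L / 2" using mult_left_mono[OF True, of q] q0 by (simp add: mult_ac)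
          then have "exp (\<epsilon> * q * u x) \<le> e" by (simp add: e_def)
          then show ?thesis using e0 by (simp add: add_increasing2)
        next
          case False
          have "\<epsilon> * u x \<le> L" using sf[OF x] by (simp add: L_def s_def)
          then have "\<epsilon> * q * u x \<le> q * L" using mult_left_mono[of "\<epsilon> * u x" L q] q0 by (simp add: mult_ac)
          then have "exp (\<epsilon> * q * u x) \<le> exp (q * L)" by simp
          also have "exp (q * L) = e * e" by (simp add: e_def exp_add[symmetric])
          also have "\<dots> \<le> e * L\<^sup>2" using eL e0 by simp
          also have "L\<^sup>2 \<le> 4 * (u x)\<^sup>2"
          proof -
            have "(L / 2)\<^sup>2 \<le> (\<epsilon> * u x)\<^sup>2" using False L3 by (intro power_mono) auto
            moreover have "(\<epsilon> * u x)\<^sup>2 = (u x)\<^sup>2" using \<epsilon> by auto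
            ultimately show ?thesis by (simp add: power_divide)
          qed
          finally show ?thesis using e0 by simp
        qed
        have B: "bint R (\<lambda>x. exp (\<epsilon> * q * u x)) \<le> e * W"
        proof -
          have c1: "continuous_on UNIV (\<lambda>x. (u x)\<^sup>2)" by (intro continuous_intros cu)
          have "bint R (\<lambda>x. exp (\<epsilon> * q * u x)) \<le> bint R (\<lambda>x. e + e * (4 * (u x)\<^sup>2))"
            by (intro bint_mono continuous_intros cu pw)
          also have "\<dots> \<le> bint 2 (\<lambda>x. e + e * (4 * (u x)\<^sup>2))"
            using r e0 by (intro bint_mono_R continuous_intros cu) auto
          also have "\<dots> = (\<integral>x. e * indicator (cball (0::(real, 'n) vec) 2) x + 4 * e * ((u x)\<^sup>2 * indicator (cball 0 2) x) \<partial>lborel)"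
            by (intro Bochner_Integration.integral_cong) (auto simp: algebra_simps)
          also have "\<dots> = e * v + 4 * e * bint 2 (\<lambda>x. (u x)\<^sup>2)"
            using bint_integrable[OF c1, of 2] emeasure_lborel_cball_finite[of "0::(real, 'n) vec" 2]
            by (subst Bochner_Integration.integral_add) (auto simp: v_def)
          also have "\<dots> \<le> e * v + 4 * e * \<bar>C0\<bar>"
            using L2 e0 by (intro add_left_mono mult_left_mono) auto
          also have "\<dots> \<le> e * W" using e0 by (simp add: W_def algebra_simps)
          finally show ?thesis .
        qed
        have "s x \<le> 3 / 4 * L" if x: "norm x \<le> r" for x
        proof -
          have "exp (\<epsilon> * q * u x) \<le> C / (R - r) ^ Q * bint R (\<lambda>x. exp (\<epsilon> * q * u x))"
            unfolding q_def by (rule C[rule_format]) (use u \<epsilon> r x in auto)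
          also have "\<dots> \<le> C / (R - r) ^ Q * (e * W)"
            using C1 r by (intro mult_left_mono B) auto
          also have "\<dots> = exp (ln H + q * L / 2)"
            using H1 by (simp add: exp_add e_def H_def g_def)
          finally have "\<epsilon> * q * u x \<le> ln H + q * L / 2" by simp
          \<comment> \<open>\<open>q * L / 4\<close> from \<open>ln H\<close> and
            \<open>q * L / 2\<close> from \<open>e\<close> make up the factor 3/4.\<close>
          then have "q * (\<epsilon> * u x) \<le> q * (3 / 4 * L)" using lH ql by (simp add: mult_ac)
          then have "\<epsilon> * u x \<le> 3 / 4 * L" using q0 by (simp only: mult_le_cancel_left_pos)
          then show ?thesis using L3 by (simp add: s_def)
        qed
        then have "f r \<le> 3 / 4 * L" using r by (intro f_le) auto
        then show ?thesis using g by (simp add: L_def g_def D_def add_increasing2)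
      qed
    qed simp
    then show ?thesis using sf[of x0 1] x0 by (simp add: s_def)
  qed
  then show ?thesis by blast
qed

lemma oscillation_bound: "\<exists>M. \<forall>u x y. sol u \<longrightarrow> u x - u y \<le> M"
proof -
  obtain C0 where C0: "\<forall>u. sol u \<longrightarrow> (\<exists>c. bint 2 (\<lambda>x. (u x - c)\<^sup>2) \<le> C0)"
    using sol_mean_square by blast
  obtain M where M: "\<forall>u \<epsilon> x. sol u \<longrightarrow> (\<epsilon> = 1 \<or> \<epsilon> = -1) \<longrightarrow> bint 2 (\<lambda>x. (u x)\<^sup>2) \<le> C0 \<longrightarrow> norm x \<le> 1 \<longrightarrow> \<epsilon> * u x \<le> M"
    using sup_bound by blast
  have unit: "u x - u y \<le> 2 * M" if u: "sol u" and x: "norm x \<le> 1" "norm y \<le> 1" for u x y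
  proof -
    obtain c where c: "bint 2 (\<lambda>x. (u x - c)\<^sup>2) \<le> C0" using C0 u by blast
    have "1 * (u x - c) \<le> M" by (rule M[rule_format, OF sol_diff_const[OF u] _ c]) (use x in auto)
    moreover have "-1 * (u y - c) \<le> M" by (rule M[rule_format, OF sol_diff_const[OF u] _ c]) (use x in auto)
    ultimately show ?thesis by simp
  qed
  have "u x - u y \<le> 2 * M" if u: "sol u" for u x y
  proof -
    have ev: "\<forall>\<^sub>F t in at_right 0. norm (dil \<sigma> t z) < 1" for z :: "(real, 'n) vec"
      using tendstoD[OF dil_tendsto_zero[of \<sigma> z, OF sigma_pos], of 1] by simp
    have "\<forall>\<^sub>F t::real in at_right 0. 0 < t" by (simp add: eventually_at_filter)
    from eventually_conj[OF this eventually_conj[OF ev[of x] ev[of y]]]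
    obtain t where t: "0 < t" "norm (dil \<sigma> t x) < 1" "norm (dil \<sigma> t y) < 1"
      using eventually_happens'[OF trivial_limit_at_right_real] by blast
    have inv: "dil \<sigma> (inverse t) (dil \<sigma> t z) = z" for z
      using dil_inverse[of "inverse t" z] t by simp
    show ?thesis
      using unit[OF sol_dil[OF u, of "inverse t"], of "dil \<sigma> t x" "dil \<sigma> t y"] t by (simp add: inv)
  qed
  then show ?thesis by blast
qed

lemma sol_shift_positive:
  assumes u: "sol u" and a: "\<And>x. a < exp (- u x)"
  shows "sol (\<lambda>x. - ln (exp (- u x) - a))"
proof (rule sol_comp[OF u, where F = "\<lambda>s. - ln (exp (- s) - a)"
      and F' = "\<lambda>s. exp (- s) / (exp (- s) - a)" and F'' = "\<lambda>s. a * exp (- s) / (exp (- s) - a)\<^sup>2"])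
  fix x
  have p: "0 < exp (- u x) - a" using a[of x] by simp
  show "((\<lambda>s. - ln (exp (- s) - a)) has_real_derivative exp (- u x) / (exp (- u x) - a)) (at (u x))"
    using p by (auto intro!: derivative_eq_intros)
  show "((\<lambda>s. exp (- s) / (exp (- s) - a)) has_real_derivative a * exp (- u x) / (exp (- u x) - a)\<^sup>2) (at (u x))"
    using p by (auto intro!: derivative_eq_intros simp: field_simps power2_eq_square)
  show "a * exp (- u x) / (exp (- u x) - a)\<^sup>2 + exp (- u x) / (exp (- u x) - a) = (exp (- u x) / (exp (- u x) - a))\<^sup>2"
  proof -
    define w where "w = exp (- u x) - a"
    have w: "0 < w" "a = exp (- u x) - w" using p by (simp_all add: w_def)
    show ?thesis unfolding w_def[symmetric] using w(1)
      by (subst w(2)) (simp add: field_simps power2_eq_square)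
  qed
next
  have "(exp (- u x) - a)\<^sup>2 \<noteq> 0" for x using a[of x] by simp
  then show "continuous_on UNIV (\<lambda>x. a * exp (- u x) / (exp (- u x) - a)\<^sup>2)"
    by (intro continuous_intros C1_cont[OF sol_C1[OF u]]) auto
qed

text \<open>For the shifted solutions the oscillation bound reads
  \<open>exp (- u y) - a \<le> exp M * (exp (- u x) - a)\<close>, a Harnack inequality whose
  constant does not depend on \<open>a\<close>.\<close>

lemma sol_constant:
  assumes u: "sol u" shows "\<exists>c. \<forall>x. u x = c"
proof -
  obtain M where M: "\<forall>u x y. sol u \<longrightarrow> u x - u y \<le> M" using oscillation_bound by blast
  define I where "I = (INF x. exp (- u x))"
  have bdd: "bdd_below (range (\<lambda>x. exp (- u x)))" by (intro bdd_belowI[of _ 0]) auto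
  have I: "I \<le> exp (- u x)" for x unfolding I_def by (intro cINF_lower bdd) simp
  have "exp (- u y) \<le> I" for y
  proof (rule field_le_epsilon)
    fix e :: real assume e: "0 < e"
    \<comment> \<open>With \<open>a = I - d\<close>, strictly below the infimum, and a point
      \<open>x\<close> whose value is within \<open>d\<close> of it, the right side is at most
      \<open>exp M * (2 * d) = e\<close>.\<close>
    define d where "d = e / (2 * exp M)"
    have d: "0 < d" using e by (simp add: d_def)
    have "\<exists>x. exp (- u x) < I + d"
      using d cINF_less_iff[OF _ bdd, of "I + d"] by (auto simp: I_def)
    then obtain x where x: "exp (- u x) < I + d" by blast
    have p: "I - d < exp (- u z)" for z using I[of z] d by linarith
    have "- ln (exp (- u x) - (I - d)) - - ln (exp (- u y) - (I - d)) \<le> M"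
      using M sol_shift_positive[OF u p] by blast
    then have "ln (exp (- u y) - (I - d)) \<le> M + ln (exp (- u x) - (I - d))" by simp
    then have "exp (ln (exp (- u y) - (I - d))) \<le> exp (M + ln (exp (- u x) - (I - d)))" by simp
    then have "exp (- u y) - (I - d) \<le> exp M * (exp (- u x) - (I - d))"
      using p[of x] p[of y] by (simp add: exp_add)
    also have "\<dots> \<le> exp M * (2 * d)" using x by (intro mult_left_mono) auto
    also have "\<dots> = e" by (simp add: d_def)
    finally show "exp (- u y) \<le> I + e" using d by linarith
  qed
  then have "exp (- u y) = I" for y using I[of y] by (simp add: order_antisym)
  then have "exp (- u x) = exp (- u y)" for x y by simp
  then have "u x = u y" for x y by simp
  then show ?thesis by blast
qed

end

theorem theorem6p2:
  fixes \<sigma> :: "'n::{finite,linorder} \<Rightarrow> nat"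
    and X :: "nat \<Rightarrow> (real, 'n) vec \<Rightarrow> (real, 'n) vec"
    and m :: nat and u :: "(real, 'n) vec \<Rightarrow> real"
  assumes N3: "CARD('n) \<ge> 3"
    and mN: "m \<le> CARD('n)"
    and smooth: "\<forall>i<m. smooth_vf (X i)"
    and indep: "vf_lin_indep X m"
    and sigma_pos: "\<forall>j. 1 \<le> \<sigma> j"
    and sigma_mono: "\<forall>j k. j \<le> k \<longrightarrow> \<sigma> j \<le> \<sigma> k"
    and sigma_first: "\<sigma> (LEAST j. True) = 1"
    and homog: "\<forall>i<m. homogeneous_deg1 \<sigma> (X i)"
    and hoer: "hoermander X m"
    and C2: "Ck 2 u"
    and eq: "\<forall>x. - (\<Sum>i<m. vf_apply (X i) (vf_apply (X i) u) x)
                 + (\<Sum>i<m. (vf_apply (X i) u x)\<^sup>2) = 0"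
  shows "\<exists>c. \<forall>x. u x = c"
proof -
  interpret hom_system \<sigma> X m
    by unfold_locales (use sigma_pos sigma_mono smooth homog hoer in auto)
  have "sol u"
    using C2 eq by (simp add: sol_def Xsq_def)
  then show ?thesis by (rule sol_constant)
qed

end
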